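(* Let $p$ be a prime number, let $R$ be a $p$-adically complete Noetherian integral domain of finite Krull dimension whose field of fractions has characteristic zero, and let $G$ be a finite group. For every positive integer $n$ with $p^n>2$, the reduction map $\mathrm{K}_2(R[G])\to \mathrm{K}_2(R_n[G])$ is surjective, where $R_n=R/p^nR$.
   Context: $R$ is $p$-adically complete means that the natural map $R\to\varprojlim_n R/p^nR$ is an isomorphism. $\mathrm{K}_2$ is Milnor's $\mathrm{K}_2$ of a unital ring. *)

theory Defs
  imports
    "HOL-Algebra.Ring_Divisibility"
    "HOL-Library.Extended_Nat"
    "HOL-Computational_Algebra.Primes"
begin

text \<open>A letter is a generator together with a sign; \<^term>\<open>(g, True)\<close> stands for \<open>g\<close> and
  \<^term>\<open>(g, False)\<close> for its formal inverse.\<close>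

type_synonym 'g word = "('g \<times> bool) list"

definition words :: "'g set \<Rightarrow> 'g word set"
  where "words X = lists (X \<times> UNIV)"

inductive pres_eq :: "'g set \<Rightarrow> ('g word \<times> 'g word) set \<Rightarrow> 'g word \<Rightarrow> 'g word \<Rightarrow> bool"
  for X :: "'g set" and S :: "('g word \<times> 'g word) set" where
  pres_refl: "w \<in> words X \<Longrightarrow> pres_eq X S w w"
| pres_sym: "pres_eq X S u v \<Longrightarrow> pres_eq X S v u"
| pres_trans: "pres_eq X S u v \<Longrightarrow> pres_eq X S v w \<Longrightarrow> pres_eq X S u w"
| pres_append: "pres_eq X S u u' \<Longrightarrow> pres_eq X S v v' \<Longrightarrow> pres_eq X S (u @ v) (u' @ v')"
| pres_cancel: "g \<in> X \<Longrightarrow> pres_eq X S [(g, b), (g, \<not> b)] []"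
| pres_rel: "(u, v) \<in> S \<Longrightarrow> u \<in> words X \<Longrightarrow> v \<in> words X \<Longrightarrow> pres_eq X S u v"

definition pres_class :: "'g set \<Rightarrow> ('g word \<times> 'g word) set \<Rightarrow> 'g word \<Rightarrow> 'g word set"
  where "pres_class X S w = {v. pres_eq X S w v}"

definition presented_group :: "'g set \<Rightarrow> ('g word \<times> 'g word) set \<Rightarrow> 'g word set monoid"
  where "presented_group X S =
    \<lparr> carrier = words X // {(u, v). pres_eq X S u v},
      mult = (\<lambda>A B. \<Union>u\<in>A. \<Union>v\<in>B. pres_class X S (u @ v)),
      one = pres_class X S [] \<rparr>"

definition word_eval :: "('h, 'c) monoid_scheme \<Rightarrow> ('g \<Rightarrow> 'h) \<Rightarrow> 'g word \<Rightarrow> 'h"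
  where "word_eval H \<phi> w =
    foldr (\<lambda>(g, b) h. (if b then \<phi> g else inv\<^bsub>H\<^esub> (\<phi> g)) \<otimes>\<^bsub>H\<^esub> h) w \<one>\<^bsub>H\<^esub>"

text \<open>The homomorphism out of a presented group determined by the images \<open>\<phi>\<close> of the generators.
  It is meaningful when \<open>\<phi>\<close> respects the relations, so that \<^const>\<open>word_eval\<close> is constant on
  each class.\<close>

definition pres_lift :: "('h, 'c) monoid_scheme \<Rightarrow> ('g \<Rightarrow> 'h) \<Rightarrow> 'g word set \<Rightarrow> 'h"
  where "pres_lift H \<phi> A = the_elem (word_eval H \<phi> ` A)"

lemma pres_eq_words: "pres_eq X S u v \<Longrightarrow> u \<in> words X \<and> v \<in> words X"
  by (induction rule: pres_eq.induct) (auto simp: words_def)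

lemma pres_equiv: "equiv (words X) {(u, v). pres_eq X S u v}"
proof (rule equivI)
  show "{(u, v). pres_eq X S u v} \<subseteq> words X \<times> words X"
    by (auto dest: pres_eq_words)
  show "refl_on (words X) {(u, v). pres_eq X S u v}"
    by (auto simp: refl_on_def intro: pres_refl)
  show "sym {(u, v). pres_eq X S u v}"
    using pres_sym by (fastforce simp: sym_def)
  show "trans {(u, v). pres_eq X S u v}"
    unfolding trans_def using pres_trans[of X S] by blast
qed

lemma pres_class_Image: "pres_class X S w = {(u, v). pres_eq X S u v} `` {w}"
  by (auto simp: pres_class_def)

lemma pres_class_eqI: "pres_eq X S u v \<Longrightarrow> pres_class X S u = pres_class X S v"
  unfolding pres_class_def using pres_sym[of X S] pres_trans[of X S] by blast

lemma presented_carrier: "carrier (presented_group X S) = pres_class X S ` words X"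
  by (auto simp: presented_group_def quotient_def pres_class_Image)

lemma presented_one: "\<one>\<^bsub>presented_group X S\<^esub> = pres_class X S []"
  by (simp add: presented_group_def)

lemma presented_mult:
  assumes "u \<in> words X" "v \<in> words X"
  shows "pres_class X S u \<otimes>\<^bsub>presented_group X S\<^esub> pres_class X S v = pres_class X S (u @ v)"
proof -
  have eq: "pres_class X S (u' @ v') = pres_class X S (u @ v)"
    if "u' \<in> pres_class X S u" "v' \<in> pres_class X S v" for u' v'
    using that pres_class_eqI[OF pres_append, of X S u u' v v'] by (simp add: pres_class_def)
  have "u \<in> pres_class X S u" "v \<in> pres_class X S v"
    using assms by (auto simp: pres_class_def intro: pres_refl)
  then have "(\<Union>u'\<in>pres_class X S u. \<Union>v'\<in>pres_class X S v. pres_class X S (u @ v)) =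
      pres_class X S (u @ v)"
    by blast
  moreover have "pres_class X S u \<otimes>\<^bsub>presented_group X S\<^esub> pres_class X S v =
      (\<Union>u'\<in>pres_class X S u. \<Union>v'\<in>pres_class X S v. pres_class X S (u @ v))"
    by (auto simp: presented_group_def eq)
  ultimately show ?thesis by simp
qed

definition word_inv :: "'g word \<Rightarrow> 'g word"
  where "word_inv w = rev (map (\<lambda>(g, b). (g, \<not> b)) w)"

lemma word_inv_words: "w \<in> words X \<Longrightarrow> word_inv w \<in> words X"
  by (auto simp: word_inv_def words_def in_lists_conv_set)

lemma word_inv_cancel: "w \<in> words X \<Longrightarrow> pres_eq X S (word_inv w @ w) []"
proof (induction w)
  case Nil
  then show ?case by (auto simp: word_inv_def words_def intro: pres_refl)
next
  case (Cons a w)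
  obtain g b where a: "a = (g, b)" by (cases a)
  have w: "w \<in> words X" "g \<in> X" using Cons a by (auto simp: words_def)
  have 0: "pres_eq X S ([(g, \<not> b), (g, b)] @ w) ([] @ w)"
    using pres_cancel[of g X S "\<not> b"] w by (intro pres_append pres_refl) simp_all
  have "pres_eq X S (word_inv w @ ([(g, \<not> b), (g, b)] @ w)) (word_inv w @ w)"
    using 0 word_inv_words[OF w(1)] by (intro pres_append pres_refl) simp_all
  from pres_trans[OF this Cons.IH[OF w(1)]] show ?case
    by (simp add: a word_inv_def)
qed

lemma presented_group_group: "group (presented_group X S)"
proof (rule groupI)
  have app: "u @ v \<in> words X" if "u \<in> words X" "v \<in> words X" for u v
    using that by (auto simp: words_def)
  have nil: "[] \<in> words X" by (auto simp: words_def)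
  fix x assume x: "x \<in> carrier (presented_group X S)"
  then obtain u where u: "u \<in> words X" "x = pres_class X S u" by (auto simp: presented_carrier)
  show "\<one>\<^bsub>presented_group X S\<^esub> \<otimes>\<^bsub>presented_group X S\<^esub> x = x"
    using u nil by (simp add: presented_one presented_mult)
  show "\<exists>y\<in>carrier (presented_group X S). y \<otimes>\<^bsub>presented_group X S\<^esub> x = \<one>\<^bsub>presented_group X S\<^esub>"
    using u word_inv_words[OF u(1)] pres_class_eqI[OF word_inv_cancel[OF u(1)], of S]
    by (intro bexI[of _ "pres_class X S (word_inv u)"])
      (simp_all add: presented_carrier presented_mult presented_one)
  fix y assume y: "y \<in> carrier (presented_group X S)"
  then obtain v where v: "v \<in> words X" "y = pres_class X S v" by (auto simp: presented_carrier)
  show "x \<otimes>\<^bsub>presented_group X S\<^esub> y \<in> carrier (presented_group X S)"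
    using u v app by (simp add: presented_carrier presented_mult)
  fix z assume "z \<in> carrier (presented_group X S)"
  then obtain w where w: "w \<in> words X" "z = pres_class X S w" by (auto simp: presented_carrier)
  show "x \<otimes>\<^bsub>presented_group X S\<^esub> y \<otimes>\<^bsub>presented_group X S\<^esub> z =
      x \<otimes>\<^bsub>presented_group X S\<^esub> (y \<otimes>\<^bsub>presented_group X S\<^esub> z)"
    using u v w app by (simp add: presented_mult)
next
  show "\<one>\<^bsub>presented_group X S\<^esub> \<in> carrier (presented_group X S)"
    unfolding presented_carrier presented_one by (rule imageI) (simp add: words_def)
qed

locale pres_images = group H for H (structure) +
  fixes X :: "'g set" and S :: "('g word \<times> 'g word) set" and \<phi> :: "'g \<Rightarrow> 'a"
  assumes img: "g \<in> X \<Longrightarrow> \<phi> g \<in> carrier H"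
    and rels: "(u, v) \<in> S \<Longrightarrow> u \<in> words X \<Longrightarrow> v \<in> words X \<Longrightarrow> word_eval H \<phi> u = word_eval H \<phi> v"
begin

lemma eval_Nil [simp]: "word_eval H \<phi> [] = \<one>"
  by (simp add: word_eval_def)

lemma eval_Cons [simp]:
  "word_eval H \<phi> ((g, b) # w) = (if b then \<phi> g else inv (\<phi> g)) \<otimes> word_eval H \<phi> w"
  by (simp add: word_eval_def)

lemma eval_closed: "w \<in> words X \<Longrightarrow> word_eval H \<phi> w \<in> carrier H"
  by (induction w) (auto simp: words_def intro!: m_closed img inv_closed)

lemma eval_append:
  "u \<in> words X \<Longrightarrow> v \<in> words X \<Longrightarrow> word_eval H \<phi> (u @ v) = word_eval H \<phi> u \<otimes> word_eval H \<phi> v"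
proof (induction u)
  case Nil
  then show ?case by (simp add: eval_closed)
next
  case (Cons a u)
  obtain g b where a: "a = (g, b)" by (cases a)
  have "u \<in> words X" "g \<in> X" using Cons a by (auto simp: words_def)
  then show ?case using Cons img[of g] by (auto simp: a m_assoc eval_closed)
qed

lemma eval_eq: "pres_eq X S u v \<Longrightarrow> word_eval H \<phi> u = word_eval H \<phi> v"
proof (induction rule: pres_eq.induct)
  case (pres_append u u' v v')
  then show ?case using pres_eq_words[OF pres_append(1)] pres_eq_words[OF pres_append(2)]
    by (simp add: eval_append)
next
  case (pres_cancel g b)
  then show ?case using img[of g] by auto
qed (auto intro: rels)

lemma lift_class: "w \<in> words X \<Longrightarrow> pres_lift H \<phi> (pres_class X S w) = word_eval H \<phi> w"
proof -
  assume w: "w \<in> words X"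
  have "word_eval H \<phi> ` pres_class X S w = {word_eval H \<phi> w}"
  proof (intro equalityI subsetI)
    fix y assume "y \<in> word_eval H \<phi> ` pres_class X S w"
    then obtain v where "pres_eq X S w v" "y = word_eval H \<phi> v" by (auto simp: pres_class_def)
    with eval_eq[of w v] show "y \<in> {word_eval H \<phi> w}" by simp
  qed (use pres_refl[OF w, of S] in \<open>auto simp: pres_class_def\<close>)
  then show ?thesis by (simp add: pres_lift_def)
qed

lemma lift_hom: "pres_lift H \<phi> \<in> hom (presented_group X S) H"
proof (rule homI)
  fix x assume "x \<in> carrier (presented_group X S)"
  then obtain u where u: "u \<in> words X" "x = pres_class X S u" by (auto simp: presented_carrier)
  then show "pres_lift H \<phi> x \<in> carrier H" by (simp add: lift_class eval_closed)
  fix y assume "y \<in> carrier (presented_group X S)"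
  then obtain v where v: "v \<in> words X" "y = pres_class X S v" by (auto simp: presented_carrier)
  have "u @ v \<in> words X" using u v by (auto simp: words_def)
  then show "pres_lift H \<phi> (x \<otimes>\<^bsub>presented_group X S\<^esub> y) = pres_lift H \<phi> x \<otimes> pres_lift H \<phi> y"
    using u v by (simp add: presented_mult lift_class eval_append)
qed

end

text \<open>In the Steinberg group the generator \<open>(i, j, r)\<close> is \<open>x\<^sub>i\<^sub>j(r)\<close>. Matrix indices range over all of \<^typ>\<open>nat\<close>.\<close>

type_synonym 'a st_gen = "nat \<times> nat \<times> 'a"

definition st_gens :: "('a, 'b) ring_scheme \<Rightarrow> 'a st_gen set"
  where "st_gens R = {(i, j, r). i \<noteq> j \<and> r \<in> carrier R}"

definition comm_word :: "'g \<Rightarrow> 'g \<Rightarrow> 'g word"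
  where "comm_word g h = [(g, True), (h, True), (g, False), (h, False)]"

inductive_set st_rels :: "('a, 'b) ring_scheme \<Rightarrow> ('a st_gen word \<times> 'a st_gen word) set"
  for R :: "('a, 'b) ring_scheme" where
  st_add: "i \<noteq> j \<Longrightarrow> r \<in> carrier R \<Longrightarrow> s \<in> carrier R \<Longrightarrow>
    ([((i, j, r), True), ((i, j, s), True)], [((i, j, r \<oplus>\<^bsub>R\<^esub> s), True)]) \<in> st_rels R"
| st_comm: "i \<noteq> j \<Longrightarrow> j \<noteq> k \<Longrightarrow> i \<noteq> k \<Longrightarrow> r \<in> carrier R \<Longrightarrow> s \<in> carrier R \<Longrightarrow>
    (comm_word (i, j, r) (j, k, s), [((i, k, r \<otimes>\<^bsub>R\<^esub> s), True)]) \<in> st_rels R"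
| st_commute: "i \<noteq> j \<Longrightarrow> k \<noteq> l \<Longrightarrow> j \<noteq> k \<Longrightarrow> i \<noteq> l \<Longrightarrow> r \<in> carrier R \<Longrightarrow> s \<in> carrier R \<Longrightarrow>
    (comm_word (i, j, r) (k, l, s), []) \<in> st_rels R"

definition Steinberg :: "('a, 'b) ring_scheme \<Rightarrow> 'a st_gen word set monoid"
  where "Steinberg R = presented_group (st_gens R) (st_rels R)"

definition st_elem :: "('a, 'b) ring_scheme \<Rightarrow> nat \<Rightarrow> nat \<Rightarrow> 'a \<Rightarrow> 'a st_gen word set"
  where "st_elem R i j r = pres_class (st_gens R) (st_rels R) [((i, j, r), True)]"

text \<open>Infinite matrices that differ from the identity in finitely many entries. The unit group of
  this monoid is the union of the groups \<open>GL\<^sub>n(R)\<close> along \<open>A \<mapsto> diag(A, 1)\<close>. The sum in the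
  product is restricted to the finitely many nonzero entries of a row because \<^const>\<open>finsum\<close>
  over an infinite set is trivial.\<close>

definition id_mat :: "('a, 'b) ring_scheme \<Rightarrow> nat \<Rightarrow> nat \<Rightarrow> 'a"
  where "id_mat R i j = (if i = j then \<one>\<^bsub>R\<^esub> else \<zero>\<^bsub>R\<^esub>)"

definition finitary_matrices :: "('a, 'b) ring_scheme \<Rightarrow> (nat \<Rightarrow> nat \<Rightarrow> 'a) monoid"
  where "finitary_matrices R =
    \<lparr> carrier = {A. (\<forall>i j. A i j \<in> carrier R) \<and> finite {(i, j). A i j \<noteq> id_mat R i j}},
      mult = (\<lambda>A B i k. \<Oplus>\<^bsub>R\<^esub>j\<in>{j. A i j \<noteq> \<zero>\<^bsub>R\<^esub>}. A i j \<otimes>\<^bsub>R\<^esub> B j k),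
      one = id_mat R \<rparr>"

definition GL :: "('a, 'b) ring_scheme \<Rightarrow> (nat \<Rightarrow> nat \<Rightarrow> 'a) monoid"
  where "GL R = units_of (finitary_matrices R)"

definition elem_mat :: "('a, 'b) ring_scheme \<Rightarrow> 'a st_gen \<Rightarrow> nat \<Rightarrow> nat \<Rightarrow> 'a"
  where "elem_mat R = (\<lambda>(i, j, r) k l. if k = i \<and> l = j then r else id_mat R k l)"

definition st_to_GL :: "('a, 'b) ring_scheme \<Rightarrow> 'a st_gen word set \<Rightarrow> nat \<Rightarrow> nat \<Rightarrow> 'a"
  where "st_to_GL R = pres_lift (GL R) (elem_mat R)"

definition K2 :: "('a, 'b) ring_scheme \<Rightarrow> 'a st_gen word set monoid"
  where "K2 R = (Steinberg R)\<lparr>carrier := kernel (Steinberg R) (GL R) (st_to_GL R)\<rparr>"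

definition st_map :: "('c, 'd) ring_scheme \<Rightarrow> ('a \<Rightarrow> 'c) \<Rightarrow> 'a st_gen word set \<Rightarrow> 'c st_gen word set"
  where "st_map S f = pres_lift (Steinberg S) (\<lambda>(i, j, r). st_elem S i j (f r))"

definition K2_map :: "('a, 'b) ring_scheme \<Rightarrow> ('c, 'd) ring_scheme \<Rightarrow> ('a \<Rightarrow> 'c) \<Rightarrow>
    'a st_gen word set \<Rightarrow> 'c st_gen word set"
  where "K2_map R S f = restrict (st_map S f) (carrier (K2 R))"

text \<open>The group ring of a finite group only: functions on the carrier with no support condition,
  and a convolution sum over the whole carrier.\<close>

definition group_ring :: "('a, 'b) ring_scheme \<Rightarrow> ('g, 'c) monoid_scheme \<Rightarrow> ('g \<Rightarrow> 'a) ring"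
  where "group_ring R G =
    \<lparr> carrier = carrier G \<rightarrow>\<^sub>E carrier R,
      mult = (\<lambda>f g. \<lambda>x\<in>carrier G.
        \<Oplus>\<^bsub>R\<^esub>y\<in>carrier G. f y \<otimes>\<^bsub>R\<^esub> g (inv\<^bsub>G\<^esub> y \<otimes>\<^bsub>G\<^esub> x)),
      one = (\<lambda>x\<in>carrier G. if x = \<one>\<^bsub>G\<^esub> then \<one>\<^bsub>R\<^esub> else \<zero>\<^bsub>R\<^esub>),
      zero = (\<lambda>x\<in>carrier G. \<zero>\<^bsub>R\<^esub>),
      add = (\<lambda>f g. \<lambda>x\<in>carrier G. f x \<oplus>\<^bsub>R\<^esub> g x) \<rparr>"

definition group_ring_map :: "('g, 'c) monoid_scheme \<Rightarrow> ('a \<Rightarrow> 'd) \<Rightarrow> ('g \<Rightarrow> 'a) \<Rightarrow> 'g \<Rightarrow> 'd"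
  where "group_ring_map G h f = (\<lambda>x\<in>carrier G. h (f x))"

definition p_ideal :: "('a, 'b) ring_scheme \<Rightarrow> nat \<Rightarrow> nat \<Rightarrow> 'a set"
  where "p_ideal R p n = PIdl\<^bsub>R\<^esub> ([(p ^ n)] \<cdot>\<^bsub>R\<^esub> \<one>\<^bsub>R\<^esub>)"

definition p_quot :: "('a, 'b) ring_scheme \<Rightarrow> nat \<Rightarrow> nat \<Rightarrow> 'a set ring"
  where "p_quot R p n = R Quot (p_ideal R p n)"

definition p_proj :: "('a, 'b) ring_scheme \<Rightarrow> nat \<Rightarrow> nat \<Rightarrow> 'a \<Rightarrow> 'a set"
  where "p_proj R p n r = p_ideal R p n +>\<^bsub>R\<^esub> r"

text \<open>The transition map \<open>R/p\<^sup>n\<^sup>+\<^sup>1R \<rightarrow> R/p\<^sup>nR\<close>: adding \<open>p\<^sup>nR\<close> to the coset of \<open>r\<close> modulo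
  \<open>p\<^sup>n\<^sup>+\<^sup>1R\<close> gives the coset of \<open>r\<close> modulo \<open>p\<^sup>nR\<close>.\<close>

definition p_trans :: "('a, 'b) ring_scheme \<Rightarrow> nat \<Rightarrow> nat \<Rightarrow> 'a set \<Rightarrow> 'a set"
  where "p_trans R p n C = p_ideal R p n <+>\<^bsub>R\<^esub> C"

definition p_limit :: "('a, 'b) ring_scheme \<Rightarrow> nat \<Rightarrow> (nat \<Rightarrow> 'a set) ring"
  where "p_limit R p =
    \<lparr> carrier = {x. (\<forall>n. x n \<in> carrier (p_quot R p n)) \<and> (\<forall>n. p_trans R p n (x (Suc n)) = x n)},
      mult = (\<lambda>x y n. x n \<otimes>\<^bsub>p_quot R p n\<^esub> y n),
      one = (\<lambda>n. \<one>\<^bsub>p_quot R p n\<^esub>),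
      zero = (\<lambda>n. \<zero>\<^bsub>p_quot R p n\<^esub>),
      add = (\<lambda>x y n. x n \<oplus>\<^bsub>p_quot R p n\<^esub> y n) \<rparr>"

definition p_adically_complete :: "nat \<Rightarrow> ('a, 'b) ring_scheme \<Rightarrow> bool"
  where "p_adically_complete p R \<longleftrightarrow> (\<lambda>r n. p_proj R p n r) \<in> ring_iso R (p_limit R p)"

definition krull_dim :: "('a, 'b) ring_scheme \<Rightarrow> enat"
  where "krull_dim R = Sup {enat k | k. \<exists>P :: nat \<Rightarrow> 'a set.
    (\<forall>i\<le>k. primeideal (P i) R) \<and> (\<forall>i<k. P i \<subset> P (Suc i))}"

definition frac_rel :: "('a, 'b) ring_scheme \<Rightarrow> (('a \<times> 'a) \<times> ('a \<times> 'a)) set"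
  where "frac_rel R = {((a, b), (c, d)). a \<in> carrier R \<and> b \<in> carrier R - {\<zero>\<^bsub>R\<^esub>} \<and>
    c \<in> carrier R \<and> d \<in> carrier R - {\<zero>\<^bsub>R\<^esub>} \<and> a \<otimes>\<^bsub>R\<^esub> d = c \<otimes>\<^bsub>R\<^esub> b}"

definition frac :: "('a, 'b) ring_scheme \<Rightarrow> 'a \<Rightarrow> 'a \<Rightarrow> ('a \<times> 'a) set"
  where "frac R a b = frac_rel R `` {(a, b)}"

definition frac_field :: "('a, 'b) ring_scheme \<Rightarrow> ('a \<times> 'a) set ring"
  where "frac_field R =
    \<lparr> carrier = (carrier R \<times> (carrier R - {\<zero>\<^bsub>R\<^esub>})) // frac_rel R,
      mult = (\<lambda>x y. \<Union>(a, b)\<in>x. \<Union>(c, d)\<in>y. frac R (a \<otimes>\<^bsub>R\<^esub> c) (b \<otimes>\<^bsub>R\<^esub> d)),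
      one = frac R \<one>\<^bsub>R\<^esub> \<one>\<^bsub>R\<^esub>,
      zero = frac R \<zero>\<^bsub>R\<^esub> \<one>\<^bsub>R\<^esub>,
      add = (\<lambda>x y. \<Union>(a, b)\<in>x. \<Union>(c, d)\<in>y.
        frac R ((a \<otimes>\<^bsub>R\<^esub> d) \<oplus>\<^bsub>R\<^esub> (c \<otimes>\<^bsub>R\<^esub> b)) (b \<otimes>\<^bsub>R\<^esub> d)) \<rparr>"

text \<open>As for \<^const>\<open>semiring_char\<close>, the nonnegative generator of the kernel of the map from the integers.\<close>

definition ring_char :: "('a, 'b) ring_scheme \<Rightarrow> nat"
  where "ring_char R = Gcd {n :: nat. [n] \<cdot>\<^bsub>R\<^esub> \<one>\<^bsub>R\<^esub> = \<zero>\<^bsub>R\<^esub>}"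

end

theory Submission
  imports Defs "HOL-Combinatorics.Permutations" "HOL-Algebra.Generated_Groups"
begin

text \<open>Write \<open>A = R[G]\<close>. Lifting an element of \<open>K\<^sub>2(R\<^sub>n[G])\<close> to the Steinberg group of \<open>A\<close> produces an
  elementary matrix \<open>u\<close> over \<open>A\<close> that is congruent to 1 modulo \<open>p\<^sup>n\<close>, and it suffices to write \<open>u\<close> as a
  product of conjugates of elements \<open>x\<^sub>i\<^sub>j(b)\<close> with \<open>b \<in> p\<^sup>nA\<close>. A fixed finite product \<open>W(b)\<close> of such factors,
  each equal to 1 plus an additive function of its parameter, reaches \<open>u\<close> by successive
  approximation: if \<open>u\<close> and \<open>W(b)\<close> agree modulo \<open>p\<^sup>k\<close>, the parameters can be improved as soon as
  \<open>W(b)\<^sup>-\<^sup>1 u = 1 + p\<^sup>kV\<close> has a trace that vanishes modulo \<open>p\<close> and commutators. Completeness then gives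
  \<open>u = W(b)\<close> exactly.

  The trace condition replaces the logarithm. For a cyclic subgroup \<open>C\<close> of \<open>G\<close>, the ring \<open>A\<close> acts on itself by
  matrices over the commutative ring \<open>R[C]\<close>; elementary matrices get determinant 1 there, and
  \<open>det (1 + p\<^sup>kV) = 1 + p\<^sup>k tr V\<close> modulo \<open>p\<^sup>2\<^sup>k\<close> shows that \<open>p\<^sup>k\<close> divides the class sums of \<open>tr V\<close>, multiplied by
  orders of centralizers. For \<open>p\<^sup>k > 2\<close> one has \<open>(1 + p\<^sup>kV)\<^bsup>p^j\<^esup> = 1 + p\<^bsup>k+j\<^esup>V'\<close> with \<open>V' = V\<close> modulo \<open>p\<close>, so
  for large \<open>j\<close> these orders cancel.\<close>

text \<open>A product of the chosen factors is the matrix of a word that becomes 1 in the Steinberg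
  group of \<open>R_n[G]\<close>, since each factor is conjugate to some \<open>x_ij(b)\<close> with
  \<open>b\<close> reducing to 0. If its matrix is \<open>u\<close>, dividing the lift by this word
  gives the preimage in K2. An infinite product of corrections would not be a word, hence the list
  of factors is fixed and only the parameters converge. To first order a factor contributes its
  linear part, whose trace is a commutator \<open>a b - b a\<close> or 0. So an error can be removed
  only if its trace is a sum of commutators, and it is enough to know this modulo \<open>p\<close>,
  as multiples of \<open>p\<close> pass to the next round. The quotient of \<open>R[G]\<close> by
  commutators is free on the conjugacy classes, which turns the condition into the vanishing of
  class sums. Determinants need commutative scalars, so the class of \<open>g\<close> is examined
  over the group ring of the cyclic group generated by \<open>g\<close>. Characteristic zero makes
  integers cancellable: this allows dividing a congruence \<open>N t = 0\<close> modulo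
  \<open>N * N\<close> by \<open>N\<close>, and removing the power of \<open>p\<close> in the order
  of a centralizer.\<close>

lemma (in abelian_monoid) finsum_swap:
  assumes "finite A" "finite B" "\<And>i j. i \<in> A \<Longrightarrow> j \<in> B \<Longrightarrow> f i j \<in> carrier G"
  shows "(\<Oplus>i\<in>A. \<Oplus>j\<in>B. f i j) = (\<Oplus>j\<in>B. \<Oplus>i\<in>A. f i j)"
  using assms(1,3)
proof (induction A rule: finite_induct)
  case empty
  then show ?case by simp
next
  case (insert a A)
  then have "(\<Oplus>i\<in>insert a A. \<Oplus>j\<in>B. f i j) = (\<Oplus>j\<in>B. f a j) \<oplus> (\<Oplus>j\<in>B. \<Oplus>i\<in>A. f i j)"
    by (simp add: Pi_def)
  also have "\<dots> = (\<Oplus>j\<in>B. f a j \<oplus> (\<Oplus>i\<in>A. f i j))"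
    using insert by (subst finsum_addf) (simp_all add: Pi_def)
  also have "\<dots> = (\<Oplus>j\<in>B. \<Oplus>i\<in>insert a A. f i j)"
    using insert by (intro finsum_cong') (simp_all add: Pi_def)
  finally show ?case .
qed

lemma (in abelian_monoid) finsum_superset:
  assumes "finite B" "A \<subseteq> B" "\<And>i. i \<in> B - A \<Longrightarrow> f i = \<zero>" "\<And>i. i \<in> A \<Longrightarrow> f i \<in> carrier G"
  shows "finsum G f A = finsum G f B"
proof (rule add.finprod_mono_neutral_cong_left)
  show "f \<in> B \<rightarrow> carrier G"
    using assms(3,4) by (metis (no_types, lifting) DiffI Pi_I zero_closed)
qed (use assms in auto)

lemma (in abelian_monoid) finsum_single:
  assumes "finite A" "i \<in> A" "\<And>j. j \<in> A \<Longrightarrow> j \<noteq> i \<Longrightarrow> f j = \<zero>" "f i \<in> carrier G"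
  shows "finsum G f A = f i"
proof -
  have "finsum G f {i} = finsum G f A"
    using assms by (intro finsum_superset) auto
  then show ?thesis using assms by simp
qed

lemma (in abelian_monoid) finsum_restrict_if:
  assumes "finite A" "\<And>i. i \<in> A \<Longrightarrow> P i \<Longrightarrow> f i \<in> carrier G"
  shows "(\<Oplus>i\<in>A. if P i then f i else \<zero>) = finsum G f {i \<in> A. P i}"
  using assms by (intro add.finprod_mono_neutral_cong_right) auto

lemma (in abelian_monoid) finsum_Sigma':
  assumes "finite A" "\<And>i. i \<in> A \<Longrightarrow> finite (B i)" "\<And>i j. i \<in> A \<Longrightarrow> j \<in> B i \<Longrightarrow> f i j \<in> carrier G"
  shows "(\<Oplus>i\<in>A. \<Oplus>j\<in>B i. f i j) = finsum G (\<lambda>(i, j). f i j) (Sigma A B)"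
  using assms
proof (induction A rule: finite_induct)
  case empty
  then show ?case by simp
next
  case (insert a A)
  have eq: "Sigma (insert a A) B = Pair a ` B a \<union> Sigma A B" by auto
  have "finsum G (\<lambda>(i, j). f i j) (Sigma (insert a A) B) =
      finsum G (\<lambda>(i, j). f i j) (Pair a ` B a) \<oplus> finsum G (\<lambda>(i, j). f i j) (Sigma A B)"
    unfolding eq using insert by (intro finsum_Un_disjoint) auto
  also have "finsum G (\<lambda>(i, j). f i j) (Pair a ` B a) = (\<Oplus>j\<in>B a. f a j)"
    using insert by (subst finsum_reindex) (auto simp: inj_on_def)
  finally show ?case using insert by (simp add: Pi_def)
qed

section \<open>Row-finite matrices and the Steinberg relations\<close>

text \<open>Row-finite matrices provide an addition for the elements of \<^const>\<open>GL\<close>: the products agree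
  definitionally.\<close>

definition rf_mat :: "('a, 'b) ring_scheme \<Rightarrow> (nat \<Rightarrow> nat \<Rightarrow> 'a) ring"
  where "rf_mat R =
    \<lparr> carrier = {A. (\<forall>i j. A i j \<in> carrier R) \<and> (\<forall>i. finite {j. A i j \<noteq> \<zero>\<^bsub>R\<^esub>})},
      mult = (\<lambda>A B i k. \<Oplus>\<^bsub>R\<^esub>j\<in>{j. A i j \<noteq> \<zero>\<^bsub>R\<^esub>}. A i j \<otimes>\<^bsub>R\<^esub> B j k),
      one = id_mat R,
      zero = (\<lambda>i j. \<zero>\<^bsub>R\<^esub>),
      add = (\<lambda>A B i j. A i j \<oplus>\<^bsub>R\<^esub> B i j) \<rparr>"

context ring
begin

abbreviation "Q \<equiv> rf_mat R"

lemma rf_carrierI: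
  "(\<And>i j. A i j \<in> carrier R) \<Longrightarrow> (\<And>i. finite {j. A i j \<noteq> \<zero>}) \<Longrightarrow> A \<in> carrier Q"
  by (simp add: rf_mat_def)

lemma rf_add: "(A \<oplus>\<^bsub>Q\<^esub> B) i j = A i j \<oplus> B i j"
  by (simp add: rf_mat_def)

lemma rf_zero: "\<zero>\<^bsub>Q\<^esub> i j = \<zero>"
  by (simp add: rf_mat_def)

lemma rf_one: "\<one>\<^bsub>Q\<^esub> = id_mat R"
  by (simp add: rf_mat_def)

lemma rf_entry [simp]: "A \<in> carrier Q \<Longrightarrow> A i j \<in> carrier R"
  unfolding rf_mat_def by simp

lemma rf_finite [simp]: "A \<in> carrier Q \<Longrightarrow> finite {j. A i j \<noteq> \<zero>}"
  unfolding rf_mat_def by simp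

text \<open>The product sums over the support of a row, which changes with the matrix. Enlarging the
  support by zero terms changes nothing, so sums coming from different matrices can be brought to a
  common index set \<open>J\<close>.\<close>

lemma rf_mult:
  assumes "\<And>j. A i j \<in> carrier R" "\<And>j. B j k \<in> carrier R" "finite J" "\<And>j. j \<notin> J \<Longrightarrow> A i j = \<zero>"
  shows "(A \<otimes>\<^bsub>Q\<^esub> B) i k = (\<Oplus>j\<in>J. A i j \<otimes> B j k)"
proof -
  have "(\<Oplus>j\<in>{j. A i j \<noteq> \<zero>}. A i j \<otimes> B j k) = (\<Oplus>j\<in>J. A i j \<otimes> B j k)"
    using assms by (intro finsum_superset) auto
  then show ?thesis unfolding rf_mat_def by simp
qed

lemma rf_mult_closed:
  assumes "A \<in> carrier Q" "B \<in> carrier Q"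
  shows "A \<otimes>\<^bsub>Q\<^esub> B \<in> carrier Q"
proof -
  have "finite {k. (A \<otimes>\<^bsub>Q\<^esub> B) i k \<noteq> \<zero>}" for i
  proof (rule finite_subset)
    let ?J = "{j. A i j \<noteq> \<zero>}"
    show "finite (\<Union>j\<in>?J. {k. B j k \<noteq> \<zero>})"
      using assms by auto
    show "{k. (A \<otimes>\<^bsub>Q\<^esub> B) i k \<noteq> \<zero>} \<subseteq> (\<Union>j\<in>?J. {k. B j k \<noteq> \<zero>})"
    proof (rule subsetI, rule ccontr)
      fix k assume k: "k \<in> {k. (A \<otimes>\<^bsub>Q\<^esub> B) i k \<noteq> \<zero>}" "k \<notin> (\<Union>j\<in>?J. {k. B j k \<noteq> \<zero>})"
      then have "(A \<otimes>\<^bsub>Q\<^esub> B) i k = (\<Oplus>j\<in>?J. A i j \<otimes> B j k)"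
        using assms by (intro rf_mult) auto
      also have "\<dots> = (\<Oplus>j\<in>?J. \<zero>)" using k assms by (intro finsum_cong') auto
      finally show False using k by simp
    qed
  qed
  moreover have "(A \<otimes>\<^bsub>Q\<^esub> B) i k \<in> carrier R" for i k
    using assms by (subst rf_mult[OF _ _ rf_finite]) (auto intro!: finsum_closed)
  ultimately show ?thesis by (intro rf_carrierI)
qed

lemma id_mat_rf: "id_mat R \<in> carrier Q"
  by (rule rf_carrierI) (auto simp: id_mat_def)

lemma rf_assoc:
  assumes A: "A \<in> carrier Q" and B: "B \<in> carrier Q" and C: "C \<in> carrier Q"
  shows "(A \<otimes>\<^bsub>Q\<^esub> B) \<otimes>\<^bsub>Q\<^esub> C = A \<otimes>\<^bsub>Q\<^esub> (B \<otimes>\<^bsub>Q\<^esub> C)"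
proof (intro ext)
  fix i l
  let ?J = "{j. A i j \<noteq> \<zero>}"
  \<comment> \<open>With both parts, \<open>?K\<close> is an admissible index set for the outer
    product on the left and for row \<open>j\<close> of \<open>B C\<close> for every
    \<open>j\<close> in \<open>?J\<close>, so that the two sums can be swapped.\<close>
  let ?K = "(\<Union>j\<in>?J. {k. B j k \<noteq> \<zero>}) \<union> {k. (A \<otimes>\<^bsub>Q\<^esub> B) i k \<noteq> \<zero>}"
  have fJ: "finite ?J" using A by simp
  have fK: "finite ?K" using B fJ rf_mult_closed[OF A B] by auto
  have ABC: "A i j \<in> carrier R" "B i j \<in> carrier R" "C i j \<in> carrier R" for i j
    using A B C by auto
  have "((A \<otimes>\<^bsub>Q\<^esub> B) \<otimes>\<^bsub>Q\<^esub> C) i l = (\<Oplus>k\<in>?K. (A \<otimes>\<^bsub>Q\<^esub> B) i k \<otimes> C k l)"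
    using ABC fK rf_mult_closed[OF A B] by (intro rf_mult) auto
  also have "\<dots> = (\<Oplus>k\<in>?K. \<Oplus>j\<in>?J. A i j \<otimes> B j k \<otimes> C k l)"
  proof (intro finsum_cong' refl)
    fix k
    have "(A \<otimes>\<^bsub>Q\<^esub> B) i k = (\<Oplus>j\<in>?J. A i j \<otimes> B j k)"
      using fJ ABC by (intro rf_mult) auto
    then show "(A \<otimes>\<^bsub>Q\<^esub> B) i k \<otimes> C k l = (\<Oplus>j\<in>?J. A i j \<otimes> B j k \<otimes> C k l)"
      using fJ ABC by (simp add: finsum_ldistr Pi_def)
  qed (use ABC in \<open>auto intro!: finsum_closed\<close>)
  also have "\<dots> = (\<Oplus>j\<in>?J. \<Oplus>k\<in>?K. A i j \<otimes> B j k \<otimes> C k l)"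
    using fJ fK ABC by (intro finsum_swap) auto
  also have "\<dots> = (\<Oplus>j\<in>?J. A i j \<otimes> (B \<otimes>\<^bsub>Q\<^esub> C) j l)"
  proof (intro finsum_cong' refl)
    fix j assume j: "j \<in> ?J"
    have "(B \<otimes>\<^bsub>Q\<^esub> C) j l = (\<Oplus>k\<in>?K. B j k \<otimes> C k l)"
      using fK ABC j by (intro rf_mult) auto
    then show "(\<Oplus>k\<in>?K. A i j \<otimes> B j k \<otimes> C k l) = A i j \<otimes> (B \<otimes>\<^bsub>Q\<^esub> C) j l"
      using fK ABC by (simp add: finsum_rdistr Pi_def m_assoc del: UN_simps)
  qed (use ABC rf_mult_closed[OF B C] in auto)
  also have "\<dots> = (A \<otimes>\<^bsub>Q\<^esub> (B \<otimes>\<^bsub>Q\<^esub> C)) i l"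
    using ABC fJ rf_mult_closed[OF B C] by (intro rf_mult[symmetric]) auto
  finally show "((A \<otimes>\<^bsub>Q\<^esub> B) \<otimes>\<^bsub>Q\<^esub> C) i l = (A \<otimes>\<^bsub>Q\<^esub> (B \<otimes>\<^bsub>Q\<^esub> C)) i l" .
qed

lemma rf_l_one: "A \<in> carrier Q \<Longrightarrow> id_mat R \<otimes>\<^bsub>Q\<^esub> A = A"
proof (intro ext)
  fix i k assume A: "A \<in> carrier Q"
  have "(id_mat R \<otimes>\<^bsub>Q\<^esub> A) i k = (\<Oplus>j\<in>{i}. id_mat R i j \<otimes> A j k)"
    using A by (intro rf_mult) (auto simp: id_mat_def)
  then show "(id_mat R \<otimes>\<^bsub>Q\<^esub> A) i k = A i k" using A by (simp add: id_mat_def)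
qed

lemma rf_r_one: "A \<in> carrier Q \<Longrightarrow> A \<otimes>\<^bsub>Q\<^esub> id_mat R = A"
proof (intro ext)
  fix i k assume A: "A \<in> carrier Q"
  have "(A \<otimes>\<^bsub>Q\<^esub> id_mat R) i k = (\<Oplus>j\<in>insert k {j. A i j \<noteq> \<zero>}. A i j \<otimes> id_mat R j k)"
    using A by (intro rf_mult) (auto simp: id_mat_def)
  also have "\<dots> = A i k \<otimes> id_mat R k k"
    using A by (intro finsum_single) (auto simp: id_mat_def)
  finally show "(A \<otimes>\<^bsub>Q\<^esub> id_mat R) i k = A i k" using A by (simp add: id_mat_def)
qed

lemma ring_rf: "ring Q"
proof (rule ringI)
  show "abelian_group Q"
  proof (rule abelian_groupI)
    fix A B assume A: "A \<in> carrier Q" and B: "B \<in> carrier Q"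
    have "finite {j. A i j \<oplus> B i j \<noteq> \<zero>}" for i
      by (rule finite_subset[of _ "{j. A i j \<noteq> \<zero>} \<union> {j. B i j \<noteq> \<zero>}"])
        (use A B in auto)
    then show "A \<oplus>\<^bsub>Q\<^esub> B \<in> carrier Q"
      using A B by (intro rf_carrierI) (auto simp: rf_add)
    show "A \<oplus>\<^bsub>Q\<^esub> B = B \<oplus>\<^bsub>Q\<^esub> A"
      using A B by (simp add: fun_eq_iff rf_add a_comm)
    fix C assume "C \<in> carrier Q"
    then show "A \<oplus>\<^bsub>Q\<^esub> B \<oplus>\<^bsub>Q\<^esub> C = A \<oplus>\<^bsub>Q\<^esub> (B \<oplus>\<^bsub>Q\<^esub> C)"
      using A B by (simp add: fun_eq_iff rf_add a_assoc)
  next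
    fix A assume A: "A \<in> carrier Q"
    show "\<zero>\<^bsub>Q\<^esub> \<oplus>\<^bsub>Q\<^esub> A = A" using A by (auto simp: fun_eq_iff rf_add rf_zero)
    have "(\<lambda>i j. \<ominus> A i j) \<in> carrier Q"
    proof -
      have "\<ominus> A i j = \<zero> \<longleftrightarrow> A i j = \<zero>" for i j
        using A by (metis minus_minus minus_zero rf_entry)
      then show ?thesis using A by (intro rf_carrierI) auto
    qed
    moreover have "(\<lambda>i j. \<ominus> A i j) \<oplus>\<^bsub>Q\<^esub> A = \<zero>\<^bsub>Q\<^esub>"
      using A by (auto simp: fun_eq_iff rf_add rf_zero l_neg)
    ultimately show "\<exists>B\<in>carrier Q. B \<oplus>\<^bsub>Q\<^esub> A = \<zero>\<^bsub>Q\<^esub>" by blast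
  qed (auto intro!: rf_carrierI simp: rf_zero)
  show "monoid Q"
    by (rule monoidI) (simp_all add: rf_mult_closed rf_assoc rf_l_one rf_r_one rf_one id_mat_rf)
next
  fix A B C assume ABC: "A \<in> carrier Q" "B \<in> carrier Q" "C \<in> carrier Q"
  show "(A \<oplus>\<^bsub>Q\<^esub> B) \<otimes>\<^bsub>Q\<^esub> C = A \<otimes>\<^bsub>Q\<^esub> C \<oplus>\<^bsub>Q\<^esub> B \<otimes>\<^bsub>Q\<^esub> C"
  proof (intro ext)
    fix i k
    let ?J = "{j. A i j \<noteq> \<zero>} \<union> {j. B i j \<noteq> \<zero>}"
    have J: "finite ?J" using ABC by auto
    have "((A \<oplus>\<^bsub>Q\<^esub> B) \<otimes>\<^bsub>Q\<^esub> C) i k = (\<Oplus>j\<in>?J. (A \<oplus>\<^bsub>Q\<^esub> B) i j \<otimes> C j k)"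
      using ABC J by (intro rf_mult) (auto simp: rf_add)
    also have "\<dots> = (\<Oplus>j\<in>?J. A i j \<otimes> C j k \<oplus> B i j \<otimes> C j k)"
      using ABC by (intro finsum_cong') (auto simp: rf_add l_distr)
    also have "\<dots> = (\<Oplus>j\<in>?J. A i j \<otimes> C j k) \<oplus> (\<Oplus>j\<in>?J. B i j \<otimes> C j k)"
      using ABC by (intro finsum_addf) auto
    also have "(\<Oplus>j\<in>?J. A i j \<otimes> C j k) = (A \<otimes>\<^bsub>Q\<^esub> C) i k"
      using ABC J by (intro rf_mult[symmetric]) auto
    also have "(\<Oplus>j\<in>?J. B i j \<otimes> C j k) = (B \<otimes>\<^bsub>Q\<^esub> C) i k"
      using ABC J by (intro rf_mult[symmetric]) auto
    finally show "((A \<oplus>\<^bsub>Q\<^esub> B) \<otimes>\<^bsub>Q\<^esub> C) i k = (A \<otimes>\<^bsub>Q\<^esub> C \<oplus>\<^bsub>Q\<^esub> B \<otimes>\<^bsub>Q\<^esub> C) i k"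
      by (simp only: rf_add[of "A \<otimes>\<^bsub>Q\<^esub> C"])
  qed
  show "C \<otimes>\<^bsub>Q\<^esub> (A \<oplus>\<^bsub>Q\<^esub> B) = C \<otimes>\<^bsub>Q\<^esub> A \<oplus>\<^bsub>Q\<^esub> C \<otimes>\<^bsub>Q\<^esub> B"
  proof (intro ext)
    fix i k
    let ?J = "{j. C i j \<noteq> \<zero>}"
    have J: "finite ?J" using ABC by auto
    have "(C \<otimes>\<^bsub>Q\<^esub> (A \<oplus>\<^bsub>Q\<^esub> B)) i k = (\<Oplus>j\<in>?J. C i j \<otimes> (A \<oplus>\<^bsub>Q\<^esub> B) j k)"
      using ABC J by (intro rf_mult) (auto simp: rf_add)
    also have "\<dots> = (\<Oplus>j\<in>?J. C i j \<otimes> A j k \<oplus> C i j \<otimes> B j k)"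
      using ABC by (intro finsum_cong') (auto simp: rf_add r_distr)
    also have "\<dots> = (\<Oplus>j\<in>?J. C i j \<otimes> A j k) \<oplus> (\<Oplus>j\<in>?J. C i j \<otimes> B j k)"
      using ABC by (intro finsum_addf) auto
    also have "(\<Oplus>j\<in>?J. C i j \<otimes> A j k) = (C \<otimes>\<^bsub>Q\<^esub> A) i k"
      using ABC J by (intro rf_mult[symmetric]) auto
    also have "(\<Oplus>j\<in>?J. C i j \<otimes> B j k) = (C \<otimes>\<^bsub>Q\<^esub> B) i k"
      using ABC J by (intro rf_mult[symmetric]) auto
    finally show "(C \<otimes>\<^bsub>Q\<^esub> (A \<oplus>\<^bsub>Q\<^esub> B)) i k = (C \<otimes>\<^bsub>Q\<^esub> A \<oplus>\<^bsub>Q\<^esub> C \<otimes>\<^bsub>Q\<^esub> B) i k"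
      by (simp only: rf_add[of "C \<otimes>\<^bsub>Q\<^esub> A"])
  qed
qed

end

section \<open>Elementary matrices, the stable general linear group and the Steinberg
  relations\<close>

context ring
begin

lemma elem_mat_rf: "r \<in> carrier R \<Longrightarrow> elem_mat R (i, j, r) \<in> carrier Q"
proof (rule rf_carrierI)
  show "finite {l. elem_mat R (i, j, r) k l \<noteq> \<zero>}" for k
    by (rule finite_subset[of _ "{j, k}"]) (auto simp: elem_mat_def id_mat_def split: if_splits)
qed (auto simp: elem_mat_def id_mat_def)

text \<open>A row operation: row \<open>k\<close> of the elementary matrix is supported on
  \<open>{k}\<close>, or on \<open>{i, j}\<close> if \<open>k = i\<close>. Statements about the
  matrix of a word can therefore be proved by induction over its letters, one row operation at a
  time.\<close>

lemma elem_mat_mult: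
  assumes "i \<noteq> j" "r \<in> carrier R" "\<And>k l. X k l \<in> carrier R"
  shows "elem_mat R (i, j, r) \<otimes>\<^bsub>Q\<^esub> X = (\<lambda>k l. if k = i then X i l \<oplus> r \<otimes> X j l else X k l)"
proof (intro ext)
  fix k l
  have "(elem_mat R (i, j, r) \<otimes>\<^bsub>Q\<^esub> X) k l =
      (\<Oplus>q\<in>(if k = i then {i, j} else {k}). elem_mat R (i, j, r) k q \<otimes> X q l)"
    using assms by (intro rf_mult) (auto simp: elem_mat_def id_mat_def split: if_splits)
  also have "\<dots> = (if k = i then X i l \<oplus> r \<otimes> X j l else X k l)"
    using assms by (simp add: elem_mat_def id_mat_def)
  finally show "(elem_mat R (i, j, r) \<otimes>\<^bsub>Q\<^esub> X) k l = (if k = i then X i l \<oplus> r \<otimes> X j l else X k l)" .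
qed

lemma finitary_carrier:
  "A \<in> carrier (finitary_matrices R) \<longleftrightarrow>
    (\<forall>i j. A i j \<in> carrier R) \<and> finite {(i, j). A i j \<noteq> id_mat R i j}"
  by (simp add: finitary_matrices_def)

lemma finitary_bound:
  assumes "A \<in> carrier (finitary_matrices R)"
  obtains m where "\<And>i j. i \<ge> m \<or> j \<ge> m \<Longrightarrow> A i j = id_mat R i j"
proof -
  let ?S = "{(i, j). A i j \<noteq> id_mat R i j}"
  have "finite (fst ` ?S \<union> snd ` ?S)" using assms by (simp add: finitary_carrier)
  then obtain m where m: "\<And>k. k \<in> fst ` ?S \<union> snd ` ?S \<Longrightarrow> k < m"
    by (meson finite_nat_set_iff_bounded)
  have "A i j = id_mat R i j" if "i \<ge> m \<or> j \<ge> m" for i j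
  proof (rule ccontr)
    assume "A i j \<noteq> id_mat R i j"
    then have "(i, j) \<in> ?S" by simp
    then have "i \<in> fst ` ?S" "j \<in> snd ` ?S" by force+
    then have "i < m" "j < m" by (blast intro: m)+
    then show False using that by simp
  qed
  then show thesis by (rule that)
qed

lemma finitaryI:
  assumes "\<And>i j. A i j \<in> carrier R" "\<And>i j. i \<ge> m \<or> j \<ge> m \<Longrightarrow> A i j = id_mat R i j"
  shows "A \<in> carrier (finitary_matrices R)"
proof -
  have "{(i, j). A i j \<noteq> id_mat R i j} \<subseteq> {..<m} \<times> {..<m}"
    using assms(2) by (auto simp: not_le[symmetric])
  then have "finite {(i, j). A i j \<noteq> id_mat R i j}" by (rule finite_subset) simp
  then show ?thesis using assms(1) by (simp add: finitary_carrier)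
qed

lemma finitary_rf:
  assumes "A \<in> carrier (finitary_matrices R)" shows "A \<in> carrier Q"
proof -
  obtain m where m: "\<And>i j. i \<ge> m \<or> j \<ge> m \<Longrightarrow> A i j = id_mat R i j"
    using finitary_bound[OF assms] by blast
  show ?thesis
  proof (rule rf_carrierI)
    fix i
    have "{j. A i j \<noteq> \<zero>} \<subseteq> insert i {..<m}"
      using m[of i] by (auto simp: id_mat_def not_le[symmetric] split: if_splits)
    then show "finite {j. A i j \<noteq> \<zero>}" by (rule finite_subset) simp
  qed (use assms in \<open>simp add: finitary_carrier\<close>)
qed

lemma finitary_mult: "mult (finitary_matrices R) = mult Q"
  by (simp add: finitary_matrices_def rf_mat_def del: rf_entry rf_finite)

lemma finitary_one: "one (finitary_matrices R) = id_mat R"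
  by (simp add: finitary_matrices_def)

lemma id_mat_finitary: "id_mat R \<in> carrier (finitary_matrices R)"
  by (simp add: finitary_carrier) (simp add: id_mat_def)

lemma monoid_finitary: "monoid (finitary_matrices R)"
proof (rule monoidI)
  fix A B assume A: "A \<in> carrier (finitary_matrices R)" and B: "B \<in> carrier (finitary_matrices R)"
  obtain a where a: "\<And>i j. i \<ge> a \<or> j \<ge> a \<Longrightarrow> A i j = id_mat R i j"
    using finitary_bound[OF A] by blast
  obtain b where b: "\<And>i j. i \<ge> b \<or> j \<ge> b \<Longrightarrow> B i j = id_mat R i j"
    using finitary_bound[OF B] by blast
  have QA: "A \<in> carrier Q" and QB: "B \<in> carrier Q" using A B by (simp_all add: finitary_rf)
  have "(A \<otimes>\<^bsub>Q\<^esub> B) i k = id_mat R i k" if "i \<ge> max a b \<or> k \<ge> max a b" for i k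
  proof (cases "i \<ge> max a b")
    case True
    have "(A \<otimes>\<^bsub>Q\<^esub> B) i k = (\<Oplus>j\<in>{i}. A i j \<otimes> B j k)"
      using QA QB True a by (intro rf_mult) (auto simp: id_mat_def)
    then show ?thesis using True a b QB by (auto simp: id_mat_def)
  next
    case False
    with that have k: "k \<ge> max a b" by blast
    have "(A \<otimes>\<^bsub>Q\<^esub> B) i k = (\<Oplus>j\<in>insert k {j. A i j \<noteq> \<zero>}. A i j \<otimes> B j k)"
      using QA QB by (intro rf_mult) auto
    also have "\<dots> = A i k \<otimes> B k k"
      using QA QB k b by (intro finsum_single) (auto simp: id_mat_def)
    finally show ?thesis using k a b QA by (auto simp: id_mat_def)
  qed
  then show "A \<otimes>\<^bsub>finitary_matrices R\<^esub> B \<in> carrier (finitary_matrices R)"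
    unfolding finitary_mult using rf_mult_closed[OF QA QB] by (intro finitaryI[where m = "max a b"]) auto
qed (auto simp: finitary_mult finitary_one finitary_rf rf_assoc rf_l_one rf_r_one id_mat_finitary)

lemma group_GL: "group (GL R)"
  unfolding GL_def by (rule monoid.units_group[OF monoid_finitary])

lemma GL_mult: "mult (GL R) = mult Q"
  by (simp add: GL_def units_of_def finitary_mult)

lemma GL_one: "one (GL R) = id_mat R"
  by (simp add: GL_def units_of_def finitary_one)

lemma GL_finitary: "A \<in> carrier (GL R) \<Longrightarrow> A \<in> carrier (finitary_matrices R)"
  by (simp add: GL_def units_of_def Units_def)

lemma GL_rf: "A \<in> carrier (GL R) \<Longrightarrow> A \<in> carrier Q"
  by (simp add: GL_finitary finitary_rf)

lemma elem_mat_inv: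
  assumes "i \<noteq> j" "r \<in> carrier R"
  shows "elem_mat R (i, j, r) \<otimes>\<^bsub>Q\<^esub> elem_mat R (i, j, \<ominus> r) = id_mat R"
  using assms elem_mat_rf[of "\<ominus> r" i j]
  by (subst elem_mat_mult) (auto simp: elem_mat_def id_mat_def fun_eq_iff l_neg)

lemma elem_mat_GL:
  assumes "i \<noteq> j" "r \<in> carrier R"
  shows "elem_mat R (i, j, r) \<in> carrier (GL R)"
proof -
  have fin: "elem_mat R (i, j, s) \<in> carrier (finitary_matrices R)" if "s \<in> carrier R" for s
    using that by (intro finitaryI[where m = "Suc (max i j)"]) (auto simp: elem_mat_def id_mat_def)
  show ?thesis
    unfolding GL_def units_of_def Units_def using assms fin elem_mat_inv[OF assms]
      elem_mat_inv[of i j "\<ominus> r"]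
    by (auto simp: finitary_mult finitary_one intro!: bexI[of _ "elem_mat R (i, j, \<ominus> r)"])
qed

lemma GL_inv_elem_mat:
  assumes "i \<noteq> j" "r \<in> carrier R"
  shows "inv\<^bsub>GL R\<^esub> elem_mat R (i, j, r) = elem_mat R (i, j, \<ominus> r)"
  using assms elem_mat_inv[of i j "\<ominus> r"]
  by (intro group.inv_equality[OF group_GL]) (auto simp: GL_mult GL_one elem_mat_GL)

lemma elem_mat_entry: "r \<in> carrier R \<Longrightarrow> elem_mat R (i, j, r) k l \<in> carrier R"
  by (simp add: elem_mat_def id_mat_def)

lemma GL_images: "pres_images (GL R) (st_gens R) (st_rels R) (elem_mat R)"
proof -
  interpret GL: group "GL R" by (rule group_GL)
  \<comment> \<open>Rewriting the commutator relation as \<open>x y = Z y x\<close> removes the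
    inverses, so that the remaining identities follow by composing row operations.\<close>
  have comm: "word_eval (GL R) (elem_mat R) (comm_word (i, j, r) (k, l, s)) = Z"
    if "i \<noteq> j" "k \<noteq> l" "r \<in> carrier R" "s \<in> carrier R" "Z \<in> carrier (GL R)"
      and eq: "elem_mat R (i, j, r) \<otimes>\<^bsub>Q\<^esub> elem_mat R (k, l, s) =
        Z \<otimes>\<^bsub>Q\<^esub> (elem_mat R (k, l, s) \<otimes>\<^bsub>Q\<^esub> elem_mat R (i, j, r))" for i j k l r s Z
  proof -
    let ?x = "elem_mat R (i, j, r)" and ?y = "elem_mat R (k, l, s)"
    have xy: "?x \<in> carrier (GL R)" "?y \<in> carrier (GL R)" using that by (auto intro: elem_mat_GL)
    have "word_eval (GL R) (elem_mat R) (comm_word (i, j, r) (k, l, s)) =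
        ?x \<otimes>\<^bsub>GL R\<^esub> ?y \<otimes>\<^bsub>GL R\<^esub> (inv\<^bsub>GL R\<^esub> ?x \<otimes>\<^bsub>GL R\<^esub> inv\<^bsub>GL R\<^esub> ?y)"
      using xy by (simp add: word_eval_def comm_word_def GL.m_assoc)
    also have "\<dots> = Z"
    proof -
      have "?x \<otimes>\<^bsub>GL R\<^esub> ?y = Z \<otimes>\<^bsub>GL R\<^esub> (?y \<otimes>\<^bsub>GL R\<^esub> ?x)" using eq by (simp add: GL_mult)
      then show ?thesis using xy \<open>Z \<in> carrier (GL R)\<close>
        by (simp add: GL.m_assoc flip: GL.inv_mult_group)
    qed
    finally show ?thesis .
  qed
  show ?thesis
  proof (unfold_locales)
    fix g assume "g \<in> st_gens R"
    then show "elem_mat R g \<in> carrier (GL R)" by (auto simp: st_gens_def intro: elem_mat_GL)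
  next
    fix u v assume "(u, v) \<in> st_rels R"
    then show "word_eval (GL R) (elem_mat R) u = word_eval (GL R) (elem_mat R) v"
    proof cases
      case (st_add i j r s)
      then have e: "elem_mat R (i, j, r) \<in> carrier (GL R)" "elem_mat R (i, j, s) \<in> carrier (GL R)"
        "elem_mat R (i, j, r \<oplus> s) \<in> carrier (GL R)" by (auto intro: elem_mat_GL)
      have "elem_mat R (i, j, r) \<otimes>\<^bsub>Q\<^esub> elem_mat R (i, j, s) = elem_mat R (i, j, r \<oplus> s)"
        using st_add by (subst elem_mat_mult)
          (auto simp: elem_mat_entry elem_mat_def id_mat_def fun_eq_iff a_comm)
      then show ?thesis using st_add e by (simp add: word_eval_def flip: GL_mult)
    next
      case (st_comm i j k r s)
      have "word_eval (GL R) (elem_mat R) (comm_word (i, j, r) (j, k, s)) =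
          elem_mat R (i, k, r \<otimes> s)"
      proof (rule comm)
        show "elem_mat R (i, j, r) \<otimes>\<^bsub>Q\<^esub> elem_mat R (j, k, s) = elem_mat R (i, k, r \<otimes> s) \<otimes>\<^bsub>Q\<^esub>
            (elem_mat R (j, k, s) \<otimes>\<^bsub>Q\<^esub> elem_mat R (i, j, r))"
          using st_comm by (simp add: elem_mat_mult elem_mat_entry)
            (auto simp: elem_mat_def id_mat_def fun_eq_iff)
      qed (use st_comm in \<open>auto intro: elem_mat_GL\<close>)
      then show ?thesis using st_comm elem_mat_GL[of i k "r \<otimes> s"]
        by (simp add: word_eval_def)
    next
      case (st_commute i j k l r s)
      have "word_eval (GL R) (elem_mat R) (comm_word (i, j, r) (k, l, s)) = id_mat R"
      proof (rule comm)
        show "elem_mat R (i, j, r) \<otimes>\<^bsub>Q\<^esub> elem_mat R (k, l, s) = id_mat R \<otimes>\<^bsub>Q\<^esub>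
            (elem_mat R (k, l, s) \<otimes>\<^bsub>Q\<^esub> elem_mat R (i, j, r))"
          using st_commute by (simp add: rf_l_one rf_mult_closed elem_mat_rf)
            (simp add: elem_mat_mult elem_mat_entry,
              auto simp: elem_mat_def id_mat_def fun_eq_iff a_comm)
      qed (use st_commute GL.one_closed in \<open>auto simp: GL_one\<close>)
      then show ?thesis using st_commute by (simp add: word_eval_def GL_one)
    qed
  qed
qed

end

section \<open>Functoriality of the Steinberg group and a criterion for surjectivity on K2\<close>

abbreviation wmap :: "('a \<Rightarrow> 'c) \<Rightarrow> 'a st_gen word \<Rightarrow> 'c st_gen word"
  where "wmap f \<equiv> map (\<lambda>((i, j, r), b). ((i, j, f r), b))"

lemma wmap_words:
  assumes "f \<in> carrier R \<rightarrow> carrier S" "w \<in> words (st_gens R)"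
  shows "wmap f w \<in> words (st_gens S)"
  using assms by (fastforce simp: words_def st_gens_def in_lists_conv_set)

lemma group_Steinberg: "group (Steinberg R)"
  unfolding Steinberg_def by (rule presented_group_group)

lemma st_elem_closed:
  assumes "i \<noteq> j" "r \<in> carrier R"
  shows "st_elem R i j r \<in> carrier (Steinberg R)"
  using assms by (auto simp: st_elem_def Steinberg_def presented_carrier words_def st_gens_def)

lemma st_elem_inv:
  assumes "i \<noteq> j" "r \<in> carrier R"
  shows "inv\<^bsub>Steinberg R\<^esub> st_elem R i j r = pres_class (st_gens R) (st_rels R) [((i, j, r), False)]"
proof (rule group.inv_equality[OF group_Steinberg])
  have g: "(i, j, r) \<in> st_gens R" using assms by (simp add: st_gens_def)
  have w: "[((i, j, r), b)] \<in> words (st_gens R)" for b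
    using assms by (auto simp: words_def st_gens_def)
  show "pres_class (st_gens R) (st_rels R) [((i, j, r), False)] \<otimes>\<^bsub>Steinberg R\<^esub> st_elem R i j r =
      \<one>\<^bsub>Steinberg R\<^esub>"
    using pres_class_eqI[OF pres_cancel[of "(i, j, r)" "st_gens R" "st_rels R" False]] g
    by (simp add: Steinberg_def st_elem_def presented_mult[OF w w] presented_one)
  show "pres_class (st_gens R) (st_rels R) [((i, j, r), False)] \<in> carrier (Steinberg R)"
    unfolding Steinberg_def presented_carrier using w by blast
qed (use assms in \<open>rule st_elem_closed\<close>)

text \<open>Classes multiply by concatenation and \<open>st_elem_inv\<close> handles the inverse
  letters, so evaluation in the target group is a relabelling of letters. The map induced by
  \<open>f\<close> can thus be computed on words.\<close>

lemma word_eval_Steinberg: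
  assumes "f \<in> carrier R \<rightarrow> carrier S" "w \<in> words (st_gens R)"
  shows "word_eval (Steinberg S) (\<lambda>(i, j, r). st_elem S i j (f r)) w =
    pres_class (st_gens S) (st_rels S) (wmap f w)"
  using assms(2)
proof (induction w)
  case Nil
  then show ?case by (simp add: word_eval_def Steinberg_def presented_one)
next
  case (Cons a w)
  obtain i j r b where a: "a = ((i, j, r), b)" by (metis surj_pair)
  have w: "w \<in> words (st_gens R)" and ij: "i \<noteq> j" "r \<in> carrier R"
    using Cons.prems by (auto simp: a words_def st_gens_def)
  have g: "[((i, j, f r), b)] \<in> words (st_gens S)"
    using ij assms(1) by (auto simp: words_def st_gens_def)
  have "(if b then st_elem S i j (f r) else inv\<^bsub>Steinberg S\<^esub> st_elem S i j (f r)) =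
      pres_class (st_gens S) (st_rels S) [((i, j, f r), b)]"
    using st_elem_inv[of i j "f r" S] ij assms(1) by (auto simp: st_elem_def)
  moreover have "word_eval (Steinberg S) (\<lambda>(i, j, r). st_elem S i j (f r)) (a # w) =
      (if b then st_elem S i j (f r) else inv\<^bsub>Steinberg S\<^esub> st_elem S i j (f r)) \<otimes>\<^bsub>Steinberg S\<^esub>
      word_eval (Steinberg S) (\<lambda>(i, j, r). st_elem S i j (f r)) w"
    by (simp add: a word_eval_def)
  ultimately show ?case
    using Cons.IH[OF w] presented_mult[OF g wmap_words[OF assms(1) w], of "st_rels S"]
    by (simp only: Steinberg_def) (simp add: a)
qed

lemma wmap_st_rels:
  assumes "f \<in> ring_hom R S" "(u, v) \<in> st_rels R"
  shows "(wmap f u, wmap f v) \<in> st_rels S"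
  using assms(2)
proof cases
  case (st_add i j r s)
  then show ?thesis using assms(1)
    by (simp add: ring_hom_add ring_hom_closed st_rels.st_add)
next
  case (st_comm i j k r s)
  then show ?thesis using assms(1) st_rels.st_comm[of i j k "f r" S "f s"]
    by (simp add: ring_hom_mult ring_hom_closed comm_word_def)
next
  case (st_commute i j k l r s)
  then show ?thesis using assms(1) st_rels.st_commute[of i j k l "f r" S "f s"]
    by (simp add: ring_hom_closed comm_word_def)
qed

lemma Steinberg_images:
  assumes "f \<in> ring_hom R S"
  shows "pres_images (Steinberg S) (st_gens R) (st_rels R) (\<lambda>(i, j, r). st_elem S i j (f r))"
proof -
  interpret group "Steinberg S" by (rule group_Steinberg)
  have f: "f \<in> carrier R \<rightarrow> carrier S" using assms by (auto simp: ring_hom_closed)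
  show ?thesis
  proof
    fix g assume "g \<in> st_gens R"
    then show "(case g of (i, j, r) \<Rightarrow> st_elem S i j (f r)) \<in> carrier (Steinberg S)"
      using f by (auto simp: st_gens_def intro: st_elem_closed)
  next
    fix u v assume uv: "(u, v) \<in> st_rels R" "u \<in> words (st_gens R)" "v \<in> words (st_gens R)"
    show "word_eval (Steinberg S) (\<lambda>(i, j, r). st_elem S i j (f r)) u =
        word_eval (Steinberg S) (\<lambda>(i, j, r). st_elem S i j (f r)) v"
      unfolding word_eval_Steinberg[OF f uv(2)] word_eval_Steinberg[OF f uv(3)]
      by (intro pres_class_eqI pres_rel wmap_st_rels[OF assms uv(1)] wmap_words[OF f] uv)
  qed
qed


lemma st_to_GL_class:
  assumes "ring R" "w \<in> words (st_gens R)"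
  shows "st_to_GL R (pres_class (st_gens R) (st_rels R) w) = word_eval (GL R) (elem_mat R) w"
  unfolding st_to_GL_def by (rule pres_images.lift_class[OF ring.GL_images[OF assms(1)] assms(2)])

lemma st_to_GL_hom: "ring R \<Longrightarrow> st_to_GL R \<in> hom (Steinberg R) (GL R)"
  unfolding st_to_GL_def Steinberg_def by (rule pres_images.lift_hom[OF ring.GL_images])

lemma st_map_class:
  assumes "f \<in> ring_hom R S" "w \<in> words (st_gens R)"
  shows "st_map S f (pres_class (st_gens R) (st_rels R) w) =
    pres_class (st_gens S) (st_rels S) (wmap f w)"
proof -
  have f: "f \<in> carrier R \<rightarrow> carrier S" using assms(1) by (auto simp: ring_hom_closed)
  show ?thesis
    unfolding st_map_def pres_images.lift_class[OF Steinberg_images[OF assms(1)] assms(2)]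
    by (rule word_eval_Steinberg[OF f assms(2)])
qed

lemma st_map_hom: "f \<in> ring_hom R S \<Longrightarrow> st_map S f \<in> hom (Steinberg R) (Steinberg S)"
  unfolding st_map_def Steinberg_def[of R] by (rule pres_images.lift_hom[OF Steinberg_images])

lemma (in ring) word_eval_GL_entry:
  "w \<in> words (st_gens R) \<Longrightarrow> word_eval (GL R) (elem_mat R) w k l \<in> carrier R"
  using GL_rf[OF pres_images.eval_closed[OF GL_images]] by simp

lemma (in ring) word_eval_GL_Cons:
  fixes b :: bool
  assumes "i \<noteq> j" "r \<in> carrier R" "w \<in> words (st_gens R)"
  defines "X \<equiv> word_eval (GL R) (elem_mat R) w" and "c \<equiv> if b then r else \<ominus> r"
  shows "word_eval (GL R) (elem_mat R) (((i, j, r), b) # w) =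
    (\<lambda>k l. if k = i then X i l \<oplus> c \<otimes> X j l else X k l)"
proof -
  have "X k l \<in> carrier R" for k l unfolding X_def using assms(3) by (rule word_eval_GL_entry)
  moreover have "word_eval (GL R) (elem_mat R) (((i, j, r), b) # w) = elem_mat R (i, j, c) \<otimes>\<^bsub>Q\<^esub> X"
    using assms(1,2) by (simp add: word_eval_def X_def c_def GL_inv_elem_mat GL_mult)
  moreover have "c \<in> carrier R" using assms(2) by (simp add: c_def)
  ultimately show ?thesis using elem_mat_mult[OF assms(1)] by simp
qed

text \<open>Each letter acts by a row operation with coefficient \<open>r\<close> or
  \<open>- r\<close>, and a ring homomorphism carries it to the row operation with coefficient
  \<open>f r\<close> or \<open>- f r\<close>.\<close>

lemma word_eval_GL_natural:
  assumes "ring R" "ring S" "f \<in> ring_hom R S" "w \<in> words (st_gens R)"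
  shows "word_eval (GL S) (elem_mat S) (wmap f w) = (\<lambda>i j. f (word_eval (GL R) (elem_mat R) w i j))"
  using assms(4)
proof (induction w)
  case Nil
  interpret R: ring R by fact
  interpret S: ring S by fact
  show ?case using assms(3)
    by (auto simp: word_eval_def id_mat_def R.GL_one S.GL_one fun_eq_iff ring_hom_one
        ring_hom_zero[OF assms(3,1,2)])
next
  case (Cons a w)
  interpret R: ring R by fact
  interpret S: ring S by fact
  interpret h: ring_hom_ring R S f using assms by (intro ring_hom_ringI2)
  obtain i j r b where a: "a = ((i, j, r), b)" by (metis surj_pair)
  have w: "w \<in> words (st_gens R)" and ij: "i \<noteq> j" "r \<in> carrier R"
    using Cons.prems by (auto simp: a words_def st_gens_def)
  have f: "f \<in> carrier R \<rightarrow> carrier S" by auto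
  have X: "word_eval (GL R) (elem_mat R) w k l \<in> carrier R" for k l
    using w by (rule R.word_eval_GL_entry)
  show ?case
    unfolding a using ij R.word_eval_GL_Cons[OF ij w, of b] Cons.IH[OF w] X
      S.word_eval_GL_Cons[OF ij(1) _ wmap_words[OF f w], of "f r" b]
    by (auto simp: fun_eq_iff)
qed

lemma st_to_GL_natural:
  assumes "ring R" "ring S" "f \<in> ring_hom R S" "x \<in> carrier (Steinberg R)"
  shows "st_to_GL S (st_map S f x) = (\<lambda>i j. f (st_to_GL R x i j))"
proof -
  have f: "f \<in> carrier R \<rightarrow> carrier S" using assms by (auto simp: ring_hom_closed)
  obtain w where w: "w \<in> words (st_gens R)" "x = pres_class (st_gens R) (st_rels R) w"
    using assms(4) by (auto simp: Steinberg_def presented_carrier)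
  then show ?thesis
    using assms wmap_words[OF f] by (simp add: st_map_class st_to_GL_class word_eval_GL_natural)
qed

lemma st_map_surj:
  assumes "f \<in> ring_hom R S" "f ` carrier R = carrier S"
  shows "st_map S f ` carrier (Steinberg R) = carrier (Steinberg S)"
proof
  show "st_map S f ` carrier (Steinberg R) \<subseteq> carrier (Steinberg S)"
    using st_map_hom[OF assms(1)] by (auto simp: hom_def)
  show "carrier (Steinberg S) \<subseteq> st_map S f ` carrier (Steinberg R)"
  proof
    fix y assume "y \<in> carrier (Steinberg S)"
    then obtain v where v: "v \<in> words (st_gens S)" "y = pres_class (st_gens S) (st_rels S) v"
      by (auto simp: Steinberg_def presented_carrier)
    \<comment> \<open>\<open>g\<close> is a set-theoretic section of \<open>f\<close>, in general
      not a homomorphism; it is applied to the letters of a representing word rather than to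
      classes.\<close>
    define g where "g s = (SOME r. r \<in> carrier R \<and> f r = s)" for s
    have g: "g s \<in> carrier R \<and> f (g s) = s" if "s \<in> carrier S" for s
    proof -
      have "s \<in> f ` carrier R" using that assms(2) by simp
      then have "\<exists>r. r \<in> carrier R \<and> f r = s" by auto
      then show ?thesis unfolding g_def by (rule someI_ex)
    qed
    have w: "wmap g v \<in> words (st_gens R)" using g v(1) by (intro wmap_words[of g S R]) auto
    have "wmap f (wmap g v) = v"
      using v(1) g by (auto simp: words_def st_gens_def in_lists_conv_set intro!: map_idI)
    then have "st_map S f (pres_class (st_gens R) (st_rels R) (wmap g v)) = y"
      using st_map_class[OF assms(1) w] v by simp
    moreover have "pres_class (st_gens R) (st_rels R) (wmap g v) \<in> carrier (Steinberg R)"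
      using w by (auto simp: Steinberg_def presented_carrier)
    ultimately show "y \<in> st_map S f ` carrier (Steinberg R)" by blast
  qed
qed

lemma K2_carrier:
  assumes "ring R"
  shows "carrier (K2 R) = {x \<in> carrier (Steinberg R). st_to_GL R x = id_mat R}"
  by (auto simp: K2_def kernel_def ring.GL_one[OF assms])

text \<open>A diagram chase. A lift \<open>x\<close> of an element of \<open>K2 S\<close> has a
  matrix that becomes 1 over \<open>S\<close>. Dividing \<open>x\<close> by an element
  \<open>z\<close> of the kernel of \<open>st_map\<close> with the same matrix makes the matrix
  trivial without changing the image. The hypothesis \<open>lift\<close> supplies this
  \<open>z\<close>, and is where the arithmetic of the rings enters.\<close>

lemma K2_map_surjI:
  assumes "ring R" "ring S" "f \<in> ring_hom R S" "f ` carrier R = carrier S"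
    and lift: "\<And>y. y \<in> carrier (Steinberg R) \<Longrightarrow> (\<And>i j. f (st_to_GL R y i j) = id_mat S i j) \<Longrightarrow>
      \<exists>z\<in>carrier (Steinberg R). st_to_GL R z = st_to_GL R y \<and> st_map S f z = \<one>\<^bsub>Steinberg S\<^esub>"
  shows "K2_map R S f ` carrier (K2 R) = carrier (K2 S)"
proof -
  interpret R: ring R by fact
  interpret S: ring S by fact
  interpret m: group_hom "Steinberg R" "Steinberg S" "st_map S f"
    by (intro group_hom.intro group_Steinberg group_hom_axioms.intro st_map_hom assms)
  interpret e: group_hom "Steinberg R" "GL R" "st_to_GL R"
    by (intro group_hom.intro group_Steinberg R.group_GL group_hom_axioms.intro st_to_GL_hom assms)
  have "st_map S f ` carrier (K2 R) = carrier (K2 S)"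
  proof (intro equalityI subsetI)
    fix y assume "y \<in> st_map S f ` carrier (K2 R)"
    then obtain x where x: "x \<in> carrier (Steinberg R)" "st_to_GL R x = id_mat R" "y = st_map S f x"
      by (auto simp: K2_carrier[OF assms(1)])
    then have "st_to_GL S y = id_mat S"
      using st_to_GL_natural[OF assms(1-3) x(1)]
      by (auto simp: fun_eq_iff id_mat_def ring_hom_one[OF assms(3)] ring_hom_zero[OF assms(3,1,2)])
    then show "y \<in> carrier (K2 S)" using x by (simp add: K2_carrier[OF assms(2)])
  next
    fix y assume "y \<in> carrier (K2 S)"
    then have y: "y \<in> carrier (Steinberg S)" "st_to_GL S y = id_mat S"
      by (auto simp: K2_carrier[OF assms(2)])
    then obtain x where x: "x \<in> carrier (Steinberg R)" "y = st_map S f x"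
      using st_map_surj[OF assms(3,4)] by blast
    have "f (st_to_GL R x i j) = id_mat S i j" for i j
      using st_to_GL_natural[OF assms(1-3) x(1)] x(2) y(2) by metis
    from lift[OF x(1) this] obtain z where z: "z \<in> carrier (Steinberg R)"
      "st_to_GL R z = st_to_GL R x" "st_map S f z = \<one>\<^bsub>Steinberg S\<^esub>" by blast
    let ?x = "x \<otimes>\<^bsub>Steinberg R\<^esub> inv\<^bsub>Steinberg R\<^esub> z"
    have "st_to_GL R ?x = \<one>\<^bsub>GL R\<^esub>" using x z e.hom_closed[OF x(1)] by (simp add: e.H.r_inv)
    then have "?x \<in> carrier (K2 R)" using x z by (simp add: K2_carrier[OF assms(1)] R.GL_one)
    moreover have "st_map S f ?x = y" using x z y by simp
    ultimately show "y \<in> st_map S f ` carrier (K2 R)" by blast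
  qed
  then show ?thesis by (simp add: K2_map_def)
qed

section \<open>Congruences modulo an integer\<close>

text \<open>Stated for an arbitrary ring, since it serves \<open>R\<close>, group rings and matrices
  alike: natural multiples are central, so congruences multiply even without commutativity. For
  \<open>N = 0\<close> it is equality with \<open>y\<close>, provided that \<open>y\<close> lies in
  the carrier.\<close>

definition ncong :: "('a, 'b) ring_scheme \<Rightarrow> nat \<Rightarrow> 'a \<Rightarrow> 'a \<Rightarrow> bool"
  where "ncong R N x y \<longleftrightarrow> (\<exists>z\<in>carrier R. x = y \<oplus>\<^bsub>R\<^esub> [N] \<cdot>\<^bsub>R\<^esub> z)"

context ring
begin

lemma add_pow_distrib: "x \<in> carrier R \<Longrightarrow> y \<in> carrier R \<Longrightarrow> [(N::nat)] \<cdot> (x \<oplus> y) = [N] \<cdot> x \<oplus> [N] \<cdot> y"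
  by (rule add.nat_pow_distrib)

lemma add_pow_add: "x \<in> carrier R \<Longrightarrow> [(M + N :: nat)] \<cdot> x = [M] \<cdot> x \<oplus> [N] \<cdot> x"
  by (simp add: add.nat_pow_mult)

lemma add_pow_mult: "x \<in> carrier R \<Longrightarrow> [(M * N :: nat)] \<cdot> x = [M] \<cdot> ([N] \<cdot> x)"
  by (simp add: add.nat_pow_pow mult.commute)

lemma add_pow_neg: "x \<in> carrier R \<Longrightarrow> [(N::nat)] \<cdot> (\<ominus> x) = \<ominus> ([N] \<cdot> x)"
  by (simp add: add.nat_pow_inv)

lemma ncongI: "z \<in> carrier R \<Longrightarrow> x = y \<oplus> [N] \<cdot> z \<Longrightarrow> ncong R N x y"
  by (auto simp: ncong_def)

lemma ncongE:
  assumes "ncong R N x y" obtains z where "z \<in> carrier R" "x = y \<oplus> [N] \<cdot> z"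
  using assms by (auto simp: ncong_def)

lemma ncong_refl [simp]: "x \<in> carrier R \<Longrightarrow> ncong R N x x"
  by (rule ncongI[of \<zero>]) auto

lemma ncong_sym:
  assumes "ncong R N x y" "y \<in> carrier R" shows "ncong R N y x"
proof -
  obtain z where z: "z \<in> carrier R" "x = y \<oplus> [N] \<cdot> z" using assms(1) by (rule ncongE)
  then show ?thesis using assms(2)
    by (intro ncongI[of "\<ominus> z"]) (auto simp: add_pow_neg a_assoc r_neg)
qed

lemma ncong_trans:
  assumes "ncong R N x y" "ncong R N y z" "z \<in> carrier R" shows "ncong R N x z"
proof -
  obtain a where a: "a \<in> carrier R" "x = y \<oplus> [N] \<cdot> a" using assms(1) by (rule ncongE)
  obtain b where b: "b \<in> carrier R" "y = z \<oplus> [N] \<cdot> b" using assms(2) by (rule ncongE)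
  show ?thesis using a b assms(3)
    by (intro ncongI[of "b \<oplus> a"]) (auto simp: add_pow_distrib a_assoc)
qed

lemma ncong_add:
  assumes "ncong R N x x'" "ncong R N y y'" "x' \<in> carrier R" "y' \<in> carrier R"
  shows "ncong R N (x \<oplus> y) (x' \<oplus> y')"
proof -
  obtain a where a: "a \<in> carrier R" "x = x' \<oplus> [N] \<cdot> a" using assms(1) by (rule ncongE)
  obtain b where b: "b \<in> carrier R" "y = y' \<oplus> [N] \<cdot> b" using assms(2) by (rule ncongE)
  show ?thesis using a b assms(3,4)
    by (intro ncongI[of "a \<oplus> b"]) (auto simp: add_pow_distrib a_ac)
qed

lemma ncong_mult:
  assumes "ncong R N x x'" "ncong R N y y'" "x' \<in> carrier R" "y' \<in> carrier R"
  shows "ncong R N (x \<otimes> y) (x' \<otimes> y')"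
proof -
  obtain a where a: "a \<in> carrier R" "x = x' \<oplus> [N] \<cdot> a" using assms(1) by (rule ncongE)
  obtain b where b: "b \<in> carrier R" "y = y' \<oplus> [N] \<cdot> b" using assms(2) by (rule ncongE)
  have "x \<otimes> y = x' \<otimes> y' \<oplus> [N] \<cdot> (a \<otimes> y' \<oplus> x' \<otimes> b \<oplus> [N] \<cdot> (a \<otimes> b))"
    using a b assms(3,4)
    by (simp add: l_distr r_distr add_pow_distrib add_pow_ldistr add_pow_rdistr a_ac)
  then show ?thesis using a b assms(3,4) by (intro ncongI) auto
qed

lemma ncong_dvd:
  assumes "ncong R N x y" "M dvd N" shows "ncong R M x y"
proof -
  obtain z where z: "z \<in> carrier R" "x = y \<oplus> [N] \<cdot> z" using assms(1) by (rule ncongE)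
  obtain c where c: "N = M * c" using assms(2) by (rule dvdE)
  show ?thesis using z by (intro ncongI[of "[c] \<cdot> z"]) (auto simp: c add_pow_mult)
qed

lemma ncong_scale:
  assumes "ncong R M x y" "y \<in> carrier R" shows "ncong R (N * M) ([N] \<cdot> x) ([N] \<cdot> y)"
proof -
  obtain z where z: "z \<in> carrier R" "x = y \<oplus> [M] \<cdot> z" using assms(1) by (rule ncongE)
  then show ?thesis using assms(2) by (intro ncongI[of z]) (auto simp: add_pow_distrib add_pow_mult)
qed

lemma ncong_add_pow: "z \<in> carrier R \<Longrightarrow> y \<in> carrier R \<Longrightarrow> ncong R N (y \<oplus> [N] \<cdot> z) y"
  by (rule ncongI) auto

text \<open>Binomial expansion. The quadratic coefficient stays explicit because its divisibility by
  \<open>p\<close> is what the next lemma depends on; from the cubic term on, three factors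
  \<open>Y\<close> already contain enough powers of \<open>p\<close> once \<open>Y\<close> is a
  multiple of \<open>p ^ k\<close> with \<open>k > 0\<close>.\<close>

lemma one_plus_power:
  assumes Y: "Y \<in> carrier R"
  shows "\<exists>Z\<in>carrier R. (\<one> \<oplus> Y) [^] (q::nat) =
    \<one> \<oplus> [q] \<cdot> Y \<oplus> [(q choose 2)] \<cdot> (Y \<otimes> Y) \<oplus> Y \<otimes> Y \<otimes> Y \<otimes> Z"
proof (induction q)
  case 0
  show ?case by (rule bexI[of _ \<zero>]) (use Y in \<open>auto simp: numeral_2_eq_2\<close>)
next
  case (Suc q)
  then obtain Z where Z: "Z \<in> carrier R" "(\<one> \<oplus> Y) [^] q =
    \<one> \<oplus> [q] \<cdot> Y \<oplus> [(q choose 2)] \<cdot> (Y \<otimes> Y) \<oplus> Y \<otimes> Y \<otimes> Y \<otimes> Z" by blast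
  let ?c = "q choose 2"
  have c: "Suc q choose 2 = ?c + q" by (simp add: numeral_2_eq_2)
  have "(\<one> \<oplus> Y) [^] Suc q = (\<one> \<oplus> [q] \<cdot> Y \<oplus> [?c] \<cdot> (Y \<otimes> Y) \<oplus> Y \<otimes> Y \<otimes> Y \<otimes> Z) \<otimes> (\<one> \<oplus> Y)"
    using Z by simp
  also have "\<dots> = \<one> \<oplus> ([q] \<cdot> Y \<oplus> Y) \<oplus> ([?c] \<cdot> (Y \<otimes> Y) \<oplus> [q] \<cdot> (Y \<otimes> Y)) \<oplus>
      Y \<otimes> Y \<otimes> Y \<otimes> ([?c] \<cdot> \<one> \<oplus> Z \<oplus> Z \<otimes> Y)"
    using Y Z(1)
    by (simp add: l_distr r_distr add_pow_ldistr add_pow_rdistr a_ac m_assoc)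
  also have "\<dots> = \<one> \<oplus> [Suc q] \<cdot> Y \<oplus> [(Suc q choose 2)] \<cdot> (Y \<otimes> Y) \<oplus>
      Y \<otimes> Y \<otimes> Y \<otimes> ([?c] \<cdot> \<one> \<oplus> Z \<oplus> Z \<otimes> Y)"
    using Y by (simp only: c add_pow_add m_closed add.nat_pow_Suc)
  finally show ?case using Y Z(1) by (intro bexI[of _ "[?c] \<cdot> \<one> \<oplus> Z \<oplus> Z \<otimes> Y"]) auto
qed

text \<open>This step fails for \<open>p = 2\<close>, \<open>k = 1\<close>: there the term in \<open>V\<^sup>2\<close> is not divisible by \<open>p\<^sup>k\<^sup>+\<^sup>2\<close>.\<close>

lemma one_plus_prime_power:
  assumes "prime p" "k > 0" "p ^ k > (2::nat)" and V: "V \<in> carrier R"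
  shows "\<exists>V'\<in>carrier R. (\<one> \<oplus> [(p ^ k)] \<cdot> V) [^] p = \<one> \<oplus> [(p ^ Suc k)] \<cdot> V' \<and> ncong R p V' V"
proof -
  let ?Y = "[(p ^ k)] \<cdot> V"
  obtain Z where Z: "Z \<in> carrier R" "(\<one> \<oplus> ?Y) [^] p =
    \<one> \<oplus> [p] \<cdot> ?Y \<oplus> [(p choose 2)] \<cdot> (?Y \<otimes> ?Y) \<oplus> ?Y \<otimes> ?Y \<otimes> ?Y \<otimes> Z"
    using one_plus_power[of ?Y p] V by auto
  \<comment> \<open>The quadratic term has to be divisible by \<open>p ^ (k + 2)\<close>. For odd
    \<open>p\<close> one factor \<open>p\<close> comes from the binomial coefficient, and
    \<open>2 * k + 1 \<ge> k + 2\<close>; for \<open>p = 2\<close> that coefficient is 1, and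
    \<open>2 * k \<ge> k + 2\<close> because \<open>2 ^ k > 2\<close>.\<close>
  have "\<exists>c. (p choose 2) * p ^ k * p ^ k = p ^ Suc k * (p * c)"
  proof (cases "p = 2")
    case True
    with assms obtain j where "k = Suc (Suc j)"
      by (cases k; cases "k - 1") auto
    then show ?thesis using True by (intro exI[of _ "2 ^ j"]) (simp add: power_add)
  next
    case False
    then have "odd p" using assms(1) primes_dvd_imp_eq two_is_prime_nat by blast
    then obtain c where "p = 2 * c + 1" by (rule oddE)
    then have "p choose 2 = p * c" by (simp add: choose_two)
    moreover obtain j where "k = Suc j" using assms(2) by (cases k) auto
    ultimately show ?thesis by (intro exI[of _ "p ^ j * c"]) simp
  qed
  then obtain c where c: "(p choose 2) * p ^ k * p ^ k = p ^ Suc k * (p * c)" by blast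
  obtain j where j: "k = Suc j" using assms(2) by (cases k) auto
  have d: "p ^ k * p ^ k * p ^ k = p ^ Suc k * (p * (p ^ j * p ^ j))" by (simp add: j power_add)
  let ?E = "[c] \<cdot> (V \<otimes> V) \<oplus> [(p ^ j * p ^ j)] \<cdot> (V \<otimes> V \<otimes> V \<otimes> Z)"
  have E: "?E \<in> carrier R" using V Z by auto
  have "[(p choose 2)] \<cdot> (?Y \<otimes> ?Y) = [((p choose 2) * p ^ k * p ^ k)] \<cdot> (V \<otimes> V)"
    using V by (simp add: add_pow_ldistr add_pow_rdistr add_pow_mult)
  also have "\<dots> = [(p ^ Suc k)] \<cdot> ([p] \<cdot> ([c] \<cdot> (V \<otimes> V)))"
    unfolding c using V by (simp only: add_pow_mult m_closed add.nat_pow_closed)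
  finally have 1: "[(p choose 2)] \<cdot> (?Y \<otimes> ?Y) = [(p ^ Suc k)] \<cdot> ([p] \<cdot> ([c] \<cdot> (V \<otimes> V)))" .
  have "?Y \<otimes> ?Y \<otimes> ?Y \<otimes> Z = [(p ^ k * p ^ k * p ^ k)] \<cdot> (V \<otimes> V \<otimes> V \<otimes> Z)"
    using V Z(1) by (simp add: add_pow_ldistr add_pow_rdistr add_pow_mult)
  also have "\<dots> = [(p ^ Suc k)] \<cdot> ([p] \<cdot> ([(p ^ j * p ^ j)] \<cdot> (V \<otimes> V \<otimes> V \<otimes> Z)))"
    unfolding d using V Z(1) by (simp only: add_pow_mult m_closed add.nat_pow_closed)
  finally have 2: "?Y \<otimes> ?Y \<otimes> ?Y \<otimes> Z =
      [(p ^ Suc k)] \<cdot> ([p] \<cdot> ([(p ^ j * p ^ j)] \<cdot> (V \<otimes> V \<otimes> V \<otimes> Z)))" .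
  have 3: "[p] \<cdot> ?Y = [(p ^ Suc k)] \<cdot> V" using V by (simp add: add_pow_mult)
  have "(\<one> \<oplus> ?Y) [^] p = \<one> \<oplus> [(p ^ Suc k)] \<cdot> (V \<oplus> [p] \<cdot> ?E)"
    unfolding Z(2) 1 2 3 using V Z(1)
    by (simp only: add_pow_distrib a_assoc m_closed a_closed add.nat_pow_closed one_closed)
  then show ?thesis using V E by (intro bexI[of _ "V \<oplus> [p] \<cdot> ?E"] conjI ncong_add_pow) auto
qed

lemma one_plus_prime_power_iter:
  assumes "prime p" "k > 0" "p ^ k > (2::nat)" and V: "V \<in> carrier R"
  shows "\<exists>V'\<in>carrier R. (\<one> \<oplus> [(p ^ k)] \<cdot> V) [^] (p ^ j) = \<one> \<oplus> [(p ^ (k + j))] \<cdot> V' \<and> ncong R p V' V"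
proof (induction j)
  case 0
  show ?case using V by (intro bexI[of _ V]) auto
next
  case (Suc j)
  then obtain V' where V': "V' \<in> carrier R" "ncong R p V' V"
    "(\<one> \<oplus> [(p ^ k)] \<cdot> V) [^] (p ^ j) = \<one> \<oplus> [(p ^ (k + j))] \<cdot> V'" by blast
  have "p ^ (k + j) > 2"
    using assms(3) power_increasing[of k "k + j" p] prime_ge_1_nat[OF assms(1)] by linarith
  with one_plus_prime_power[OF assms(1) _ _ V'(1), of "k + j"] assms(2)
  obtain V'' where V'': "V'' \<in> carrier R" "ncong R p V'' V'"
    "(\<one> \<oplus> [(p ^ (k + j))] \<cdot> V') [^] p = \<one> \<oplus> [(p ^ Suc (k + j))] \<cdot> V''" by auto
  have "(\<one> \<oplus> [(p ^ k)] \<cdot> V) [^] (p ^ Suc j) = ((\<one> \<oplus> [(p ^ k)] \<cdot> V) [^] (p ^ j)) [^] p"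
    using V by (simp add: nat_pow_pow mult.commute)
  then have "(\<one> \<oplus> [(p ^ k)] \<cdot> V) [^] (p ^ Suc j) = \<one> \<oplus> [(p ^ (k + Suc j))] \<cdot> V''"
    using V'(3) V''(3) by simp
  moreover have "ncong R p V'' V" using ncong_trans[OF V''(2) V'(2) V] .
  ultimately show ?case using V''(1) by blast
qed

end

section \<open>Successive approximation\<close>

text \<open>The matrix factors are abstracted to elements \<open>1 + lin s b\<close> of a ring
  \<open>Q\<close>, with \<open>lin s\<close> additive in the parameter \<open>b\<close>.
  \<open>L\<close> is a list because factors need not commute; it is distinct so that the first
  order change of the product is a sum over \<open>set L\<close>.\<close>

locale approximation = A: ring A + Q: ring Q for A :: "('a, 'c) ring_scheme" and Q :: "('q, 'd) ring_scheme" (structure) +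
  fixes p n :: nat and L :: "'s list" and lin :: "'s \<Rightarrow> 'a \<Rightarrow> 'q"
  assumes n: "n > 0"
    and dist: "distinct L"
    and lin_closed: "s \<in> set L \<Longrightarrow> x \<in> carrier A \<Longrightarrow> lin s x \<in> carrier Q"
    and lin_add: "s \<in> set L \<Longrightarrow> x \<in> carrier A \<Longrightarrow> y \<in> carrier A \<Longrightarrow> lin s (x \<oplus>\<^bsub>A\<^esub> y) = lin s x \<oplus> lin s y"
begin

text \<open>The multiple \<open>p ^ n\<close> is taken inside the parameter. Thus \<open>b\<close>
  ranges freely over \<open>A\<close>, where limits are formed, while the product stays 1 modulo
  \<open>p ^ n\<close>.\<close>

definition prod_of :: "'s list \<Rightarrow> ('s \<Rightarrow> 'a) \<Rightarrow> 'q"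
  where "prod_of M b = foldr (\<lambda>s X. (\<one> \<oplus> lin s ([(p ^ n)] \<cdot>\<^bsub>A\<^esub> b s)) \<otimes> X) M \<one>"

lemma lin_zero: "s \<in> set L \<Longrightarrow> lin s \<zero>\<^bsub>A\<^esub> = \<zero>"
  using lin_add[of s "\<zero>\<^bsub>A\<^esub>" "\<zero>\<^bsub>A\<^esub>"] lin_closed[of s "\<zero>\<^bsub>A\<^esub>"]
  by (metis A.l_zero A.zero_closed Q.add.l_cancel_one')

lemma lin_pow: "s \<in> set L \<Longrightarrow> x \<in> carrier A \<Longrightarrow> lin s ([(N::nat)] \<cdot>\<^bsub>A\<^esub> x) = [N] \<cdot> lin s x"
  by (induction N) (simp_all add: lin_zero lin_add)

lemma prod_of_closed:
  "set M \<subseteq> set L \<Longrightarrow> b \<in> set L \<rightarrow> carrier A \<Longrightarrow> prod_of M b \<in> carrier Q"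
  by (induction M) (auto simp: prod_of_def intro!: lin_closed)

lemma prod_of_ncong_one:
  "set M \<subseteq> set L \<Longrightarrow> b \<in> set L \<rightarrow> carrier A \<Longrightarrow> ncong Q (p ^ n) (prod_of M b) \<one>"
proof (induction M)
  case Nil
  then show ?case by (simp add: prod_of_def)
next
  case (Cons s M)
  then have s: "s \<in> set L" "b s \<in> carrier A" by auto
  have "ncong Q (p ^ n) (\<one> \<oplus> lin s ([(p ^ n)] \<cdot>\<^bsub>A\<^esub> b s)) \<one>"
    using s by (simp add: lin_pow lin_closed Q.ncong_add_pow)
  then have "ncong Q (p ^ n) ((\<one> \<oplus> lin s ([(p ^ n)] \<cdot>\<^bsub>A\<^esub> b s)) \<otimes> prod_of M b) (\<one> \<otimes> \<one>)"
    using Cons by (intro Q.ncong_mult) auto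
  then show ?case by (simp add: prod_of_def)
qed

text \<open>All factors are 1 modulo \<open>p\<close>, so to first order a change of parameters acts additively.\<close>

lemma prod_of_step:
  assumes b: "b \<in> set L \<rightarrow> carrier A" and d: "d \<in> set L \<rightarrow> carrier A"
  shows "set M \<subseteq> set L \<Longrightarrow> distinct M \<Longrightarrow>
    ncong Q (p ^ (n + k + 1)) (prod_of M (\<lambda>s. b s \<oplus>\<^bsub>A\<^esub> [(p ^ k)] \<cdot>\<^bsub>A\<^esub> d s))
      (prod_of M b \<oplus> [(p ^ (n + k))] \<cdot> (\<Oplus>s\<in>set M. lin s (d s)))"
proof (induction M)
  case Nil
  then show ?case by (simp add: prod_of_def)
next
  case (Cons s M)
  let ?K = "p ^ (n + k)" and ?K' = "p ^ (n + k + 1)"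
  let ?w = "\<lambda>b. \<one> \<oplus> lin s ([(p ^ n)] \<cdot>\<^bsub>A\<^esub> b s)"
  let ?b = "\<lambda>s. b s \<oplus>\<^bsub>A\<^esub> [(p ^ k)] \<cdot>\<^bsub>A\<^esub> d s"
  let ?x = "lin s (d s)" and ?y = "\<Oplus>s\<in>set M. lin s (d s)" and ?W = "prod_of M b"
  have s: "s \<in> set L" "b s \<in> carrier A" "d s \<in> carrier A" using Cons b d by auto
  have M: "set M \<subseteq> set L" "distinct M" "s \<notin> set M" using Cons by auto
  have cl: "?w b \<in> carrier Q" "?x \<in> carrier Q" "?W \<in> carrier Q"
    using s M b by (auto intro!: lin_closed prod_of_closed)
  have y: "?y \<in> carrier Q" using M(1) d by (auto intro!: Q.finsum_closed lin_closed)
  have w: "?w ?b = ?w b \<oplus> [?K] \<cdot> ?x"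
    using s by (simp add: lin_add lin_pow lin_closed A.add_pow_distrib Q.a_assoc power_add Q.add_pow_mult)
  have "p dvd p ^ n" using n by (simp add: dvd_power)
  note pn = this
  have one: "ncong Q p ?W \<one>"
    by (rule Q.ncong_dvd[OF prod_of_ncong_one[OF M(1) b] pn])
  have one': "ncong Q p (?w b) \<one>"
    using s by (intro Q.ncong_dvd[OF _ pn]) (simp add: lin_pow lin_closed Q.ncong_add_pow)
  \<comment> \<open>The first order term carries the factor \<open>?K = p ^ (n + k)\<close>, so to
    know it modulo \<open>p ^ (n + k + 1)\<close> its cofactor is needed modulo \<open>p\<close>
    only, where \<open>?W\<close> and \<open>?w b\<close> are 1.\<close>
  have "ncong Q p (?x \<otimes> ?W \<oplus> ?w b \<otimes> ?y) (?x \<otimes> \<one> \<oplus> \<one> \<otimes> ?y)"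
    using cl y one one' by (intro Q.ncong_add Q.ncong_mult) auto
  then have "ncong Q p (?x \<otimes> ?W \<oplus> ?w b \<otimes> ?y) (?x \<oplus> ?y)" using cl y by simp
  from Q.ncong_scale[OF this, of ?K] cl y
  have first: "ncong Q ?K' ([?K] \<cdot> (?x \<otimes> ?W \<oplus> ?w b \<otimes> ?y)) ([?K] \<cdot> (?x \<oplus> ?y))"
    by (simp add: mult.commute)
  \<comment> \<open>The product of both corrections has order \<open>2 * (n + k)\<close>, which is
    at least \<open>n + k + 1\<close> because \<open>n > 0\<close>.\<close>
  have KK: "?K' dvd ?K * ?K" unfolding power_add[of p "n + k" "n + k", symmetric]
    using n by (intro le_imp_power_dvd) simp
  have "(?w b \<oplus> [?K] \<cdot> ?x) \<otimes> (?W \<oplus> [?K] \<cdot> ?y) =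
      (?w b \<otimes> ?W \<oplus> [?K] \<cdot> (?x \<otimes> ?W \<oplus> ?w b \<otimes> ?y)) \<oplus>
        [(?K * ?K)] \<cdot> (?x \<otimes> ?y)"
    using cl y by (simp add: Q.l_distr Q.r_distr Q.add_pow_distrib Q.add_pow_mult
        Q.add_pow_ldistr Q.add_pow_rdistr Q.a_ac)
  moreover have "ncong Q ?K' \<dots> (?w b \<otimes> ?W \<oplus> [?K] \<cdot> (?x \<otimes> ?W \<oplus> ?w b \<otimes> ?y))"
    using cl y by (intro Q.ncong_dvd[OF Q.ncong_add_pow KK]) auto
  moreover have "ncong Q ?K' (?w b \<otimes> ?W \<oplus> [?K] \<cdot> (?x \<otimes> ?W \<oplus> ?w b \<otimes> ?y))
      (?w b \<otimes> ?W \<oplus> [?K] \<cdot> (?x \<oplus> ?y))"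
    using cl y by (intro Q.ncong_add[OF _ first]) auto
  ultimately have 1: "ncong Q ?K' ((?w b \<oplus> [?K] \<cdot> ?x) \<otimes> (?W \<oplus> [?K] \<cdot> ?y))
      (?w b \<otimes> ?W \<oplus> [?K] \<cdot> (?x \<oplus> ?y))"
    using cl y Q.ncong_trans by auto
  have "ncong Q ?K' (?w ?b \<otimes> prod_of M ?b)
      ((?w b \<oplus> [?K] \<cdot> ?x) \<otimes> (?W \<oplus> [?K] \<cdot> ?y))"
    unfolding w using cl y Cons.IH[OF M(1,2)] by (intro Q.ncong_mult) auto
  from Q.ncong_trans[OF this 1]
  have "ncong Q ?K' (?w ?b \<otimes> prod_of M ?b) (?w b \<otimes> ?W \<oplus> [?K] \<cdot> (?x \<oplus> ?y))"
    using cl y by auto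
  moreover have "(\<Oplus>s\<in>set (s # M). lin s (d s)) = ?x \<oplus> ?y"
    using M d s by (simp, subst Q.finsum_insert) (auto intro!: lin_closed)
  ultimately show ?case by (simp add: prod_of_def)
qed

text \<open>Continuity of the product in its parameters, with a gain of \<open>n\<close> in the
  exponent from the scaling: write \<open>b' = b + p ^ k d\<close> and absorb the first order term
  of \<open>prod_of_step\<close> into the modulus.\<close>

lemma prod_of_ncong:
  assumes b: "b \<in> set L \<rightarrow> carrier A" and b': "b' \<in> set L \<rightarrow> carrier A"
    and bb': "\<And>s. s \<in> set L \<Longrightarrow> ncong A (p ^ k) (b' s) (b s)"
  shows "ncong Q (p ^ (n + k)) (prod_of L b') (prod_of L b)"
proof -
  have "\<forall>s. \<exists>d. s \<in> set L \<longrightarrow> d \<in> carrier A \<and> b' s = b s \<oplus>\<^bsub>A\<^esub> [(p ^ k)] \<cdot>\<^bsub>A\<^esub> d"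
    using bb' unfolding ncong_def by blast
  then obtain d where d: "\<And>s. s \<in> set L \<Longrightarrow> d s \<in> carrier A \<and> b' s = b s \<oplus>\<^bsub>A\<^esub> [(p ^ k)] \<cdot>\<^bsub>A\<^esub> d s"
    by metis
  then have dc: "d \<in> set L \<rightarrow> carrier A" by blast
  have eq: "prod_of L b' = prod_of L (\<lambda>s. b s \<oplus>\<^bsub>A\<^esub> [(p ^ k)] \<cdot>\<^bsub>A\<^esub> d s)"
    unfolding prod_of_def by (intro foldr_cong) (use d in auto)
  have sum: "(\<Oplus>s\<in>set L. lin s (d s)) \<in> carrier Q"
    using dc by (auto intro!: Q.finsum_closed lin_closed)
  have "ncong Q (p ^ (n + k)) (prod_of L b')
      (prod_of L b \<oplus> [(p ^ (n + k))] \<cdot> (\<Oplus>s\<in>set L. lin s (d s)))"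
    unfolding eq by (rule Q.ncong_dvd[OF prod_of_step[OF b dc]]) (use dist in \<open>simp_all add: le_imp_power_dvd\<close>)
  then show ?thesis
    using Q.ncong_trans Q.ncong_add_pow[OF sum prod_of_closed[OF subset_refl b]] prod_of_closed[OF subset_refl b] by blast
qed

text \<open>A Newton iteration in which the linearized equation is solved only modulo
  \<open>p\<close>: each round gains one power of \<open>p\<close>. Because the list
  \<open>L\<close> is fixed, convergence concerns finitely many sequences in \<open>A\<close>, so
  completeness is asked of \<open>A\<close>, and separatedness of \<open>Q\<close> identifies the
  limit.\<close>

theorem successive_approximation:
  assumes u: "u \<in> carrier Q" "ncong Q (p ^ n) u \<one>"
    and complete: "\<And>x. (\<And>k. x k \<in> carrier A) \<Longrightarrow> (\<And>k. ncong A (p ^ k) (x (Suc k)) (x k)) \<Longrightarrow>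
      \<exists>y\<in>carrier A. \<forall>k. ncong A (p ^ k) y (x k)"
    and separated: "\<And>x y. x \<in> carrier Q \<Longrightarrow> y \<in> carrier Q \<Longrightarrow> (\<And>k. ncong Q (p ^ k) x y) \<Longrightarrow> x = y"
    and step: "\<And>b k. b \<in> set L \<rightarrow> carrier A \<Longrightarrow> ncong Q (p ^ (n + k)) u (prod_of L b) \<Longrightarrow>
      \<exists>d Y. d \<in> set L \<rightarrow> carrier A \<and> Y \<in> carrier Q \<and> u = prod_of L b \<oplus> [(p ^ (n + k))] \<cdot> Y \<and>
        ncong Q p Y (\<Oplus>s\<in>set L. lin s (d s))"
  shows "\<exists>b \<in> set L \<rightarrow> carrier A. prod_of L b = u"
proof -
  let ?P = "\<lambda>k b. b \<in> set L \<rightarrow> carrier A \<and> ncong Q (p ^ (n + k)) u (prod_of L b)"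
  \<comment> \<open>The parameters of round \<open>k + 1\<close> are a correction of those of round
    \<open>k\<close>, hence dependent choice. The start is \<open>b = 0\<close>, whose product is 1
    and agrees with \<open>u\<close> modulo \<open>p ^ n\<close>.\<close>
  have "\<exists>B. \<forall>k. ?P k (B k) \<and> (\<forall>s\<in>set L. ncong A (p ^ k) (B (Suc k) s) (B k s))"
  proof (rule dependent_nat_choice)
    have "prod_of M (\<lambda>s. \<zero>\<^bsub>A\<^esub>) = \<one>" if "set M \<subseteq> set L" for M
      using that by (induction M) (auto simp: prod_of_def lin_zero)
    then show "\<exists>b. ?P 0 b" using u by (intro exI[of _ "\<lambda>s. \<zero>\<^bsub>A\<^esub>"]) auto
  next
    fix b k assume "?P k b"
    then have b: "b \<in> set L \<rightarrow> carrier A" and ub: "ncong Q (p ^ (n + k)) u (prod_of L b)" by auto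
    from step[OF this] obtain d Y where d: "d \<in> set L \<rightarrow> carrier A" and Y: "Y \<in> carrier Q"
      and uY: "u = prod_of L b \<oplus> [(p ^ (n + k))] \<cdot> Y"
      and Yd: "ncong Q p Y (\<Oplus>s\<in>set L. lin s (d s))" by blast
    let ?b = "\<lambda>s. b s \<oplus>\<^bsub>A\<^esub> [(p ^ k)] \<cdot>\<^bsub>A\<^esub> d s" and ?S = "\<Oplus>s\<in>set L. lin s (d s)"
    have bc: "?b \<in> set L \<rightarrow> carrier A" using b d by auto
    have S: "?S \<in> carrier Q" using d by (auto intro!: Q.finsum_closed lin_closed)
    have W: "prod_of L b \<in> carrier Q" "prod_of L ?b \<in> carrier Q" using b bc by (auto intro: prod_of_closed)
    have "ncong Q (p ^ (n + k + 1)) u (prod_of L b \<oplus> [(p ^ (n + k))] \<cdot> ?S)"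
      unfolding uY using Q.ncong_scale[OF Yd S, of "p ^ (n + k)"] S W
      by (intro Q.ncong_add) (auto simp: mult.commute)
    moreover have "ncong Q (p ^ (n + k + 1)) (prod_of L b \<oplus> [(p ^ (n + k))] \<cdot> ?S) (prod_of L ?b)"
      by (rule Q.ncong_sym[OF prod_of_step[OF b d subset_refl dist]]) (use S W in simp)
    ultimately have "ncong Q (p ^ (n + k + 1)) u (prod_of L ?b)"
      using W(2) by (rule Q.ncong_trans)
    moreover have "ncong A (p ^ k) (?b s) (b s)" if "s \<in> set L" for s
      using that b d by (intro A.ncong_add_pow) auto
    ultimately show "\<exists>b'. ?P (Suc k) b' \<and> (\<forall>s\<in>set L. ncong A (p ^ k) (b' s) (b s))"
      using bc by (intro exI[of _ ?b]) simp
  qed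
  then obtain B where B: "\<And>k. B k \<in> set L \<rightarrow> carrier A" "\<And>k. ncong Q (p ^ (n + k)) u (prod_of L (B k))"
    "\<And>k s. s \<in> set L \<Longrightarrow> ncong A (p ^ k) (B (Suc k) s) (B k s)" by blast
  have "\<exists>y\<in>carrier A. \<forall>k. ncong A (p ^ k) y (B k s)" if "s \<in> set L" for s
    using that B(1,3) by (intro complete) auto
  then obtain b where b: "\<And>s. s \<in> set L \<Longrightarrow> b s \<in> carrier A"
    "\<And>s k. s \<in> set L \<Longrightarrow> ncong A (p ^ k) (b s) (B k s)" by metis
  then have bc: "b \<in> set L \<rightarrow> carrier A" by blast
  have W: "prod_of L b \<in> carrier Q" "prod_of L (B k) \<in> carrier Q" for k
    using bc B(1) by (auto intro: prod_of_closed)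
  have "prod_of L b = u"
  proof (rule separated[OF W(1) u(1)])
    fix k
    have "ncong Q (p ^ (n + k)) (prod_of L b) (prod_of L (B k))"
      using B(1) bc b(2) by (intro prod_of_ncong) auto
    moreover have "ncong Q (p ^ (n + k)) (prod_of L (B k)) u"
      by (rule Q.ncong_sym[OF B(2) W(2)])
    ultimately have "ncong Q (p ^ (n + k)) (prod_of L b) u" using u(1) by (rule Q.ncong_trans)
    then show "ncong Q (p ^ k) (prod_of L b) u" by (rule Q.ncong_dvd) (simp add: le_imp_power_dvd)
  qed
  then show ?thesis using bc by blast
qed

end

section \<open>Determinants over commutative rings with carrier\<close>

context ring
begin

lemma ncong_finsum:
  assumes "finite A" "\<And>i. i \<in> A \<Longrightarrow> ncong R N (f i) (g i)" "\<And>i. i \<in> A \<Longrightarrow> f i \<in> carrier R"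
    "\<And>i. i \<in> A \<Longrightarrow> g i \<in> carrier R"
  shows "ncong R N (finsum R f A) (finsum R g A)"
  using assms
proof (induction A rule: finite_induct)
  case (insert a A)
  then have "ncong R N (f a \<oplus> finsum R f A) (g a \<oplus> finsum R g A)"
    by (intro ncong_add finsum_closed) auto
  then show ?case using insert by (simp add: Pi_def)
qed simp

end

context cring
begin

abbreviation even_perms :: "'i set \<Rightarrow> ('i \<Rightarrow> 'i) set"
  where "even_perms S \<equiv> {\<pi>. \<pi> permutes S \<and> evenperm \<pi>}"

abbreviation odd_perms :: "'i set \<Rightarrow> ('i \<Rightarrow> 'i) set"
  where "odd_perms S \<equiv> {\<pi>. \<pi> permutes S \<and> \<not> evenperm \<pi>}"

text \<open>Leibniz formula with the two parities kept apart, so that no signs have to be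
  interpreted in the ring. The index type is arbitrary because the blow-up of a matrix is indexed by
  pairs.\<close>

definition ldet :: "'i set \<Rightarrow> ('i \<Rightarrow> 'i \<Rightarrow> 'a) \<Rightarrow> 'a"
  where "ldet S X = (\<Oplus>\<pi>\<in>even_perms S. \<Otimes>i\<in>S. X i (\<pi> i)) \<ominus> (\<Oplus>\<pi>\<in>odd_perms S. \<Otimes>i\<in>S. X i (\<pi> i))"

lemma finprod_remove:
  assumes "finite S" "i \<in> S" "\<And>j. j \<in> S \<Longrightarrow> f j \<in> carrier R"
  shows "finprod R f S = f i \<otimes> finprod R f (S - {i})"
proof -
  have "finprod R f (insert i (S - {i})) = f i \<otimes> finprod R f (S - {i})"
    using assms by (intro finprod_insert) auto
  then show ?thesis using assms by (simp add: insert_absorb)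
qed

lemma finite_even_odd: "finite S \<Longrightarrow> finite (even_perms S)" "finite S \<Longrightarrow> finite (odd_perms S)"
  by (rule finite_subset[OF _ finite_permutations[of S]], auto)+

lemma bij_betw_swap:
  assumes "finite S" "i \<in> S" "j \<in> S" "i \<noteq> j"
  shows "bij_betw (\<lambda>\<pi>. \<pi> \<circ> transpose i j) (even_perms S) (odd_perms S)"
proof (rule bij_betw_byWitness[where f' = "\<lambda>\<pi>. \<pi> \<circ> transpose i j"])
  have t: "transpose i j permutes S" using assms by (intro permutes_swap_id)
  have p: "\<pi> \<circ> transpose i j permutes S \<and> evenperm (\<pi> \<circ> transpose i j) \<noteq> evenperm \<pi>"
    if "\<pi> permutes S" for \<pi>
  proof -
    have "permutation \<pi>" "permutation (transpose i j)"
      using assms that t by (auto simp: permutation_permutes)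
    then show ?thesis
      using permutes_compose[OF t that] evenperm_comp[of \<pi> "transpose i j"] assms
      by (auto simp: evenperm_swap)
  qed
  show "(\<lambda>\<pi>. \<pi> \<circ> transpose i j) ` even_perms S \<subseteq> odd_perms S"
    "(\<lambda>\<pi>. \<pi> \<circ> transpose i j) ` odd_perms S \<subseteq> even_perms S"
    using p by blast+
qed (auto simp: comp_assoc)

text \<open>Expanding row \<open>i\<close> leaves, besides the determinant of \<open>X\<close>,
  \<open>c\<close> times that of the matrix in which row \<open>i\<close> is replaced by row
  \<open>j\<close>. \<open>T \<pi>\<close> is the term of \<open>\<pi>\<close> in the latter; it
  does not change under \<open>\<pi> \<circ> transpose i j\<close>, which exchanges the parities, so
  the two halves cancel.\<close>

lemma ldet_row_add:
  assumes S: "finite S" "i \<in> S" "j \<in> S" "i \<noteq> j" and c: "c \<in> carrier R"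
    and X: "\<And>k l. X k l \<in> carrier R"
  shows "ldet S (\<lambda>k l. if k = i then X i l \<oplus> c \<otimes> X j l else X k l) = ldet S X"
proof -
  let ?Y = "\<lambda>k l. if k = i then X i l \<oplus> c \<otimes> X j l else X k l"
  define T where "T \<pi> = X j (\<pi> i) \<otimes> (X j (\<pi> j) \<otimes> (\<Otimes>k\<in>S - {i} - {j}. X k (\<pi> k)))" for \<pi>
  have T: "T \<pi> \<in> carrier R" for \<pi>
    using X by (simp add: T_def Pi_def)
  have prod: "(\<Otimes>k\<in>S. ?Y k (\<pi> k)) = (\<Otimes>k\<in>S. X k (\<pi> k)) \<oplus> c \<otimes> T \<pi>" for \<pi>
  proof -
    have rest: "(\<Otimes>k\<in>S - {i}. ?Y k (\<pi> k)) = (\<Otimes>k\<in>S - {i}. X k (\<pi> k))"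
      using X c by (intro finprod_cong') auto
    have "(\<Otimes>k\<in>S. ?Y k (\<pi> k)) = ?Y i (\<pi> i) \<otimes> (\<Otimes>k\<in>S - {i}. ?Y k (\<pi> k))"
      by (rule finprod_remove) (use S X c in auto)
    also have "\<dots> = (X i (\<pi> i) \<oplus> c \<otimes> X j (\<pi> i)) \<otimes> (\<Otimes>k\<in>S - {i}. X k (\<pi> k))"
      unfolding rest by simp
    also have "\<dots> = X i (\<pi> i) \<otimes> (\<Otimes>k\<in>S - {i}. X k (\<pi> k)) \<oplus>
        c \<otimes> (X j (\<pi> i) \<otimes> (\<Otimes>k\<in>S - {i}. X k (\<pi> k)))"
      using X c by (simp add: l_distr m_assoc Pi_def)
    also have "X i (\<pi> i) \<otimes> (\<Otimes>k\<in>S - {i}. X k (\<pi> k)) = (\<Otimes>k\<in>S. X k (\<pi> k))"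
      by (rule finprod_remove[symmetric]) (use S X in auto)
    also have "(\<Otimes>k\<in>S - {i}. X k (\<pi> k)) = X j (\<pi> j) \<otimes> (\<Otimes>k\<in>S - {i} - {j}. X k (\<pi> k))"
      by (rule finprod_remove) (use S X in auto)
    finally show ?thesis by (simp add: T_def)
  qed
  have swap: "T (\<pi> \<circ> transpose i j) = T \<pi>" for \<pi>
  proof -
    have "(\<Otimes>k\<in>S - {i} - {j}. X k ((\<pi> \<circ> transpose i j) k)) = (\<Otimes>k\<in>S - {i} - {j}. X k (\<pi> k))"
      using X by (intro finprod_cong') (auto simp: transpose_def)
    then show ?thesis using X by (simp add: T_def m_lcomm Pi_def)
  qed
  let ?p = "\<lambda>\<pi>. \<Otimes>k\<in>S. X k (\<pi> k)"
  have p: "?p \<pi> \<in> carrier R" for \<pi> using X by (simp add: Pi_def)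
  have sum: "(\<Oplus>\<pi>\<in>P. \<Otimes>k\<in>S. ?Y k (\<pi> k)) = finsum R ?p P \<oplus> c \<otimes> finsum R T P" if "finite P" for P
  proof -
    have "(\<Oplus>\<pi>\<in>P. ?p \<pi> \<oplus> c \<otimes> T \<pi>) = finsum R ?p P \<oplus> (\<Oplus>\<pi>\<in>P. c \<otimes> T \<pi>)"
      by (rule finsum_addf) (use p T c in auto)
    also have "(\<Oplus>\<pi>\<in>P. c \<otimes> T \<pi>) = c \<otimes> finsum R T P"
      by (rule finsum_rdistr[symmetric]) (use T c that in auto)
    finally show ?thesis unfolding prod .
  qed
  have bij: "bij_betw (\<lambda>\<pi>. \<pi> \<circ> transpose i j) (even_perms S) (odd_perms S)"
    using S by (rule bij_betw_swap)
  have "finsum R T (odd_perms S) = finsum R (\<lambda>\<pi>. T (\<pi> \<circ> transpose i j)) (even_perms S)"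
    unfolding bij_betw_imp_surj_on[OF bij, symmetric]
    using T by (intro finsum_reindex bij_betw_imp_inj_on[OF bij]) auto
  then have eq: "finsum R T (odd_perms S) = finsum R T (even_perms S)" unfolding swap .
  have cl: "finsum R ?p P \<in> carrier R" "finsum R T P \<in> carrier R" for P
    using p T by (auto intro: finsum_closed)
  show ?thesis
    unfolding ldet_def sum[OF finite_even_odd(1)[OF S(1)]] sum[OF finite_even_odd(2)[OF S(1)]] eq
    using cl c by (simp add: a_minus_def minus_add a_ac r_neg1 r_neg2)
qed

lemma ldet_row_combination:
  assumes S: "finite S" "i \<in> S" "J \<subseteq> S" "i \<notin> J" and c: "\<And>q. c q \<in> carrier R"
    and X: "\<And>k l. X k l \<in> carrier R"
  shows "ldet S (\<lambda>k l. if k = i then X i l \<oplus> (\<Oplus>q\<in>J. c q \<otimes> X q l) else X k l) = ldet S X"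
proof -
  have "finite J" using S finite_subset by blast
  then show ?thesis using S(3,4)
  proof (induction J rule: finite_induct)
    case empty
    have "(\<lambda>k l. if k = i then X i l \<oplus> (\<Oplus>q\<in>{}. c q \<otimes> X q l) else X k l) = X"
      using X by (auto simp: fun_eq_iff)
    then show ?case by simp
  next
    case (insert j J)
    define Y where "Y k l = (if k = i then X i l \<oplus> (\<Oplus>q\<in>J. c q \<otimes> X q l) else X k l)" for k l
    have Y: "Y k l \<in> carrier R" for k l using X c by (auto simp: Y_def intro!: finsum_closed)
    have "(\<lambda>k l. if k = i then X i l \<oplus> (\<Oplus>q\<in>insert j J. c q \<otimes> X q l) else X k l) =
        (\<lambda>k l. if k = i then Y i l \<oplus> c j \<otimes> Y j l else Y k l)"
      using insert X c by (auto simp: fun_eq_iff Y_def Pi_def a_ac)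
    moreover have "ldet S (\<lambda>k l. if k = i then Y i l \<oplus> c j \<otimes> Y j l else Y k l) = ldet S Y"
      using insert S c Y by (intro ldet_row_add) auto
    moreover have "ldet S Y = ldet S X" unfolding Y_def[abs_def] using insert by auto
    ultimately show ?case by simp
  qed
qed

text \<open>One row operation over the group ring of \<open>G\<close> becomes, after the blow-up, a
  simultaneous change of a block \<open>I\<close> of rows by the rows of a block \<open>J\<close>.
  Disjointness keeps the rows of \<open>J\<close> unchanged while those of \<open>I\<close> are
  treated one by one.\<close>

lemma ldet_block_row_operation:
  assumes S: "finite S" "I \<subseteq> S" "J \<subseteq> S" "I \<inter> J = {}" and c: "\<And>k q. c k q \<in> carrier R"
    and X: "\<And>k l. X k l \<in> carrier R"
  shows "ldet S (\<lambda>k l. if k \<in> I then X k l \<oplus> (\<Oplus>q\<in>J. c k q \<otimes> X q l) else X k l) = ldet S X"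
proof -
  have "finite I" using S finite_subset by blast
  then show ?thesis using S(2,4)
  proof (induction I rule: finite_induct)
    case empty
    then show ?case by simp
  next
    case (insert i I)
    define Y where "Y k l = (if k \<in> I then X k l \<oplus> (\<Oplus>q\<in>J. c k q \<otimes> X q l) else X k l)" for k l
    have Y: "Y k l \<in> carrier R" for k l using X c by (auto simp: Y_def intro!: finsum_closed)
    have YJ: "(\<Oplus>q\<in>J. c i q \<otimes> Y q l) = (\<Oplus>q\<in>J. c i q \<otimes> X q l)" for l
      using insert X c by (intro finsum_cong') (auto simp: Y_def)
    have "(\<lambda>k l. if k \<in> insert i I then X k l \<oplus> (\<Oplus>q\<in>J. c k q \<otimes> X q l) else X k l) =
        (\<lambda>k l. if k = i then Y i l \<oplus> (\<Oplus>q\<in>J. c i q \<otimes> Y q l) else Y k l)"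
      unfolding YJ using insert by (auto simp: fun_eq_iff Y_def)
    moreover have "ldet S (\<lambda>k l. if k = i then Y i l \<oplus> (\<Oplus>q\<in>J. c i q \<otimes> Y q l) else Y k l) = ldet S Y"
      using insert S c Y by (intro ldet_row_combination) auto
    moreover have "ldet S Y = ldet S X" unfolding Y_def[abs_def] using insert by auto
    ultimately show ?case by simp
  qed
qed

text \<open>For \<open>N = 0\<close> the congruence is an equality: it says that the identity has determinant 1.\<close>

lemma ldet_one_plus:
  assumes S: "finite S" and V: "\<And>i j. V i j \<in> carrier R"
  shows "ncong R (N * N) (ldet S (\<lambda>i j. (if i = j then \<one> else \<zero>) \<oplus> [N] \<cdot> V i j))
    (\<one> \<oplus> [N] \<cdot> (\<Oplus>i\<in>S. V i i))"
proof -
  let ?X = "\<lambda>i j. (if i = j then \<one> else \<zero>) \<oplus> [N] \<cdot> V i j"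
  let ?p = "\<lambda>\<pi>. \<Otimes>i\<in>S. ?X i (\<pi> i)"
  have X: "?X i j \<in> carrier R" for i j using V by simp
  have p: "?p \<pi> \<in> carrier R" for \<pi> using X by (intro finprod_closed) auto
  have diag: "ncong R (N * N) (\<Otimes>i\<in>A. ?X i i) (\<one> \<oplus> [N] \<cdot> (\<Oplus>i\<in>A. V i i))" if "finite A" for A
    using that
  proof (induction A rule: finite_induct)
    case empty
    then show ?case by simp
  next
    case (insert a A)
    let ?s = "\<Oplus>i\<in>A. V i i"
    have s: "?s \<in> carrier R" using V by (auto intro: finsum_closed)
    have "(\<one> \<oplus> [N] \<cdot> V a a) \<otimes> (\<one> \<oplus> [N] \<cdot> ?s) =
        (\<one> \<oplus> [N] \<cdot> (V a a \<oplus> ?s)) \<oplus> [(N * N)] \<cdot> (V a a \<otimes> ?s)"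
      using V s by (simp add: l_distr r_distr add_pow_distrib add_pow_mult add_pow_ldistr
          add_pow_rdistr a_ac)
    moreover have "ncong R (N * N) \<dots> (\<one> \<oplus> [N] \<cdot> (V a a \<oplus> ?s))"
      using V s by (intro ncong_add_pow) auto
    moreover have "ncong R (N * N) (?X a a \<otimes> (\<Otimes>i\<in>A. ?X i i)) ((\<one> \<oplus> [N] \<cdot> V a a) \<otimes> (\<one> \<oplus> [N] \<cdot> ?s))"
      using V s insert.IH by (intro ncong_mult) auto
    ultimately have "ncong R (N * N) (?X a a \<otimes> (\<Otimes>i\<in>A. ?X i i)) (\<one> \<oplus> [N] \<cdot> (V a a \<oplus> ?s))"
      using V s ncong_trans by auto
    then show ?case using insert V by (simp add: Pi_def)
  qed
  \<comment> \<open>A permutation other than the identity moves some \<open>i\<close> and then also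
    \<open>\<pi> i\<close>; both rows contribute an off-diagonal entry, each a multiple of
    \<open>N\<close>.\<close>
  have off: "ncong R (N * N) (?p \<pi>) \<zero>" if \<pi>: "\<pi> permutes S" "\<pi> \<noteq> id" for \<pi>
  proof -
    obtain i where i: "\<pi> i \<noteq> i" using \<pi>(2) by (auto simp: fun_eq_iff)
    then have iS: "i \<in> S" using \<pi>(1) by (auto simp: permutes_def)
    then have jS: "\<pi> i \<in> S" using permutes_in_image[OF \<pi>(1)] by blast
    have j: "\<pi> (\<pi> i) \<noteq> \<pi> i" using i permutes_inj[OF \<pi>(1)] by (auto dest: injD)
    let ?j = "\<pi> i" and ?r = "\<Otimes>k\<in>S - {i} - {\<pi> i}. ?X k (\<pi> k)"
    have r: "?r \<in> carrier R" using X by (intro finprod_closed) auto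
    have "?p \<pi> = ?X i ?j \<otimes> (\<Otimes>k\<in>S - {i}. ?X k (\<pi> k))"
      by (rule finprod_remove) (use S iS X in auto)
    also have "(\<Otimes>k\<in>S - {i}. ?X k (\<pi> k)) = ?X ?j (\<pi> ?j) \<otimes> ?r"
      by (rule finprod_remove) (use S jS i X in auto)
    also have "?X i ?j = [N] \<cdot> V i ?j" using i V by simp
    also have "?X ?j (\<pi> ?j) = [N] \<cdot> V ?j (\<pi> ?j)" using j V by simp
    also have "([N] \<cdot> V i ?j) \<otimes> (([N] \<cdot> V ?j (\<pi> ?j)) \<otimes> ?r) =
        \<zero> \<oplus> [(N * N)] \<cdot> (V i ?j \<otimes> (V ?j (\<pi> ?j) \<otimes> ?r))"
      using r V by (simp add: add_pow_ldistr add_pow_rdistr add_pow_mult)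
    finally show ?thesis by (rule ncongI[rotated]) (use V r in simp)
  qed
  define f where "f \<pi> = ?p \<pi>" for \<pi>
  have f: "f \<pi> \<in> carrier R" for \<pi> unfolding f_def by (rule p)
  have f_id: "ncong R (N * N) (f id) (\<one> \<oplus> [N] \<cdot> (\<Oplus>i\<in>S. V i i))"
    using diag[OF S] by (simp add: f_def)
  have sum0: "ncong R (N * N) (finsum R f P) \<zero>" if "finite P" "\<And>\<pi>. \<pi> \<in> P \<Longrightarrow> \<pi> permutes S \<and> \<pi> \<noteq> id" for P
  proof -
    have "ncong R (N * N) (finsum R f P) (\<Oplus>\<pi>\<in>P. \<zero>)"
      by (rule ncong_finsum) (use that off f in \<open>auto simp: f_def\<close>)
    then show ?thesis by simp
  qed
  have fS: "finsum R f P \<in> carrier R" for P using f by (auto intro: finsum_closed)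
  have tr: "\<one> \<oplus> [N] \<cdot> (\<Oplus>i\<in>S. V i i) \<in> carrier R" using V by (auto intro: finsum_closed)
  have "even_perms S = insert id (even_perms S - {id})"
    using permutes_id[of S] evenperm_id by auto
  then have "finsum R f (even_perms S) = finsum R f (insert id (even_perms S - {id}))" by simp
  also have "\<dots> = f id \<oplus> finsum R f (even_perms S - {id})"
    by (rule finsum_insert) (use finite_even_odd[OF S] f in simp_all)
  finally have sum_even: "finsum R f (even_perms S) = f id \<oplus> finsum R f (even_perms S - {id})" .
  have "ncong R (N * N) (finsum R f (even_perms S - {id})) \<zero>"
    by (rule sum0) (use finite_even_odd[OF S] in simp_all)
  then have "ncong R (N * N) (finsum R f (even_perms S)) ((\<one> \<oplus> [N] \<cdot> (\<Oplus>i\<in>S. V i i)) \<oplus> \<zero>)"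
    unfolding sum_even by (rule ncong_add[OF f_id _ tr]) simp
  then have even: "ncong R (N * N) (finsum R f (even_perms S)) (\<one> \<oplus> [N] \<cdot> (\<Oplus>i\<in>S. V i i))"
    unfolding r_zero[OF tr] .
  have odd: "ncong R (N * N) (finsum R f (odd_perms S)) \<zero>"
    by (rule sum0) (use finite_even_odd[OF S] evenperm_id in auto)
  then obtain z where z: "z \<in> carrier R" "finsum R f (odd_perms S) = \<zero> \<oplus> [(N * N)] \<cdot> z" by (rule ncongE)
  have "ncong R (N * N) (\<ominus> finsum R f (odd_perms S)) \<zero>"
    using z by (intro ncongI[of "\<ominus> z"]) (auto simp: add_pow_neg)
  from ncong_add[OF even this tr zero_closed]
  show ?thesis unfolding r_zero[OF tr] ldet_def a_minus_def f_def[abs_def] .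
qed

end

context ring
begin

lemma rf_add_pow: "A \<in> carrier Q \<Longrightarrow> ([(N::nat)] \<cdot>\<^bsub>Q\<^esub> A) i j = [N] \<cdot> A i j"
proof (induction N)
  case 0
  interpret rf: ring Q by (rule ring_rf)
  show ?case by (simp add: rf_zero)
next
  case (Suc N)
  interpret rf: ring Q by (rule ring_rf)
  show ?case using Suc by (simp add: rf_add)
qed

lemma rf_finsum:
  assumes "finite S" "\<And>s. s \<in> S \<Longrightarrow> F s \<in> carrier Q"
  shows "(finsum Q F S) i j = (\<Oplus>s\<in>S. F s i j)"
  using assms
proof (induction S rule: finite_induct)
  case empty
  interpret rf: ring Q by (rule ring_rf)
  show ?case by (simp add: rf_zero)
next
  case (insert s S)
  interpret rf: ring Q by (rule ring_rf)
  have "(finsum Q F (insert s S)) i j = F s i j \<oplus> (finsum Q F S) i j"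
    using insert by (subst rf.finsum_insert) (auto simp: rf_add)
  then show ?case using insert by (simp add: Pi_def)
qed

end

section \<open>Group rings\<close>

lemma group_ring_carrier: "carrier (group_ring R G) = carrier G \<rightarrow>\<^sub>E carrier R"
  by (simp add: group_ring_def)

lemma group_ring_add: "x \<in> carrier G \<Longrightarrow> (f \<oplus>\<^bsub>group_ring R G\<^esub> g) x = f x \<oplus>\<^bsub>R\<^esub> g x"
  by (simp add: group_ring_def)

lemma group_ring_zero: "x \<in> carrier G \<Longrightarrow> \<zero>\<^bsub>group_ring R G\<^esub> x = \<zero>\<^bsub>R\<^esub>"
  by (simp add: group_ring_def)

lemma group_ring_one:
  "x \<in> carrier G \<Longrightarrow> \<one>\<^bsub>group_ring R G\<^esub> x = (if x = \<one>\<^bsub>G\<^esub> then \<one>\<^bsub>R\<^esub> else \<zero>\<^bsub>R\<^esub>)"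
  by (simp add: group_ring_def)

lemma group_ring_mult:
  "x \<in> carrier G \<Longrightarrow> (f \<otimes>\<^bsub>group_ring R G\<^esub> g) x =
    (\<Oplus>\<^bsub>R\<^esub>y\<in>carrier G. f y \<otimes>\<^bsub>R\<^esub> g (inv\<^bsub>G\<^esub> y \<otimes>\<^bsub>G\<^esub> x))"
  by (simp add: group_ring_def)

lemma group_ring_eqI:
  assumes "f \<in> carrier (group_ring R G)" "g \<in> carrier (group_ring R G)"
    "\<And>x. x \<in> carrier G \<Longrightarrow> f x = g x"
  shows "f = g"
  using assms unfolding group_ring_carrier by (rule PiE_ext)

lemma group_ring_val [simp]:
  "f \<in> carrier (group_ring R G) \<Longrightarrow> x \<in> carrier G \<Longrightarrow> f x \<in> carrier R"
  by (auto simp: group_ring_carrier)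

lemma (in group) bij_betw_left_translate:
  "y \<in> carrier G \<Longrightarrow> bij_betw (\<lambda>x. y \<otimes> x) (carrier G) (carrier G)"
  by (rule bij_betw_byWitness[where f' = "\<lambda>x. inv y \<otimes> x"]) (auto simp: m_assoc[symmetric])

lemma (in abelian_monoid) finsum_bij_betw:
  assumes "bij_betw h A B" "\<And>y. y \<in> B \<Longrightarrow> f y \<in> carrier G"
  shows "finsum G f B = (\<Oplus>x\<in>A. f (h x))"
  unfolding bij_betw_imp_surj_on[OF assms(1), symmetric]
  using assms(2) bij_betw_imp_surj_on[OF assms(1)]
  by (intro finsum_reindex bij_betw_imp_inj_on[OF assms(1)]) auto

locale finite_group_ring = R: ring R + G: group G for R :: "('a, 'b) ring_scheme" and G :: "('g, 'c) monoid_scheme" (structure) +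
  assumes fin: "finite (carrier G)"
begin

abbreviation "A \<equiv> group_ring R G"

lemma group_ring_abelian: "abelian_group A"
proof (rule abelian_groupI)
  fix f assume f: "f \<in> carrier A"
  let ?g = "\<lambda>x\<in>carrier G. \<ominus>\<^bsub>R\<^esub> f x"
  have "?g \<in> carrier A" using f by (auto simp: group_ring_carrier)
  moreover have "?g \<oplus>\<^bsub>A\<^esub> f = \<zero>\<^bsub>A\<^esub>"
    using f by (intro group_ring_eqI[of _ R G]) (auto simp: group_ring_def R.l_neg)
  ultimately show "\<exists>g\<in>carrier A. g \<oplus>\<^bsub>A\<^esub> f = \<zero>\<^bsub>A\<^esub>" by blast
qed (auto simp: group_ring_def R.a_ac restrict_def PiE_iff extensional_def
    fun_eq_iff)

lemma group_ring_mult_closed: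
  assumes "f \<in> carrier A" "g \<in> carrier A" shows "f \<otimes>\<^bsub>A\<^esub> g \<in> carrier A"
proof -
  have "f y \<otimes>\<^bsub>R\<^esub> g (inv y \<otimes> x) \<in> carrier R" if "x \<in> carrier G" "y \<in> carrier G" for x y
    using assms that by simp
  then show ?thesis by (auto simp: group_ring_def intro!: R.finsum_closed)
qed

lemma group_ring_mult_assoc:
  assumes f: "f \<in> carrier A" and g: "g \<in> carrier A" and h: "h \<in> carrier A"
  shows "(f \<otimes>\<^bsub>A\<^esub> g) \<otimes>\<^bsub>A\<^esub> h = f \<otimes>\<^bsub>A\<^esub> (g \<otimes>\<^bsub>A\<^esub> h)"
proof (rule group_ring_eqI[of _ R G])
  fix x assume x: "x \<in> carrier G"
  let ?G = "carrier G"
  have "((f \<otimes>\<^bsub>A\<^esub> g) \<otimes>\<^bsub>A\<^esub> h) x = (\<Oplus>\<^bsub>R\<^esub>y\<in>?G. (\<Oplus>\<^bsub>R\<^esub>z\<in>?G. f z \<otimes>\<^bsub>R\<^esub> g (inv z \<otimes> y)) \<otimes>\<^bsub>R\<^esub> h (inv y \<otimes> x))"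
    using x f g h group_ring_mult_closed[OF f g]
    by (auto simp: group_ring_mult intro!: R.finsum_cong' R.finsum_closed)
  also have "\<dots> = (\<Oplus>\<^bsub>R\<^esub>y\<in>?G. \<Oplus>\<^bsub>R\<^esub>z\<in>?G. f z \<otimes>\<^bsub>R\<^esub> g (inv z \<otimes> y) \<otimes>\<^bsub>R\<^esub> h (inv y \<otimes> x))"
    using x f g h fin by (intro R.finsum_cong' R.finsum_ldistr) (auto intro!: R.finsum_closed)
  also have "\<dots> = (\<Oplus>\<^bsub>R\<^esub>z\<in>?G. \<Oplus>\<^bsub>R\<^esub>y\<in>?G. f z \<otimes>\<^bsub>R\<^esub> g (inv z \<otimes> y) \<otimes>\<^bsub>R\<^esub> h (inv y \<otimes> x))"
    using x f g h fin by (intro R.finsum_swap) auto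
  also have "\<dots> = (\<Oplus>\<^bsub>R\<^esub>z\<in>?G. f z \<otimes>\<^bsub>R\<^esub> (g \<otimes>\<^bsub>A\<^esub> h) (inv z \<otimes> x))"
  proof (intro R.finsum_cong' refl)
    fix z assume z: "z \<in> ?G"
    have "(\<Oplus>\<^bsub>R\<^esub>y\<in>?G. f z \<otimes>\<^bsub>R\<^esub> g (inv z \<otimes> y) \<otimes>\<^bsub>R\<^esub> h (inv y \<otimes> x)) =
      (\<Oplus>\<^bsub>R\<^esub>w\<in>?G. f z \<otimes>\<^bsub>R\<^esub> g (inv z \<otimes> (z \<otimes> w)) \<otimes>\<^bsub>R\<^esub> h (inv (z \<otimes> w) \<otimes> x))"
      using x f g h z by (intro R.finsum_bij_betw[OF G.bij_betw_left_translate]) auto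
    also have "\<dots> = (\<Oplus>\<^bsub>R\<^esub>w\<in>?G. f z \<otimes>\<^bsub>R\<^esub> (g w \<otimes>\<^bsub>R\<^esub> h (inv w \<otimes> (inv z \<otimes> x))))"
      using x f g h z
      by (intro R.finsum_cong') (auto simp: G.m_assoc[symmetric] G.inv_mult_group R.m_assoc)
    also have "\<dots> = f z \<otimes>\<^bsub>R\<^esub> (g \<otimes>\<^bsub>A\<^esub> h) (inv z \<otimes> x)"
      using x f g h z fin by (simp add: group_ring_mult R.finsum_rdistr Pi_def)
    finally show "(\<Oplus>\<^bsub>R\<^esub>y\<in>?G. f z \<otimes>\<^bsub>R\<^esub> g (inv z \<otimes> y) \<otimes>\<^bsub>R\<^esub> h (inv y \<otimes> x)) =
      f z \<otimes>\<^bsub>R\<^esub> (g \<otimes>\<^bsub>A\<^esub> h) (inv z \<otimes> x)" .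
  qed (use x f group_ring_mult_closed[OF g h] in auto)
  also have "\<dots> = (f \<otimes>\<^bsub>A\<^esub> (g \<otimes>\<^bsub>A\<^esub> h)) x" using x by (simp add: group_ring_mult)
  finally show "((f \<otimes>\<^bsub>A\<^esub> g) \<otimes>\<^bsub>A\<^esub> h) x = (f \<otimes>\<^bsub>A\<^esub> (g \<otimes>\<^bsub>A\<^esub> h)) x" .
qed (use assms in \<open>auto intro: group_ring_mult_closed\<close>)

definition single :: "'g \<Rightarrow> 'g \<Rightarrow> 'a"
  where "single h = (\<lambda>x\<in>carrier G. if x = h then \<one>\<^bsub>R\<^esub> else \<zero>\<^bsub>R\<^esub>)"

lemma single_closed [simp]: "single h \<in> carrier A"
  by (auto simp: single_def group_ring_carrier)

lemma single_one: "single \<one> = \<one>\<^bsub>A\<^esub>"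
  by (simp add: single_def group_ring_def)

lemma single_mult:
  assumes "h \<in> carrier G" "f \<in> carrier A" "x \<in> carrier G"
  shows "(single h \<otimes>\<^bsub>A\<^esub> f) x = f (inv h \<otimes> x)"
proof -
  have "(\<Oplus>\<^bsub>R\<^esub>y\<in>carrier G. single h y \<otimes>\<^bsub>R\<^esub> f (inv y \<otimes> x)) = single h h \<otimes>\<^bsub>R\<^esub> f (inv h \<otimes> x)"
    using assms fin by (intro R.finsum_single) (auto simp: single_def)
  then show ?thesis using assms by (simp add: group_ring_mult single_def)
qed

lemma mult_single:
  assumes "h \<in> carrier G" "f \<in> carrier A" "x \<in> carrier G"
  shows "(f \<otimes>\<^bsub>A\<^esub> single h) x = f (x \<otimes> inv h)"
proof -
  let ?y = "x \<otimes> inv h"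
  have y: "inv y \<otimes> x = h \<longleftrightarrow> y = ?y" if "y \<in> carrier G" for y
    using that assms by (metis G.inv_closed G.inv_solve_left G.inv_solve_right' G.m_closed)
  have "(\<Oplus>\<^bsub>R\<^esub>y\<in>carrier G. f y \<otimes>\<^bsub>R\<^esub> single h (inv y \<otimes> x)) =
      f ?y \<otimes>\<^bsub>R\<^esub> single h (inv ?y \<otimes> x)"
    using assms fin y by (intro R.finsum_single) (auto simp: single_def)
  then show ?thesis using assms y[of ?y] by (simp add: group_ring_mult single_def)
qed

lemma ring_group_ring: "ring A"
proof (rule ringI)
  show "abelian_group A" by (rule group_ring_abelian)
  show "monoid A"
  proof (rule monoidI)
    fix f assume f: "f \<in> carrier A"
    show "\<one>\<^bsub>A\<^esub> \<otimes>\<^bsub>A\<^esub> f = f"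
      using f single_mult[of "\<one>" f] unfolding single_one[symmetric]
      by (intro group_ring_eqI[of _ R G]) (auto intro: group_ring_mult_closed)
    show "f \<otimes>\<^bsub>A\<^esub> \<one>\<^bsub>A\<^esub> = f"
      using f mult_single[of "\<one>" f] unfolding single_one[symmetric]
      by (intro group_ring_eqI[of _ R G]) (auto intro: group_ring_mult_closed)
  next
    show "\<one>\<^bsub>A\<^esub> \<in> carrier A" using single_closed[of "\<one>"] unfolding single_one .
  qed (auto intro: group_ring_mult_closed group_ring_mult_assoc)
next
  interpret ab: abelian_group A by (rule group_ring_abelian)
  fix f g h assume f: "f \<in> carrier A" and g: "g \<in> carrier A" and h: "h \<in> carrier A"
  have c: "inv y \<otimes> x \<in> carrier G" if "x \<in> carrier G" "y \<in> carrier G" for x y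
    using that by simp
  show "(f \<oplus>\<^bsub>A\<^esub> g) \<otimes>\<^bsub>A\<^esub> h = f \<otimes>\<^bsub>A\<^esub> h \<oplus>\<^bsub>A\<^esub> g \<otimes>\<^bsub>A\<^esub> h"
  proof (rule group_ring_eqI[of _ R G])
    fix x assume x: "x \<in> carrier G"
    have "((f \<oplus>\<^bsub>A\<^esub> g) \<otimes>\<^bsub>A\<^esub> h) x = (\<Oplus>\<^bsub>R\<^esub>y\<in>carrier G. f y \<otimes>\<^bsub>R\<^esub> h (inv y \<otimes> x) \<oplus>\<^bsub>R\<^esub>
        g y \<otimes>\<^bsub>R\<^esub> h (inv y \<otimes> x))"
      unfolding group_ring_mult[OF x] using x f g h
      by (intro R.finsum_cong') (auto simp: group_ring_add R.l_distr)
    also have "\<dots> = (f \<otimes>\<^bsub>A\<^esub> h \<oplus>\<^bsub>A\<^esub> g \<otimes>\<^bsub>A\<^esub> h) x"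
      unfolding group_ring_add[OF x] group_ring_mult[OF x] using x f g h
      by (intro R.finsum_addf) auto
    finally show "((f \<oplus>\<^bsub>A\<^esub> g) \<otimes>\<^bsub>A\<^esub> h) x = (f \<otimes>\<^bsub>A\<^esub> h \<oplus>\<^bsub>A\<^esub> g \<otimes>\<^bsub>A\<^esub> h) x" .
  qed (use f g h in \<open>auto intro: group_ring_mult_closed\<close>)
  show "h \<otimes>\<^bsub>A\<^esub> (f \<oplus>\<^bsub>A\<^esub> g) = h \<otimes>\<^bsub>A\<^esub> f \<oplus>\<^bsub>A\<^esub> h \<otimes>\<^bsub>A\<^esub> g"
  proof (rule group_ring_eqI[of _ R G])
    fix x assume x: "x \<in> carrier G"
    have "(h \<otimes>\<^bsub>A\<^esub> (f \<oplus>\<^bsub>A\<^esub> g)) x = (\<Oplus>\<^bsub>R\<^esub>y\<in>carrier G. h y \<otimes>\<^bsub>R\<^esub> f (inv y \<otimes> x) \<oplus>\<^bsub>R\<^esub>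
        h y \<otimes>\<^bsub>R\<^esub> g (inv y \<otimes> x))"
      unfolding group_ring_mult[OF x] using x f g h
      by (intro R.finsum_cong') (auto simp: group_ring_add R.r_distr)
    also have "\<dots> = (h \<otimes>\<^bsub>A\<^esub> f \<oplus>\<^bsub>A\<^esub> h \<otimes>\<^bsub>A\<^esub> g) x"
      unfolding group_ring_add[OF x] group_ring_mult[OF x] using x f g h
      by (intro R.finsum_addf) auto
    finally show "(h \<otimes>\<^bsub>A\<^esub> (f \<oplus>\<^bsub>A\<^esub> g)) x = (h \<otimes>\<^bsub>A\<^esub> f \<oplus>\<^bsub>A\<^esub> h \<otimes>\<^bsub>A\<^esub> g) x" .
  qed (use f g h in \<open>auto intro: group_ring_mult_closed\<close>)
qed

lemma val [simp]: "f \<in> carrier A \<Longrightarrow> x \<in> carrier G \<Longrightarrow> f x \<in> carrier R"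
  by (rule group_ring_val)

sublocale A: ring A by (rule ring_group_ring)

lemma group_ring_add_pow:
  "f \<in> carrier A \<Longrightarrow> x \<in> carrier G \<Longrightarrow> ([(N::nat)] \<cdot>\<^bsub>A\<^esub> f) x = [N] \<cdot>\<^bsub>R\<^esub> f x"
  by (induction N) (simp_all add: group_ring_zero group_ring_add)

lemma group_ring_finsum:
  assumes "finite S" "\<And>s. s \<in> S \<Longrightarrow> F s \<in> carrier A" "x \<in> carrier G"
  shows "(finsum A F S) x = (\<Oplus>\<^bsub>R\<^esub>s\<in>S. F s x)"
  using assms(1,2)
proof (induction S rule: finite_induct)
  case empty
  then show ?case using assms(3) by (simp add: group_ring_zero)
next
  case (insert s S)
  then have "(finsum A F (insert s S)) x = F s x \<oplus>\<^bsub>R\<^esub> (finsum A F S) x"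
    using assms(3) by (subst A.finsum_insert) (auto simp: group_ring_add)
  also have "\<dots> = (\<Oplus>\<^bsub>R\<^esub>s\<in>insert s S. F s x)"
    using insert assms(3) by (subst R.finsum_insert) auto
  finally show ?case .
qed

end

lemma cring_group_ring:
  assumes "cring R" "comm_group H" "finite (carrier H)"
  shows "cring (group_ring R H)"
proof -
  interpret R: cring R by fact
  interpret H: comm_group H by fact
  interpret finite_group_ring R H by unfold_locales fact
  show ?thesis
  proof (rule cring.intro[OF ring_group_ring comm_monoid.intro[OF A.monoid_axioms]], unfold_locales)
    fix f g assume f: "f \<in> carrier A" and g: "g \<in> carrier A"
    show "f \<otimes>\<^bsub>A\<^esub> g = g \<otimes>\<^bsub>A\<^esub> f"
    proof (rule group_ring_eqI[of _ R H])
      fix x assume x: "x \<in> carrier H"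
      \<comment> \<open>For commutative \<open>H\<close> the substitution of \<open>y^-1 x\<close>
        for \<open>y\<close> is an involution, and it interchanges the two factors of the
        convolution.\<close>
      have bij: "bij_betw (\<lambda>y. inv\<^bsub>H\<^esub> y \<otimes>\<^bsub>H\<^esub> x) (carrier H) (carrier H)"
        using x by (intro bij_betw_byWitness[where f' = "\<lambda>y. inv\<^bsub>H\<^esub> y \<otimes>\<^bsub>H\<^esub> x"])
          (auto simp: H.inv_mult_group H.m_ac H.m_assoc[symmetric])
      have "(f \<otimes>\<^bsub>A\<^esub> g) x = (\<Oplus>\<^bsub>R\<^esub>y\<in>carrier H. f (inv\<^bsub>H\<^esub> y \<otimes>\<^bsub>H\<^esub> x) \<otimes>\<^bsub>R\<^esub> g (inv\<^bsub>H\<^esub> (inv\<^bsub>H\<^esub> y \<otimes>\<^bsub>H\<^esub> x) \<otimes>\<^bsub>H\<^esub> x))"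
        unfolding group_ring_mult[OF x] using x f g by (intro R.finsum_bij_betw[OF bij]) auto
      also have "\<dots> = (\<Oplus>\<^bsub>R\<^esub>y\<in>carrier H. g y \<otimes>\<^bsub>R\<^esub> f (inv\<^bsub>H\<^esub> y \<otimes>\<^bsub>H\<^esub> x))"
      proof (intro R.finsum_cong' refl)
        fix y assume y: "y \<in> carrier H"
        have "inv\<^bsub>H\<^esub> (inv\<^bsub>H\<^esub> y \<otimes>\<^bsub>H\<^esub> x) \<otimes>\<^bsub>H\<^esub> x = y"
          using x y by (simp add: H.inv_mult_group H.m_ac)
            (simp add: H.m_comm[of y] H.m_assoc[symmetric])
        then show "f (inv\<^bsub>H\<^esub> y \<otimes>\<^bsub>H\<^esub> x) \<otimes>\<^bsub>R\<^esub> g (inv\<^bsub>H\<^esub> (inv\<^bsub>H\<^esub> y \<otimes>\<^bsub>H\<^esub> x) \<otimes>\<^bsub>H\<^esub> x) =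
            g y \<otimes>\<^bsub>R\<^esub> f (inv\<^bsub>H\<^esub> y \<otimes>\<^bsub>H\<^esub> x)"
          using x y f g by (simp add: R.m_comm)
      qed (use x f g in auto)
      finally show "(f \<otimes>\<^bsub>A\<^esub> g) x = (g \<otimes>\<^bsub>A\<^esub> f) x" using x by (simp add: group_ring_mult)
    qed (use f g in auto)
  qed
qed

section \<open>Elementary matrices of bounded size\<close>

definition bounded_gens :: "('a, 'b) ring_scheme \<Rightarrow> nat \<Rightarrow> 'a st_gen set"
  where "bounded_gens R m = {(i, j, r). i \<noteq> j \<and> i < m \<and> j < m \<and> r \<in> carrier R}"

text \<open>The matrices themselves are infinite; the bound \<open>m\<close> on the indices of the
  generators provides finite index sets for determinants and traces, and a finite list of
  factors.\<close>

definition elementary :: "('a, 'b) ring_scheme \<Rightarrow> nat \<Rightarrow> (nat \<Rightarrow> nat \<Rightarrow> 'a) set"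
  where "elementary R m = word_eval (GL R) (elem_mat R) ` words (bounded_gens R m)"

lemma words_mono: "X \<subseteq> Y \<Longrightarrow> words X \<subseteq> words Y"
  unfolding words_def by (intro lists_mono Sigma_mono) auto

lemma words_append: "u \<in> words X \<Longrightarrow> v \<in> words X \<Longrightarrow> u @ v \<in> words X"
  by (simp add: words_def)

lemma bounded_words: "words (bounded_gens R m) \<subseteq> words (st_gens R)"
  by (rule words_mono) (auto simp: bounded_gens_def st_gens_def)

lemma words_bounded:
  assumes "w \<in> words (st_gens R)"
  obtains m where "m > 1" "w \<in> words (bounded_gens R m)"
proof -
  have "\<exists>m>1. w \<in> words (bounded_gens R m)"
    using assms
  proof (induction w)
    case Nil
    show ?case by (intro exI[of _ 2]) (simp add: words_def)
  next
    case (Cons a w)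
    obtain i j r b where a: "a = ((i, j, r), b)" by (metis surj_pair)
    have w: "w \<in> words (st_gens R)" and ij: "i \<noteq> j" "r \<in> carrier R"
      using Cons.prems by (auto simp: a words_def st_gens_def)
    obtain m where m: "m > 1" "w \<in> words (bounded_gens R m)" using Cons.IH[OF w] by blast
    let ?m = "max m (Suc (max i j))"
    have "bounded_gens R m \<subseteq> bounded_gens R ?m" by (auto simp: bounded_gens_def)
    then have "w \<in> words (bounded_gens R ?m)" using m(2) words_mono by blast
    moreover have "(i, j, r) \<in> bounded_gens R ?m" using ij by (auto simp: bounded_gens_def)
    ultimately show ?case using m(1) by (intro exI[of _ ?m]) (auto simp: a words_def)
  qed
  then show thesis using that by blast
qed

context ring
begin

lemma elementary_GL: "elementary R m \<subseteq> carrier (GL R)"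
  using bounded_words[of R m] by (auto simp: elementary_def intro!: pres_images.eval_closed[OF GL_images])

lemma elementary_rf: "x \<in> elementary R m \<Longrightarrow> x \<in> carrier Q"
  using elementary_GL GL_rf by blast

lemma elementary_one: "id_mat R \<in> elementary R m"
  unfolding elementary_def
  by (rule image_eqI[of _ _ "[]"]) (auto simp: word_eval_def GL_one words_def)

lemma elementary_mult: "x \<in> elementary R m \<Longrightarrow> y \<in> elementary R m \<Longrightarrow> x \<otimes>\<^bsub>Q\<^esub> y \<in> elementary R m"
proof -
  assume "x \<in> elementary R m" "y \<in> elementary R m"
  then obtain u v where u: "u \<in> words (bounded_gens R m)" "x = word_eval (GL R) (elem_mat R) u"
    and v: "v \<in> words (bounded_gens R m)" "y = word_eval (GL R) (elem_mat R) v"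
    by (auto simp: elementary_def)
  then have "u \<in> words (st_gens R)" "v \<in> words (st_gens R)" using bounded_words by blast+
  then have "x \<otimes>\<^bsub>Q\<^esub> y = word_eval (GL R) (elem_mat R) (u @ v)"
    using u v by (simp add: pres_images.eval_append[OF GL_images] GL_mult)
  then show "x \<otimes>\<^bsub>Q\<^esub> y \<in> elementary R m"
    using u v words_append[of u _ v] by (auto simp: elementary_def)
qed

lemma elementary_inv:
  assumes "x \<in> elementary R m"
  shows "\<exists>y\<in>elementary R m. y \<otimes>\<^bsub>Q\<^esub> x = id_mat R"
proof -
  interpret GL: pres_images "GL R" "st_gens R" "st_rels R" "elem_mat R" by (rule GL_images)
  obtain u where u: "u \<in> words (bounded_gens R m)" "x = word_eval (GL R) (elem_mat R) u"
    using assms by (auto simp: elementary_def)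
  then have us: "u \<in> words (st_gens R)" using bounded_words by blast
  have "word_eval (GL R) (elem_mat R) (word_inv u) \<otimes>\<^bsub>Q\<^esub> x = word_eval (GL R) (elem_mat R) (word_inv u @ u)"
    using us u(2) word_inv_words[OF us] by (simp add: GL.eval_append flip: GL_mult)
  also have "\<dots> = id_mat R"
    using GL.eval_eq[OF word_inv_cancel[OF us]] by (simp add: GL_one)
  finally show ?thesis
    using word_inv_words[OF u(1)] unfolding elementary_def by blast
qed

lemma elementary_pow: "x \<in> elementary R m \<Longrightarrow> x [^]\<^bsub>Q\<^esub> (q::nat) \<in> elementary R m"
proof (induction q)
  case 0
  then show ?case using elementary_one by (simp add: nat_pow_def rf_one)
next
  case (Suc q)
  interpret rf: ring Q by (rule ring_rf)
  show ?case using Suc by (simp add: elementary_mult)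
qed

end

text \<open>A permutation of \<open>S\<close> maps \<open>S\<close> to itself, so only entries with
  both indices in \<open>S\<close> count. The restriction matters because identities such as
  \<open>rho_one\<close> are available for indices in \<open>T\<close> only.\<close>

lemma (in cring) ldet_cong_on:
  assumes "\<And>i j. i \<in> S \<Longrightarrow> j \<in> S \<Longrightarrow> X i j = Y i j" "\<And>i j. Y i j \<in> carrier R"
  shows "ldet S X = ldet S Y"
proof -
  have "(\<Otimes>i\<in>S. X i (\<pi> i)) = (\<Otimes>i\<in>S. Y i (\<pi> i))" if "\<pi> permutes S" for \<pi>
    using assms permutes_in_image[OF that] by (intro finprod_cong') auto
  then have sum: "(\<Oplus>\<pi>\<in>P. \<Otimes>i\<in>S. X i (\<pi> i)) = (\<Oplus>\<pi>\<in>P. \<Otimes>i\<in>S. Y i (\<pi> i))"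
    if "P \<subseteq> {\<pi>. \<pi> permutes S}" for P
    using assms that by (intro finsum_cong') (auto intro!: finprod_closed)
  have "even_perms S \<subseteq> {\<pi>. \<pi> permutes S}" "odd_perms S \<subseteq> {\<pi>. \<pi> permutes S}" by auto
  then show ?thesis unfolding ldet_def by (simp only: sum)
qed

section \<open>Transfer to a commutative subgroup\<close>

text \<open>As a right module over the group ring of the subgroup \<open>C\<close>, the group ring of \<open>G\<close> is free
  on a set \<open>T\<close> of coset representatives; \<open>rho s t a\<close> are the entries of the matrix of left
  multiplication by \<open>a\<close>.\<close>

locale coset_transfer = finite_group_ring R G + R: cring R
  for R :: "('a, 'b) ring_scheme" and G :: "('g, 'c) monoid_scheme" (structure) +
  fixes C T :: "'g set"
  assumes C: "subgroup C G"
    and C_comm: "x \<in> C \<Longrightarrow> y \<in> C \<Longrightarrow> x \<otimes> y = y \<otimes> x"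
    and T: "T \<subseteq> carrier G"
    and bij: "bij_betw (\<lambda>(t, c). t \<otimes> c) (T \<times> C) (carrier G)"
begin

abbreviation "H \<equiv> G\<lparr>carrier := C\<rparr>"
abbreviation "B \<equiv> group_ring R H"

lemma C_carrier [simp]: "c \<in> C \<Longrightarrow> c \<in> carrier G"
  using subgroup.subset[OF C] by blast

lemma T_carrier [simp]: "t \<in> T \<Longrightarrow> t \<in> carrier G"
  using T by blast

lemma finite_C: "finite C" and finite_T: "finite T"
  using fin finite_subset[OF subgroup.subset[OF C]] finite_subset[OF T] by auto

lemma comm_group_H: "comm_group H"
  by (rule group.group_comm_groupI[OF subgroup.subgroup_is_group[OF C G.group_axioms]])
    (simp add: C_comm)

sublocale B: cring B
  by (rule cring_group_ring[OF R.cring_axioms comm_group_H]) (simp add: finite_C)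

sublocale H: finite_group_ring R H
  using comm_group_H finite_C
  by (intro finite_group_ring.intro finite_group_ring_axioms.intro R.ring_axioms comm_group.axioms(2)) auto

lemma inv_H: "c \<in> C \<Longrightarrow> inv\<^bsub>H\<^esub> c = inv c"
  by (rule G.m_inv_consistent[OF C])

text \<open>The coefficient of \<open>a t\<close> at \<open>s c\<close> is
  \<open>a (s c t^-1)\<close>; as a function of \<open>c\<close> it is the entry in row
  \<open>s\<close> and column \<open>t\<close>. The value zero outside the group makes
  \<open>rho_closed\<close> hold for all \<open>s\<close> and \<open>t\<close>, not only for those
  in \<open>T\<close>.\<close>

definition rho :: "'g \<Rightarrow> 'g \<Rightarrow> ('g \<Rightarrow> 'a) \<Rightarrow> 'g \<Rightarrow> 'a"
  where "rho s t a = (\<lambda>c\<in>C. if s \<otimes> c \<otimes> inv t \<in> carrier G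
    then a (s \<otimes> c \<otimes> inv t) else \<zero>\<^bsub>R\<^esub>)"

lemma rho_closed [simp]: "a \<in> carrier A \<Longrightarrow> rho s t a \<in> carrier B"
  unfolding rho_def by (subst group_ring_carrier) auto

lemma rho_entry [simp]: "a \<in> carrier A \<Longrightarrow> c \<in> C \<Longrightarrow> rho s t a c \<in> carrier R"
  using H.val[OF rho_closed] by simp

lemma rho_val: "s \<in> T \<Longrightarrow> t \<in> T \<Longrightarrow> c \<in> C \<Longrightarrow> rho s t a c = a (s \<otimes> c \<otimes> inv t)"
  by (simp add: rho_def)

lemma rho_add: "a \<in> carrier A \<Longrightarrow> b \<in> carrier A \<Longrightarrow> rho s t (a \<oplus>\<^bsub>A\<^esub> b) = rho s t a \<oplus>\<^bsub>B\<^esub> rho s t b"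
  by (rule group_ring_eqI[of _ R H]) (auto simp: group_ring_add, auto simp: rho_def group_ring_add)

lemma rho_pow: "a \<in> carrier A \<Longrightarrow> rho s t ([(N::nat)] \<cdot>\<^bsub>A\<^esub> a) = [N] \<cdot>\<^bsub>B\<^esub> rho s t a"
  by (rule group_ring_eqI[of _ R H])
    (auto simp: H.group_ring_add_pow, auto simp: rho_def group_ring_add_pow)

lemma rho_one:
  assumes s: "s \<in> T" and t: "t \<in> T"
  shows "rho s t \<one>\<^bsub>A\<^esub> = (if s = t then \<one>\<^bsub>B\<^esub> else \<zero>\<^bsub>B\<^esub>)"
proof (rule group_ring_eqI[of _ R H])
  fix c assume "c \<in> carrier H"
  then have c: "c \<in> C" by simp
  have one: "\<one> \<in> C" by (rule subgroup.one_closed[OF C])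
  have "s \<otimes> c \<otimes> inv t = \<one> \<longleftrightarrow> s \<otimes> c = t \<otimes> \<one>"
    using s t c G.inv_solve_right'[of "\<one>" "s \<otimes> c" t] by auto
  also have "\<dots> \<longleftrightarrow> s = t \<and> c = \<one>"
    using inj_onD[OF bij_betw_imp_inj_on[OF bij], of "(s, c)" "(t, \<one>)"] s t c one by auto
  finally show "rho s t \<one>\<^bsub>A\<^esub> c = (if s = t then \<one>\<^bsub>B\<^esub> else \<zero>\<^bsub>B\<^esub>) c"
    using s t c by (simp add: rho_val group_ring_one group_ring_zero)
qed auto

lemma rho_zero: "rho s t \<zero>\<^bsub>A\<^esub> = \<zero>\<^bsub>B\<^esub>"
  by (rule group_ring_eqI[of _ R H]) (auto simp: group_ring_zero, auto simp: rho_def group_ring_zero)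

text \<open>Every \<open>y\<close> in \<open>G\<close> is \<open>s d q^-1\<close> for exactly one
  pair \<open>(q, d)\<close>: decompose \<open>y^-1 s = q d^-1\<close> along the cosets. The
  convolution over \<open>y\<close> then splits into the matrix sum over \<open>q\<close> in
  \<open>T\<close> and a convolution over \<open>d\<close> in \<open>C\<close>.\<close>

lemma rho_mult:
  assumes s: "s \<in> T" and t: "t \<in> T" and a: "a \<in> carrier A" and b: "b \<in> carrier A"
  shows "rho s t (a \<otimes>\<^bsub>A\<^esub> b) = (\<Oplus>\<^bsub>B\<^esub>q\<in>T. rho s q a \<otimes>\<^bsub>B\<^esub> rho q t b)"
proof (rule group_ring_eqI[of _ R H])
  fix c assume "c \<in> carrier H"
  then have c: "c \<in> C" by simp
  let ?x = "s \<otimes> c \<otimes> inv t"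
  let ?h = "\<lambda>(q, d). s \<otimes> d \<otimes> inv q"
  have iC: "inv d \<in> C" if "d \<in> C" for d using subgroup.m_inv_closed[OF C that] .
  have b1: "bij_betw (\<lambda>(q, d). (q, inv d)) (T \<times> C) (T \<times> C)"
    by (rule bij_betw_byWitness[where f' = "\<lambda>(q, d). (q, inv d)"]) (auto simp: iC)
  have b2: "bij_betw (\<lambda>y. s \<otimes> inv y) (carrier G) (carrier G)"
    using s by (intro bij_betw_byWitness[where f' = "\<lambda>y. inv y \<otimes> s"])
      (auto simp: G.inv_mult_group G.m_assoc, auto simp: G.m_assoc[symmetric])
  have "bij_betw ?h (T \<times> C) (carrier G)"
    by (rule bij_betw_cong[THEN iffD1, OF _ bij_betw_trans[OF bij_betw_trans[OF b1 bij] b2]])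
      (use s in \<open>auto simp: G.inv_mult_group G.m_assoc\<close>)
  have "rho s t (a \<otimes>\<^bsub>A\<^esub> b) c = (\<Oplus>\<^bsub>R\<^esub>y\<in>carrier G. a y \<otimes>\<^bsub>R\<^esub> b (inv y \<otimes> ?x))"
    using s t c by (simp add: rho_val group_ring_mult)
  also have "\<dots> = (\<Oplus>\<^bsub>R\<^esub>z\<in>T \<times> C. a (?h z) \<otimes>\<^bsub>R\<^esub> b (inv (?h z) \<otimes> ?x))"
    using s t c a b by (intro R.finsum_bij_betw \<open>bij_betw ?h (T \<times> C) (carrier G)\<close>) auto
  also have "\<dots> = finsum R (\<lambda>(q, d). rho s q a d \<otimes>\<^bsub>R\<^esub> rho q t b (inv\<^bsub>H\<^esub> d \<otimes>\<^bsub>H\<^esub> c)) (T \<times> C)"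
  proof (intro R.finsum_cong' refl)
    fix z assume "z \<in> T \<times> C"
    then obtain q d where z: "z = (q, d)" "q \<in> T" "d \<in> C" by auto
    have "inv d \<otimes> c \<in> C" using z c iC subgroup.m_closed[OF C] by simp
    moreover have "inv (?h z) \<otimes> ?x = q \<otimes> (inv d \<otimes> c) \<otimes> inv t"
    proof -
      have "inv s \<otimes> (s \<otimes> (c \<otimes> inv t)) = c \<otimes> inv t"
        using s t c by (simp add: G.m_assoc[symmetric])
      then show ?thesis using z s t c by (simp add: G.inv_mult_group G.m_assoc)
    qed
    ultimately show "a (?h z) \<otimes>\<^bsub>R\<^esub> b (inv (?h z) \<otimes> ?x) =
        (case z of (q, d) \<Rightarrow> rho s q a d \<otimes>\<^bsub>R\<^esub> rho q t b (inv\<^bsub>H\<^esub> d \<otimes>\<^bsub>H\<^esub> c))"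
      using z s t by (simp add: rho_val inv_H)
  next
    have "inv\<^bsub>H\<^esub> d \<otimes>\<^bsub>H\<^esub> c \<in> C" if "d \<in> C" for d
      using c that by (simp add: inv_H iC subgroup.m_closed[OF C])
    then show "(\<lambda>(q, d). rho s q a d \<otimes>\<^bsub>R\<^esub> rho q t b (inv\<^bsub>H\<^esub> d \<otimes>\<^bsub>H\<^esub> c)) \<in> T \<times> C \<rightarrow> carrier R"
      using a b by (auto intro!: R.m_closed rho_entry)
  qed
  also have "\<dots> = (\<Oplus>\<^bsub>R\<^esub>q\<in>T. \<Oplus>\<^bsub>R\<^esub>d\<in>C. rho s q a d \<otimes>\<^bsub>R\<^esub> rho q t b (inv\<^bsub>H\<^esub> d \<otimes>\<^bsub>H\<^esub> c))"
  proof (rule R.finsum_Sigma'[symmetric])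
    fix q d assume "q \<in> T" "d \<in> C"
    moreover have "inv\<^bsub>H\<^esub> d \<otimes>\<^bsub>H\<^esub> c \<in> C" if "d \<in> C" for d
      using c that by (simp add: inv_H iC subgroup.m_closed[OF C])
    ultimately show "rho s q a d \<otimes>\<^bsub>R\<^esub> rho q t b (inv\<^bsub>H\<^esub> d \<otimes>\<^bsub>H\<^esub> c) \<in> carrier R"
      using a b by (auto intro!: R.m_closed rho_entry)
  qed (use finite_C finite_T in auto)
  also have "\<dots> = (\<Oplus>\<^bsub>R\<^esub>q\<in>T. (rho s q a \<otimes>\<^bsub>B\<^esub> rho q t b) c)"
    using c group_ring_mult[of c H R] by simp
  also have "\<dots> = (\<Oplus>\<^bsub>B\<^esub>q\<in>T. rho s q a \<otimes>\<^bsub>B\<^esub> rho q t b) c"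
    using finite_T a b c by (intro H.group_ring_finsum[symmetric]) auto
  finally show "rho s t (a \<otimes>\<^bsub>A\<^esub> b) c = (\<Oplus>\<^bsub>B\<^esub>q\<in>T. rho s q a \<otimes>\<^bsub>B\<^esub> rho q t b) c" .
qed (use a b in \<open>auto intro!: B.finsum_closed\<close>)

definition blow_up :: "(nat \<Rightarrow> nat \<Rightarrow> 'g \<Rightarrow> 'a) \<Rightarrow> nat \<times> 'g \<Rightarrow> nat \<times> 'g \<Rightarrow> 'g \<Rightarrow> 'a"
  where "blow_up X k l = rho (snd k) (snd l) (X (fst k) (fst l))"

text \<open>By induction over the letters: a row operation over \<open>A\<close> is a block row
  operation over \<open>B\<close>, by \<open>rho_add\<close> and \<open>rho_mult\<close>, and the
  blocks of \<open>i\<close> and \<open>j\<close> are disjoint as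
  \<open>i \<noteq> j\<close>.\<close>

lemma ldet_elementary:
  assumes "x \<in> elementary A m"
  shows "B.ldet ({..<m} \<times> T) (blow_up x) = \<one>\<^bsub>B\<^esub>"
proof -
  let ?S = "{..<m} \<times> T"
  have S: "finite ?S" using finite_T by simp
  interpret GL: pres_images "GL A" "st_gens A" "st_rels A" "elem_mat A" by (rule A.GL_images)
  obtain w where w: "w \<in> words (bounded_gens A m)" "x = word_eval (GL A) (elem_mat A) w"
    using assms by (auto simp: elementary_def)
  from w(1) have "B.ldet ?S (blow_up (word_eval (GL A) (elem_mat A) w)) = \<one>\<^bsub>B\<^esub>"
  proof (induction w)
    case Nil
    \<comment> \<open>The zero multiple of 0 is added only to match \<open>ldet_one_plus\<close> at
      \<open>N = 0\<close>, which evaluates the determinant of the identity.\<close>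
    let ?I = "\<lambda>k l. (if k = l then \<one>\<^bsub>B\<^esub> else \<zero>\<^bsub>B\<^esub>) \<oplus>\<^bsub>B\<^esub> [(0::nat)] \<cdot>\<^bsub>B\<^esub> \<zero>\<^bsub>B\<^esub>"
    have "B.ldet ?S (blow_up (word_eval (GL A) (elem_mat A) [])) = B.ldet ?S ?I"
      by (rule B.ldet_cong_on) (auto simp: blow_up_def A.GL_one id_mat_def rho_one rho_zero)
    moreover have "ncong B (0 * 0) (B.ldet ?S ?I) (\<one>\<^bsub>B\<^esub> \<oplus>\<^bsub>B\<^esub> [(0::nat)] \<cdot>\<^bsub>B\<^esub> (\<Oplus>\<^bsub>B\<^esub>i\<in>?S. \<zero>\<^bsub>B\<^esub>))"
      using S by (rule B.ldet_one_plus) simp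
    ultimately show ?case by (auto simp: ncong_def)
  next
    case (Cons a w)
    obtain i j r b where a: "a = ((i, j, r), b)" by (metis surj_pair)
    have w: "w \<in> words (bounded_gens A m)" and ij: "i \<noteq> j" "i < m" "j < m" "r \<in> carrier A"
      using Cons.prems by (auto simp: a words_def bounded_gens_def)
    let ?X = "word_eval (GL A) (elem_mat A) w" and ?r = "if b then r else \<ominus>\<^bsub>A\<^esub> r"
    have ws: "w \<in> words (st_gens A)" using w bounded_words by blast
    have X: "?X k l \<in> carrier A" for k l using ws by (rule A.word_eval_GL_entry)
    have r: "?r \<in> carrier A" using ij by simp
    have eX: "word_eval (GL A) (elem_mat A) (a # w) =
      (\<lambda>k l. if k = i then ?X i l \<oplus>\<^bsub>A\<^esub> ?r \<otimes>\<^bsub>A\<^esub> ?X j l else ?X k l)"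
      unfolding a by (rule A.word_eval_GL_Cons[OF ij(1,4) ws])
    let ?Y = "blow_up ?X" and ?c = "\<lambda>k q. rho (snd k) (snd q) ?r"
    have Y: "?Y k l \<in> carrier B" for k l using X by (simp add: blow_up_def)
    let ?Z = "\<lambda>k l. if k \<in> {i} \<times> T then ?Y k l \<oplus>\<^bsub>B\<^esub> (\<Oplus>\<^bsub>B\<^esub>q\<in>{j} \<times> T. ?c k q \<otimes>\<^bsub>B\<^esub> ?Y q l) else ?Y k l"
    have "B.ldet ?S (blow_up (word_eval (GL A) (elem_mat A) (a # w))) = B.ldet ?S ?Z"
    proof (rule B.ldet_cong_on)
      fix k l assume kl: "k \<in> ?S" "l \<in> ?S"
      have "(\<Oplus>\<^bsub>B\<^esub>q\<in>{j} \<times> T. ?c k q \<otimes>\<^bsub>B\<^esub> ?Y q l) = (\<Oplus>\<^bsub>B\<^esub>q\<in>T. ?c k (j, q) \<otimes>\<^bsub>B\<^esub> ?Y (j, q) l)"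
        using r Y by (intro B.finsum_bij_betw) (auto simp: bij_betw_def inj_on_def)
      moreover have "rho (snd k) (snd l) (?r \<otimes>\<^bsub>A\<^esub> ?X j (fst l)) =
          (\<Oplus>\<^bsub>B\<^esub>q\<in>T. ?c k (j, q) \<otimes>\<^bsub>B\<^esub> ?Y (j, q) l)"
        using kl r X by (subst rho_mult) (auto simp: blow_up_def)
      ultimately show "blow_up (word_eval (GL A) (elem_mat A) (a # w)) k l = ?Z k l"
        unfolding eX using kl X r by (auto simp: blow_up_def rho_add)
    qed (use Y r in \<open>auto intro!: B.finsum_closed\<close>)
    also have "\<dots> = B.ldet ?S ?Y"
      using S ij Y r by (intro B.ldet_block_row_operation) auto
    also have "\<dots> = \<one>\<^bsub>B\<^esub>" by (rule Cons.IH[OF w])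
    finally show ?case .
  qed
  then show ?thesis using w(2) by simp
qed

text \<open>The determinant of the blow-up is 1, and it is also \<open>1 + N \<tau>\<close> modulo
  \<open>N * N\<close>, where \<tau> is the trace over \<open>B\<close>; hence
  \<open>N \<tau>\<close> is divisible by \<open>N * N\<close>, and torsion-freeness cancels one
  \<open>N\<close>. The coefficient of \<tau> at \<open>g\<close> sums the coefficients of the trace
  of \<open>V\<close> at the conjugates \<open>t g t^-1\<close>.\<close>

lemma transfer_trace:
  assumes tf: "\<And>N x. N > (0::nat) \<Longrightarrow> x \<in> carrier R \<Longrightarrow> [N] \<cdot>\<^bsub>R\<^esub> x = \<zero>\<^bsub>R\<^esub> \<Longrightarrow> x = \<zero>\<^bsub>R\<^esub>"
    and x: "x \<in> elementary A m" and V: "\<And>i j. V i j \<in> carrier A" and N: "N > 0"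
    and xV: "\<And>i j. x i j = id_mat A i j \<oplus>\<^bsub>A\<^esub> [N] \<cdot>\<^bsub>A\<^esub> V i j" and g: "g \<in> C"
  shows "ncong R N (\<Oplus>\<^bsub>R\<^esub>t\<in>T. (\<Oplus>\<^bsub>A\<^esub>i\<in>{..<m}. V i i) (t \<otimes> g \<otimes> inv t)) \<zero>\<^bsub>R\<^esub>"
proof -
  let ?S = "{..<m} \<times> T"
  have S: "finite ?S" using finite_T by simp
  have W: "blow_up V k l \<in> carrier B" for k l using V by (simp add: blow_up_def)
  have "\<one>\<^bsub>B\<^esub> = B.ldet ?S (blow_up x)" using ldet_elementary[OF x] by simp
  also have "\<dots> = B.ldet ?S (\<lambda>k l. (if k = l then \<one>\<^bsub>B\<^esub> else \<zero>\<^bsub>B\<^esub>) \<oplus>\<^bsub>B\<^esub> [N] \<cdot>\<^bsub>B\<^esub> blow_up V k l)"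
  proof (rule B.ldet_cong_on)
    fix k l assume "k \<in> ?S" "l \<in> ?S"
    then show "blow_up x k l = (if k = l then \<one>\<^bsub>B\<^esub> else \<zero>\<^bsub>B\<^esub>) \<oplus>\<^bsub>B\<^esub> [N] \<cdot>\<^bsub>B\<^esub> blow_up V k l"
      using V by (auto simp: blow_up_def xV rho_add rho_pow id_mat_def rho_one rho_zero)
  qed (use W in auto)
  finally have eq: "\<one>\<^bsub>B\<^esub> = \<dots>" .
  define \<tau> where "\<tau> = (\<Oplus>\<^bsub>B\<^esub>k\<in>?S. blow_up V k k)"
  have \<tau>: "\<tau> \<in> carrier B" unfolding \<tau>_def using W by (auto intro: B.finsum_closed)
  have "ncong B (N * N) \<one>\<^bsub>B\<^esub> (\<one>\<^bsub>B\<^esub> \<oplus>\<^bsub>B\<^esub> [N] \<cdot>\<^bsub>B\<^esub> \<tau>)"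
    unfolding \<tau>_def by (subst eq) (rule B.ldet_one_plus[OF S W])
  then obtain z where z: "z \<in> carrier B" "\<one>\<^bsub>B\<^esub> = (\<one>\<^bsub>B\<^esub> \<oplus>\<^bsub>B\<^esub> [N] \<cdot>\<^bsub>B\<^esub> \<tau>) \<oplus>\<^bsub>B\<^esub> [(N * N)] \<cdot>\<^bsub>B\<^esub> z"
    by (rule B.ncongE)
  have "\<one>\<^bsub>B\<^esub> \<oplus>\<^bsub>B\<^esub> \<zero>\<^bsub>B\<^esub> = \<one>\<^bsub>B\<^esub> \<oplus>\<^bsub>B\<^esub> ([N] \<cdot>\<^bsub>B\<^esub> \<tau> \<oplus>\<^bsub>B\<^esub> [(N * N)] \<cdot>\<^bsub>B\<^esub> z)"
    using z \<tau> by (simp add: B.a_assoc)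
  then have "\<zero>\<^bsub>B\<^esub> = [N] \<cdot>\<^bsub>B\<^esub> \<tau> \<oplus>\<^bsub>B\<^esub> [(N * N)] \<cdot>\<^bsub>B\<^esub> z"
    using z(1) \<tau> by (subst (asm) B.add.l_cancel) auto
  also have "\<dots> = [N] \<cdot>\<^bsub>B\<^esub> (\<tau> \<oplus>\<^bsub>B\<^esub> [N] \<cdot>\<^bsub>B\<^esub> z)"
    using z \<tau> by (simp add: B.add_pow_distrib B.add_pow_mult)
  finally have "([N] \<cdot>\<^bsub>B\<^esub> (\<tau> \<oplus>\<^bsub>B\<^esub> [N] \<cdot>\<^bsub>B\<^esub> z)) g = \<zero>\<^bsub>B\<^esub> g" by (rule arg_cong[OF sym])
  then have "([N] \<cdot>\<^bsub>B\<^esub> (\<tau> \<oplus>\<^bsub>B\<^esub> [N] \<cdot>\<^bsub>B\<^esub> z)) g = \<zero>\<^bsub>R\<^esub>"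
    using g by (simp add: group_ring_zero)
  then have "[N] \<cdot>\<^bsub>R\<^esub> (\<tau> g \<oplus>\<^bsub>R\<^esub> [N] \<cdot>\<^bsub>R\<^esub> z g) = \<zero>\<^bsub>R\<^esub>"
    using g z \<tau> by (simp add: H.group_ring_add_pow group_ring_add)
  then have "\<tau> g \<oplus>\<^bsub>R\<^esub> [N] \<cdot>\<^bsub>R\<^esub> z g = \<zero>\<^bsub>R\<^esub>"
    using tf[OF N] g z(1) \<tau> by auto
  then have "\<tau> g = \<zero>\<^bsub>R\<^esub> \<oplus>\<^bsub>R\<^esub> [N] \<cdot>\<^bsub>R\<^esub> (\<ominus>\<^bsub>R\<^esub> z g)"
    using g z(1) \<tau> R.minus_equality[of "\<tau> g" "[N] \<cdot>\<^bsub>R\<^esub> z g"] by (simp add: R.add_pow_neg)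
  then have "ncong R N (\<tau> g) \<zero>\<^bsub>R\<^esub>" by (rule R.ncongI[rotated]) (use g z(1) in simp)
  moreover have "\<tau> g = (\<Oplus>\<^bsub>R\<^esub>t\<in>T. (\<Oplus>\<^bsub>A\<^esub>i\<in>{..<m}. V i i) (t \<otimes> g \<otimes> inv t))"
  proof -
    have "\<tau> g = (\<Oplus>\<^bsub>R\<^esub>k\<in>?S. blow_up V k k g)"
      unfolding \<tau>_def using S W g by (intro H.group_ring_finsum) auto
    also have "\<dots> = finsum R (\<lambda>(i, t). V i i (t \<otimes> g \<otimes> inv t)) ?S"
      using V g by (intro R.finsum_cong') (auto simp: blow_up_def rho_val)
    also have "\<dots> = (\<Oplus>\<^bsub>R\<^esub>i\<in>{..<m}. \<Oplus>\<^bsub>R\<^esub>t\<in>T. V i i (t \<otimes> g \<otimes> inv t))"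
      using V g finite_T by (intro R.finsum_Sigma'[symmetric]) auto
    also have "\<dots> = (\<Oplus>\<^bsub>R\<^esub>t\<in>T. \<Oplus>\<^bsub>R\<^esub>i\<in>{..<m}. V i i (t \<otimes> g \<otimes> inv t))"
      using V g finite_T by (intro R.finsum_swap) auto
    also have "\<dots> = (\<Oplus>\<^bsub>R\<^esub>t\<in>T. (\<Oplus>\<^bsub>A\<^esub>i\<in>{..<m}. V i i) (t \<otimes> g \<otimes> inv t))"
      using V g by (intro R.finsum_cong') (auto simp: group_ring_finsum intro!: R.finsum_closed)
    finally show ?thesis .
  qed
  ultimately show ?thesis by simp
qed

end

section \<open>Coset representatives, conjugacy classes and congruences for class sums\<close>

lemma (in group) cyclic_commutative:
  assumes "g \<in> carrier G" "x \<in> generate G {g}" "y \<in> generate G {g}"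
  shows "x \<otimes> y = y \<otimes> x"
proof -
  obtain i j :: int where "x = g [^] i" "y = g [^] j"
    using assms(2,3) unfolding generate_pow[OF assms(1)] by auto
  then show ?thesis using assms(1) by (metis int_pow_mult add.commute)
qed

lemma (in group) exists_coset_representatives:
  assumes "subgroup C G"
  shows "\<exists>T\<subseteq>carrier G. bij_betw (\<lambda>(t, c). t \<otimes> c) (T \<times> C) (carrier G)"
proof -
  interpret C: subgroup C G by fact
  define coset where "coset x = (\<lambda>c. x \<otimes> c) ` C" for x
  \<comment> \<open>\<open>rep x\<close> depends on \<open>x\<close> only through the set
    \<open>coset x\<close>, so equal cosets have the same representative; this yields the
    injectivity below.\<close>
  define rep where "rep x = (SOME y. y \<in> coset x)" for x
  have coset: "coset (x \<otimes> c) = coset x" if "x \<in> carrier G" "c \<in> C" for x c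
  proof (intro equalityI subsetI)
    fix y assume "y \<in> coset (x \<otimes> c)"
    then obtain d where d: "d \<in> C" "y = x \<otimes> c \<otimes> d" by (auto simp: coset_def)
    then have "y = x \<otimes> (c \<otimes> d)" using that by (simp add: m_assoc)
    then show "y \<in> coset x" using that d(1) unfolding coset_def by blast
  next
    fix y assume "y \<in> coset x"
    then obtain d where d: "d \<in> C" "y = x \<otimes> d" by (auto simp: coset_def)
    have "c \<otimes> (inv c \<otimes> d) = d" using that d by (simp add: m_assoc[symmetric])
    then have "y = x \<otimes> c \<otimes> (inv c \<otimes> d)" using that d by (simp add: m_assoc)
    then show "y \<in> coset (x \<otimes> c)" using that d(1) unfolding coset_def by blast
  qed
  have rep: "rep x \<in> coset x" for x
  proof -
    have "\<exists>y. y \<in> coset x" unfolding coset_def using C.one_closed by blast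
    then show ?thesis unfolding rep_def by (rule someI_ex)
  qed
  have rep_carrier: "rep x \<in> carrier G" if "x \<in> carrier G" for x
    using rep[of x] that by (auto simp: coset_def)
  have coset_rep: "coset (rep x) = coset x" if "x \<in> carrier G" for x
    using rep[of x] that coset by (auto simp: coset_def[of x])
  have inj: "rep x = rep y \<and> c = d"
    if "x \<in> carrier G" "y \<in> carrier G" "c \<in> C" "d \<in> C" "rep x \<otimes> c = rep y \<otimes> d" for x y c d
  proof -
    have "coset x = coset (rep x \<otimes> c)"
      using coset[OF rep_carrier] coset_rep that by metis
    also have "\<dots> = coset y"
      using coset[OF rep_carrier] coset_rep that by metis
    finally have "rep x = rep y" by (simp add: rep_def)
    then show ?thesis using that rep_carrier by simp
  qed
  have "bij_betw (\<lambda>(t, c). t \<otimes> c) (rep ` carrier G \<times> C) (carrier G)"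
  proof (rule bij_betw_imageI)
    show "inj_on (\<lambda>(t, c). t \<otimes> c) (rep ` carrier G \<times> C)"
    proof (rule inj_onI)
      fix z w assume z: "z \<in> rep ` carrier G \<times> C" and w: "w \<in> rep ` carrier G \<times> C"
        and eq: "(\<lambda>(t, c). t \<otimes> c) z = (\<lambda>(t, c). t \<otimes> c) w"
      obtain x c where x: "x \<in> carrier G" "c \<in> C" "z = (rep x, c)" using z by auto
      obtain y d where y: "y \<in> carrier G" "d \<in> C" "w = (rep y, d)" using w by auto
      show "z = w" using inj[OF x(1) y(1) x(2) y(2)] eq x y by simp
    qed
    show "(\<lambda>(t, c). t \<otimes> c) ` (rep ` carrier G \<times> C) = carrier G"
    proof (intro equalityI subsetI)
      fix x assume x: "x \<in> carrier G"
      obtain c where c: "c \<in> C" "rep x = x \<otimes> c" using rep[of x] by (auto simp: coset_def)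
      then have "x = rep x \<otimes> inv c" using x by (simp add: m_assoc)
      then show "x \<in> (\<lambda>(t, c). t \<otimes> c) ` (rep ` carrier G \<times> C)" using x c(1) by force
    qed (use rep_carrier in auto)
  qed
  moreover have "rep ` carrier G \<subseteq> carrier G" using rep_carrier by auto
  ultimately show ?thesis by (intro exI[of _ "rep ` carrier G"] conjI)
qed

lemma (in ring) finsum_add_pow:
  assumes "finite S" "\<And>s. s \<in> S \<Longrightarrow> f s \<in> carrier R"
  shows "(\<Oplus>s\<in>S. [(N::nat)] \<cdot> f s) = [N] \<cdot> finsum R f S"
  using assms
proof (induction S rule: finite_induct)
  case (insert s S)
  then show ?case by (simp add: Pi_def add_pow_distrib)
qed simp

lemma (in ring) finsum_const: "finite S \<Longrightarrow> a \<in> carrier R \<Longrightarrow> (\<Oplus>s\<in>S. a) = [card S] \<cdot> a"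
proof (induction S rule: finite_induct)
  case (insert s S)
  then show ?case by (simp add: a_comm)
qed simp

definition conj_class :: "('g, 'c) monoid_scheme \<Rightarrow> 'g \<Rightarrow> 'g set"
  where "conj_class G g = (\<lambda>x. x \<otimes>\<^bsub>G\<^esub> g \<otimes>\<^bsub>G\<^esub> inv\<^bsub>G\<^esub> x) ` carrier G"

text \<open>The elements that conjugate \<open>g\<close> to \<open>y = h g h^-1\<close> form the
  left translate by \<open>h\<close> of the centralizer of \<open>g\<close>.\<close>

lemma (in group) card_conj_fiber:
  assumes "finite (carrier G)" "g \<in> carrier G" "y \<in> conj_class G g"
  shows "card {x \<in> carrier G. x \<otimes> g \<otimes> inv x = y} = card {x \<in> carrier G. x \<otimes> g \<otimes> inv x = g}"
proof -
  obtain h where h: "h \<in> carrier G" "y = h \<otimes> g \<otimes> inv h" using assms(3) by (auto simp: conj_class_def)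
  have conj: "h \<otimes> (x \<otimes> g \<otimes> inv x) \<otimes> inv h = h \<otimes> x \<otimes> g \<otimes> inv (h \<otimes> x)"
    if "x \<in> carrier G" "h \<in> carrier G" for x h
    using that assms(2) by (simp add: inv_mult_group m_assoc)
  have "inv h \<otimes> (h \<otimes> g \<otimes> inv h) \<otimes> h = g"
    using h assms(2) by (simp add: m_assoc) (simp add: m_assoc[symmetric])
  then have "h \<otimes> x \<otimes> g \<otimes> inv (h \<otimes> x) = y" if "x \<in> carrier G" "x \<otimes> g \<otimes> inv x = g" for x
    using conj[of x h] that h by simp
  moreover have "inv h \<otimes> x \<otimes> g \<otimes> inv (inv h \<otimes> x) = g" if "x \<in> carrier G" "x \<otimes> g \<otimes> inv x = y" for x
    using conj[of x "inv h"] that h \<open>inv h \<otimes> (h \<otimes> g \<otimes> inv h) \<otimes> h = g\<close> by simp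
  ultimately have "bij_betw (\<lambda>x. h \<otimes> x) {x \<in> carrier G. x \<otimes> g \<otimes> inv x = g} {x \<in> carrier G. x \<otimes> g \<otimes> inv x = y}"
    using h(1) by (intro bij_betw_byWitness[where f' = "\<lambda>x. inv h \<otimes> x"]) (auto simp: m_assoc[symmetric])
  then show ?thesis by (rule bij_betw_same_card[symmetric])
qed

locale torsion_free_group_ring = finite_group_ring R G + R: cring R
  for R :: "('a, 'b) ring_scheme" and G :: "('g, 'c) monoid_scheme" (structure) +
  assumes torsion_free: "\<And>N x. N > (0::nat) \<Longrightarrow> x \<in> carrier R \<Longrightarrow> [N] \<cdot>\<^bsub>R\<^esub> x = \<zero>\<^bsub>R\<^esub> \<Longrightarrow> x = \<zero>\<^bsub>R\<^esub>"
begin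

text \<open>Group the sum by the value of the conjugate: by \<open>card_conj_fiber\<close> all
  fibres have the size of the centralizer.\<close>

lemma finsum_conjugates:
  assumes g: "g \<in> carrier G" and a: "a \<in> carrier A"
  shows "(\<Oplus>\<^bsub>R\<^esub>x\<in>carrier G. a (x \<otimes> g \<otimes> inv x)) =
    [card {x \<in> carrier G. x \<otimes> g \<otimes> inv x = g}] \<cdot>\<^bsub>R\<^esub> (\<Oplus>\<^bsub>R\<^esub>y\<in>conj_class G g. a y)"
proof -
  let ?F = "\<lambda>y. {x \<in> carrier G. x \<otimes> g \<otimes> inv x = y}"
  let ?K = "conj_class G g"
  have K: "?K \<subseteq> carrier G" "finite ?K" using g fin by (auto simp: conj_class_def)
  have F: "finite (?F y)" for y using fin by simp
  have "bij_betw snd (Sigma ?K ?F) (carrier G)"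
    by (rule bij_betw_byWitness[where f' = "\<lambda>x. (x \<otimes> g \<otimes> inv x, x)"]) (auto simp: conj_class_def)
  then have "(\<Oplus>\<^bsub>R\<^esub>x\<in>carrier G. a (x \<otimes> g \<otimes> inv x)) =
      (\<Oplus>\<^bsub>R\<^esub>z\<in>Sigma ?K ?F. a (snd z \<otimes> g \<otimes> inv (snd z)))"
    by (rule R.finsum_bij_betw) (use g a in auto)
  also have "\<dots> = finsum R (\<lambda>(y, x). a y) (Sigma ?K ?F)"
    by (rule R.finsum_cong') (use a K in auto)
  also have "\<dots> = (\<Oplus>\<^bsub>R\<^esub>y\<in>?K. \<Oplus>\<^bsub>R\<^esub>x\<in>?F y. a y)"
    by (rule R.finsum_Sigma'[symmetric]) (use a K F in auto)
  also have "\<dots> = (\<Oplus>\<^bsub>R\<^esub>y\<in>?K. [card (?F g)] \<cdot>\<^bsub>R\<^esub> a y)"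
  proof (rule R.finsum_cong'[OF refl])
    fix y assume y: "y \<in> ?K"
    then have "(\<Oplus>\<^bsub>R\<^esub>x\<in>?F y. a y) = [card (?F y)] \<cdot>\<^bsub>R\<^esub> a y"
      using a K F by (intro R.finsum_const) auto
    then show "(\<Oplus>\<^bsub>R\<^esub>x\<in>?F y. a y) = [card (?F g)] \<cdot>\<^bsub>R\<^esub> a y"
      using G.card_conj_fiber[OF fin g y] by simp
  qed (use a K in auto)
  also have "\<dots> = [card (?F g)] \<cdot>\<^bsub>R\<^esub> (\<Oplus>\<^bsub>R\<^esub>y\<in>?K. a y)"
    using a K by (intro R.finsum_add_pow) auto
  finally show ?thesis .
qed

text \<open>Every \<open>g\<close> lies in the commutative group \<open>C\<close> that it generates,
  so \<open>transfer_trace\<close> applies. Elements of \<open>C\<close> centralize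
  \<open>g\<close>; therefore the sum over \<open>T\<close> of the coefficients at
  \<open>t g t^-1\<close>, multiplied by the order of \<open>C\<close>, is the sum over all of
  \<open>G\<close>, and this is the class sum times the order of the centralizer.\<close>

lemma finsum_class_ncong:
  assumes x: "x \<in> elementary A m" and V: "\<And>i j. V i j \<in> carrier A" and N: "N > 0"
    and xV: "\<And>i j. x i j = id_mat A i j \<oplus>\<^bsub>A\<^esub> [N] \<cdot>\<^bsub>A\<^esub> V i j" and g: "g \<in> carrier G"
  shows "ncong R N ([card {x \<in> carrier G. x \<otimes> g \<otimes> inv x = g}] \<cdot>\<^bsub>R\<^esub>
    (\<Oplus>\<^bsub>R\<^esub>y\<in>conj_class G g. (\<Oplus>\<^bsub>A\<^esub>i\<in>{..<m}. V i i) y)) \<zero>\<^bsub>R\<^esub>"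
proof -
  define C where "C = generate G {g}"
  have C: "subgroup C G" unfolding C_def using g by (intro G.generate_is_subgroup) simp
  have gC: "g \<in> C" unfolding C_def by (rule generate.incl) simp
  have comm: "c \<otimes> d = d \<otimes> c" if "c \<in> C" "d \<in> C" for c d
    using G.cyclic_commutative[OF g] that unfolding C_def by blast
  obtain T where T: "T \<subseteq> carrier G" "bij_betw (\<lambda>(t, c). t \<otimes> c) (T \<times> C) (carrier G)"
    using G.exists_coset_representatives[OF C] by blast
  interpret coset_transfer R G C T 
    by (intro coset_transfer.intro coset_transfer_axioms.intro finite_group_ring_axioms
        R.cring_axioms C comm T)
  let ?a = "\<Oplus>\<^bsub>A\<^esub>i\<in>{..<m}. V i i"
  have a: "?a \<in> carrier A" using V by (auto intro: A.finsum_closed)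
  let ?f = "\<lambda>t. ?a (t \<otimes> g \<otimes> inv t)"
  have f: "?f t \<in> carrier R" if "t \<in> carrier G" for t using a g that by simp
  have "(\<Oplus>\<^bsub>R\<^esub>x\<in>carrier G. ?f x) = (\<Oplus>\<^bsub>R\<^esub>z\<in>T \<times> C. ?f (case z of (t, c) \<Rightarrow> t \<otimes> c))"
    using f by (intro R.finsum_bij_betw[OF bij])
  also have "\<dots> = finsum R (\<lambda>(t, c). ?f t) (T \<times> C)"
  proof (rule R.finsum_cong'[OF refl])
    fix z assume "z \<in> T \<times> C"
    then obtain t c where z: "z = (t, c)" "t \<in> T" "c \<in> C" by auto
    have "c \<otimes> g \<otimes> inv c = g" using z g comm[OF z(3) gC] by (simp add: G.m_assoc)
    then have "t \<otimes> c \<otimes> g \<otimes> inv (t \<otimes> c) = t \<otimes> g \<otimes> inv t"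
      using z g by (simp add: G.inv_mult_group G.m_assoc) (simp add: G.m_assoc[symmetric])
    then show "?f (case z of (t, c) \<Rightarrow> t \<otimes> c) = (case z of (t, c) \<Rightarrow> ?f t)"
      using z by simp
  qed (use f in auto)
  also have "\<dots> = (\<Oplus>\<^bsub>R\<^esub>t\<in>T. \<Oplus>\<^bsub>R\<^esub>c\<in>C. ?f t)"
    by (rule R.finsum_Sigma'[symmetric]) (use f finite_T finite_C in auto)
  also have "\<dots> = (\<Oplus>\<^bsub>R\<^esub>t\<in>T. [card C] \<cdot>\<^bsub>R\<^esub> ?f t)"
    using f finite_C by (intro R.finsum_cong') (auto intro!: R.finsum_const)
  also have "\<dots> = [card C] \<cdot>\<^bsub>R\<^esub> (\<Oplus>\<^bsub>R\<^esub>t\<in>T. ?f t)"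
    using f finite_T by (intro R.finsum_add_pow) auto
  finally have eq: "(\<Oplus>\<^bsub>R\<^esub>x\<in>carrier G. ?f x) = [card C] \<cdot>\<^bsub>R\<^esub> (\<Oplus>\<^bsub>R\<^esub>t\<in>T. ?f t)" .
  have "ncong R N (\<Oplus>\<^bsub>R\<^esub>t\<in>T. ?f t) \<zero>\<^bsub>R\<^esub>"
    by (rule transfer_trace[OF torsion_free x V N xV gC])
  then have "ncong R (card C * N) ([card C] \<cdot>\<^bsub>R\<^esub> (\<Oplus>\<^bsub>R\<^esub>t\<in>T. ?f t)) ([card C] \<cdot>\<^bsub>R\<^esub> \<zero>\<^bsub>R\<^esub>)"
    by (rule R.ncong_scale) simp
  then have "ncong R N (\<Oplus>\<^bsub>R\<^esub>x\<in>carrier G. ?f x) \<zero>\<^bsub>R\<^esub>"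
    using R.ncong_dvd[of "card C * N" _ _ N] by (simp only: eq R.add.nat_pow_one dvd_triv_right)
  then show ?thesis unfolding finsum_conjugates[OF g a] .
qed

lemma add_pow_cancel:
  assumes "N > (0::nat)" "x \<in> carrier R" "y \<in> carrier R" "[N] \<cdot>\<^bsub>R\<^esub> x = [N] \<cdot>\<^bsub>R\<^esub> y"
  shows "x = y"
proof -
  have "[N] \<cdot>\<^bsub>R\<^esub> (x \<oplus>\<^bsub>R\<^esub> \<ominus>\<^bsub>R\<^esub> y) = \<zero>\<^bsub>R\<^esub>"
    using assms by (simp add: R.add_pow_distrib R.add_pow_neg R.r_neg)
  then have "x \<oplus>\<^bsub>R\<^esub> \<ominus>\<^bsub>R\<^esub> y = \<zero>\<^bsub>R\<^esub>" using torsion_free[OF assms(1)] assms by auto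
  then show ?thesis using assms R.minus_equality[of x "\<ominus>\<^bsub>R\<^esub> y"] by simp
qed

text \<open>Write \<open>c = p ^ e * d\<close> with \<open>d\<close> prime to \<open>p\<close>.
  Torsion-freeness cancels \<open>p ^ e\<close> and leaves \<open>d x\<close> divisible by
  \<open>p ^ k\<close>, hence by \<open>p\<close> since \<open>k > 0\<close>; Bezout inverts
  \<open>d\<close> modulo \<open>p\<close>.\<close>

lemma ncong_cancel_coprime:
  assumes p: "prime p" and c: "c > 0" and x: "x \<in> carrier R" and k: "k > 0"
    and "ncong R (p ^ (k + multiplicity p c)) ([c] \<cdot>\<^bsub>R\<^esub> x) \<zero>\<^bsub>R\<^esub>"
  shows "ncong R p x \<zero>\<^bsub>R\<^esub>"
proof -
  let ?e = "multiplicity p c"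
  obtain d where d: "c = p ^ ?e * d" "\<not> p dvd d"
    using multiplicity_decompose'[of c p] c prime_gt_1_nat[OF p] by auto
  obtain z where z: "z \<in> carrier R" "[c] \<cdot>\<^bsub>R\<^esub> x = \<zero>\<^bsub>R\<^esub> \<oplus>\<^bsub>R\<^esub> [(p ^ (k + ?e))] \<cdot>\<^bsub>R\<^esub> z"
    using assms(5) by (rule R.ncongE)
  have "[(p ^ ?e * d)] \<cdot>\<^bsub>R\<^esub> x = [(p ^ ?e * p ^ k)] \<cdot>\<^bsub>R\<^esub> z"
    using z unfolding d(1)[symmetric] by (simp add: power_add mult.commute)
  then have "[(p ^ ?e)] \<cdot>\<^bsub>R\<^esub> ([d] \<cdot>\<^bsub>R\<^esub> x) = [(p ^ ?e)] \<cdot>\<^bsub>R\<^esub> ([(p ^ k)] \<cdot>\<^bsub>R\<^esub> z)"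
    using x z(1) by (simp only: R.add_pow_mult)
  then have dx: "[d] \<cdot>\<^bsub>R\<^esub> x = [(p ^ k)] \<cdot>\<^bsub>R\<^esub> z"
    by (rule add_pow_cancel[rotated 3]) (use x z prime_gt_0_nat[OF p] in auto)
  have "coprime d p" using prime_imp_coprime[OF p d(2)] by (simp add: coprime_commute)
  then obtain u v where uv: "d * u = p * v + 1"
    using coprime_bezout_strong[of d p] p prime_gt_1_nat by (metis less_numeral_extra(4))
  obtain j where j: "k = Suc j" using k by (cases k) auto
  have "x \<oplus>\<^bsub>R\<^esub> [p] \<cdot>\<^bsub>R\<^esub> ([v] \<cdot>\<^bsub>R\<^esub> x) = [(u * d)] \<cdot>\<^bsub>R\<^esub> x"
    using x uv by (simp add: mult.commute[of u] R.add_pow_mult R.a_comm)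
  also have "\<dots> = [u] \<cdot>\<^bsub>R\<^esub> ([(p ^ k)] \<cdot>\<^bsub>R\<^esub> z)" using x dx by (simp add: R.add_pow_mult)
  also have "\<dots> = [(p * (u * p ^ j))] \<cdot>\<^bsub>R\<^esub> z"
    using z(1) by (simp add: R.add_pow_mult[symmetric] j mult.left_commute)
  also have "\<dots> = [p] \<cdot>\<^bsub>R\<^esub> ([u] \<cdot>\<^bsub>R\<^esub> ([(p ^ j)] \<cdot>\<^bsub>R\<^esub> z))"
    using z(1) by (simp add: R.add_pow_mult)
  finally have sum: "x \<oplus>\<^bsub>R\<^esub> [p] \<cdot>\<^bsub>R\<^esub> ([v] \<cdot>\<^bsub>R\<^esub> x) = [p] \<cdot>\<^bsub>R\<^esub> ([u] \<cdot>\<^bsub>R\<^esub> ([(p ^ j)] \<cdot>\<^bsub>R\<^esub> z))" .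
  have "x = (x \<oplus>\<^bsub>R\<^esub> [p] \<cdot>\<^bsub>R\<^esub> ([v] \<cdot>\<^bsub>R\<^esub> x)) \<oplus>\<^bsub>R\<^esub> \<ominus>\<^bsub>R\<^esub> ([p] \<cdot>\<^bsub>R\<^esub> ([v] \<cdot>\<^bsub>R\<^esub> x))"
    using x by (simp add: R.a_assoc R.r_neg)
  also have "\<dots> = [p] \<cdot>\<^bsub>R\<^esub> ([u] \<cdot>\<^bsub>R\<^esub> ([(p ^ j)] \<cdot>\<^bsub>R\<^esub> z)) \<oplus>\<^bsub>R\<^esub> \<ominus>\<^bsub>R\<^esub> ([p] \<cdot>\<^bsub>R\<^esub> ([v] \<cdot>\<^bsub>R\<^esub> x))"
    unfolding sum ..
  also have "\<dots> = \<zero>\<^bsub>R\<^esub> \<oplus>\<^bsub>R\<^esub> [p] \<cdot>\<^bsub>R\<^esub> ([u] \<cdot>\<^bsub>R\<^esub> ([(p ^ j)] \<cdot>\<^bsub>R\<^esub> z) \<oplus>\<^bsub>R\<^esub> \<ominus>\<^bsub>R\<^esub> ([v] \<cdot>\<^bsub>R\<^esub> x))"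
    using x z(1) by (simp add: R.add_pow_distrib R.add_pow_neg)
  finally show ?thesis by (rule R.ncongI[rotated]) (use x z(1) in simp)
qed

text \<open>Passing to the power \<open>x\<^bsup>p^e\<^esup>\<close> changes \<open>V\<close> only by a multiple of \<open>p\<close> but improves the
  modulus of the congruence for the class sums, so that the factor \<open>p\<^sup>e\<close> of the order of a
  centralizer can be cancelled.\<close>

lemma elementary_class_trace:
  assumes p: "prime p" "k > 0" "p ^ k > (2::nat)"
    and x: "x \<in> elementary A m" and V: "V \<in> carrier A.Q"
    and xV: "x = \<one>\<^bsub>A.Q\<^esub> \<oplus>\<^bsub>A.Q\<^esub> [(p ^ k)] \<cdot>\<^bsub>A.Q\<^esub> V" and g: "g \<in> carrier G"
  shows "ncong R p (\<Oplus>\<^bsub>R\<^esub>y\<in>conj_class G g. (\<Oplus>\<^bsub>A\<^esub>i\<in>{..<m}. V i i) y) \<zero>\<^bsub>R\<^esub>"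
proof -
  interpret Q: ring A.Q by (rule A.ring_rf)
  define c where "c = card {x \<in> carrier G. x \<otimes> g \<otimes> inv x = g}"
  have "\<one> \<in> {x \<in> carrier G. x \<otimes> g \<otimes> inv x = g}" using g by simp
  then have c: "c > 0" unfolding c_def using fin by (auto simp: card_gt_0_iff)
  let ?e = "multiplicity p c"
  obtain V' where V': "V' \<in> carrier A.Q" "ncong A.Q p V' V"
    "x [^]\<^bsub>A.Q\<^esub> (p ^ ?e) = \<one>\<^bsub>A.Q\<^esub> \<oplus>\<^bsub>A.Q\<^esub> [(p ^ (k + ?e))] \<cdot>\<^bsub>A.Q\<^esub> V'"
    using Q.one_plus_prime_power_iter[OF p V, of ?e] unfolding xV[symmetric] by blast
  let ?tr = "\<lambda>V. \<Oplus>\<^bsub>A\<^esub>i\<in>{..<m}. V i i"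
  let ?\<tau> = "\<lambda>V. \<Oplus>\<^bsub>R\<^esub>y\<in>conj_class G g. ?tr V y"
  have K: "conj_class G g \<subseteq> carrier G" "finite (conj_class G g)"
    using g fin by (auto simp: conj_class_def)
  have tr: "?tr W \<in> carrier A" if "W \<in> carrier A.Q" for W
    using that by (auto intro: A.finsum_closed)
  have \<tau>: "?\<tau> W \<in> carrier R" if "W \<in> carrier A.Q" for W
    using tr[OF that] K by (auto intro!: R.finsum_closed)
  have ent: "(x [^]\<^bsub>A.Q\<^esub> (p ^ ?e)) i j = id_mat A i j \<oplus>\<^bsub>A\<^esub> [(p ^ (k + ?e))] \<cdot>\<^bsub>A\<^esub> V' i j" for i j
    unfolding V'(3) using V'(1) by (simp only: A.rf_add A.rf_add_pow A.rf_one)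
  have ent': "V' i j \<in> carrier A" for i j using V'(1) by simp
  have "p ^ (k + ?e) > 0" using prime_gt_0_nat[OF p(1)] by simp
  from finsum_class_ncong[OF A.elementary_pow[OF x] ent' this ent g]
  have "ncong R (p ^ (k + ?e)) ([c] \<cdot>\<^bsub>R\<^esub> ?\<tau> V') \<zero>\<^bsub>R\<^esub>" unfolding c_def .
  then have V'0: "ncong R p (?\<tau> V') \<zero>\<^bsub>R\<^esub>"
    by (rule ncong_cancel_coprime[OF p(1) c \<tau>[OF V'(1)] p(2)])
  obtain Z where Z: "Z \<in> carrier A.Q" "V = V' \<oplus>\<^bsub>A.Q\<^esub> [p] \<cdot>\<^bsub>A.Q\<^esub> Z"
    using Q.ncong_sym[OF V'(2) V] by (rule Q.ncongE)
  have "ncong R p (?\<tau> V) (?\<tau> V')"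
  proof (rule R.ncong_finsum[OF K(2)])
    fix y assume "y \<in> conj_class G g"
    then have y: "y \<in> carrier G" using K by blast
    have trR: "?tr W y = (\<Oplus>\<^bsub>R\<^esub>i\<in>{..<m}. W i i y)" if "W \<in> carrier A.Q" for W
      using that y by (intro group_ring_finsum) auto
    show "ncong R p (?tr V y) (?tr V' y)"
      unfolding trR[OF V] trR[OF V'(1)]
    proof (rule R.ncong_finsum)
      fix i
      show "ncong R p (V i i y) (V' i i y)"
        using Z V'(1) y by (simp add: A.rf_add A.rf_add_pow group_ring_add group_ring_add_pow
            R.ncong_add_pow)
    qed (use V V'(1) y in auto)
    show "?tr V y \<in> carrier R" "?tr V' y \<in> carrier R" using tr[OF V] tr[OF V'(1)] y by auto
  qed
  then show ?thesis by (rule R.ncong_trans[OF _ V'0]) simp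
qed

end

section \<open>Relative elementary matrices\<close>

text \<open>\<open>Inl (i, j)\<close> stands for the elements \<open>x\<^sub>i\<^sub>j(b)\<close> and \<open>Inr (j, a)\<close> for their conjugates
  \<open>x\<^sub>0\<^sub>j(a) x\<^sub>j\<^sub>0(b) x\<^sub>0\<^sub>j(-a)\<close>. In both cases the matrix is the identity plus an additive function
  of \<open>b\<close>.\<close>

type_synonym 'a factor = "(nat \<times> nat) + (nat \<times> 'a)"

text \<open>\<open>H\<close> will consist of the group elements inside the group ring. Conjugating
  by these finitely many suffices, because the differences \<open>h c - c h\<close> with
  \<open>h\<close> in \<open>G\<close> and \<open>c\<close> arbitrary span all additive commutators.
  Index 0 serves as the common corner.\<close>

definition factor_set :: "nat \<Rightarrow> 'a set \<Rightarrow> 'a factor set"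
  where "factor_set m H = Inl ` {(i, j). i \<noteq> j \<and> i < m \<and> j < m} \<union> Inr ` ({1..<m} \<times> H)"

definition unit_mat :: "('a, 'b) ring_scheme \<Rightarrow> nat \<Rightarrow> nat \<Rightarrow> 'a \<Rightarrow> nat \<Rightarrow> nat \<Rightarrow> 'a"
  where "unit_mat R i j b k l = (if k = i \<and> l = j then b else \<zero>\<^bsub>R\<^esub>)"

text \<open>For \<open>j \<noteq> 0\<close> this is the rank one matrix \<open>v b w\<close> with
  column \<open>v = a e_0 + e_j\<close> and row \<open>w = e_0 - a e_j\<close>, where
  \<open>w v = 0\<close>. Hence it is additive in \<open>b\<close>, and its trace is the commutator
  \<open>a b - b a\<close>.\<close>

definition conj_mat :: "('a, 'b) ring_scheme \<Rightarrow> nat \<Rightarrow> 'a \<Rightarrow> 'a \<Rightarrow> nat \<Rightarrow> nat \<Rightarrow> 'a"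
  where "conj_mat R j a b k l =
    (if k = 0 \<and> l = 0 then a \<otimes>\<^bsub>R\<^esub> b else if k = j \<and> l = j then \<ominus>\<^bsub>R\<^esub> (b \<otimes>\<^bsub>R\<^esub> a)
     else if k = j \<and> l = 0 then b else if k = 0 \<and> l = j then \<ominus>\<^bsub>R\<^esub> (a \<otimes>\<^bsub>R\<^esub> b \<otimes>\<^bsub>R\<^esub> a) else \<zero>\<^bsub>R\<^esub>)"

fun factor_lin :: "('a, 'b) ring_scheme \<Rightarrow> 'a factor \<Rightarrow> 'a \<Rightarrow> nat \<Rightarrow> nat \<Rightarrow> 'a" where
  "factor_lin R (Inl (i, j)) b = unit_mat R i j b"
| "factor_lin R (Inr (j, a)) b = conj_mat R j a b"

fun factor_word :: "('a, 'b) ring_scheme \<Rightarrow> 'a factor \<Rightarrow> 'a \<Rightarrow> 'a st_gen word" where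
  "factor_word R (Inl (i, j)) b = [((i, j, b), True)]"
| "factor_word R (Inr (j, a)) b = [((0, j, a), True), ((j, 0, b), True), ((0, j, \<ominus>\<^bsub>R\<^esub> a), True)]"

lemma finite_factor_set: "finite H \<Longrightarrow> finite (factor_set m H)"
proof -
  assume "finite H"
  moreover have "finite {(i, j). i \<noteq> j \<and> i < m \<and> j < m}"
    by (rule finite_subset[of _ "{..<m} \<times> {..<m}"]) auto
  ultimately show ?thesis by (simp add: factor_set_def)
qed

lemma st_elem_add:
  assumes "i \<noteq> j" "r \<in> carrier R" "s \<in> carrier R" "r \<oplus>\<^bsub>R\<^esub> s \<in> carrier R"
  shows "st_elem R i j r \<otimes>\<^bsub>Steinberg R\<^esub> st_elem R i j s = st_elem R i j (r \<oplus>\<^bsub>R\<^esub> s)"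
proof -
  have w: "[((i, j, t), True)] \<in> words (st_gens R)" if "t \<in> carrier R" for t
    using that assms(1) by (auto simp: words_def st_gens_def)
  have "pres_eq (st_gens R) (st_rels R) [((i, j, r), True), ((i, j, s), True)] [((i, j, r \<oplus>\<^bsub>R\<^esub> s), True)]"
    using assms w[OF assms(4)] words_append[OF w[OF assms(2)] w[OF assms(3)]]
    by (intro pres_rel st_add) auto
  then show ?thesis
    using presented_mult[OF w[OF assms(2)] w[OF assms(3)], of "st_rels R"] pres_class_eqI
    by (fastforce simp: st_elem_def Steinberg_def)
qed

lemma st_elem_zero:
  assumes "ring R" "i \<noteq> j"
  shows "st_elem R i j \<zero>\<^bsub>R\<^esub> = \<one>\<^bsub>Steinberg R\<^esub>"
proof -
  interpret R: ring R by fact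
  interpret St: group "Steinberg R" by (rule group_Steinberg)
  have "st_elem R i j \<zero>\<^bsub>R\<^esub> \<otimes>\<^bsub>Steinberg R\<^esub> st_elem R i j \<zero>\<^bsub>R\<^esub> = st_elem R i j \<zero>\<^bsub>R\<^esub>"
    using st_elem_add[of i j "\<zero>\<^bsub>R\<^esub>" R "\<zero>\<^bsub>R\<^esub>"] assms(2) by simp
  then show ?thesis using st_elem_closed[OF assms(2) R.zero_closed] by simp
qed

text \<open>Triviality is required in the Steinberg group of \<open>S\<close>, not merely of the
  matrix over \<open>S\<close>: the word itself has to provide the element \<open>z\<close> that
  \<open>K2_map_surjI\<close> asks for.\<close>

definition relative_elementary :: "('a, 'b) ring_scheme \<Rightarrow> ('c, 'd) ring_scheme \<Rightarrow> ('a \<Rightarrow> 'c) \<Rightarrow> nat \<Rightarrow>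
    (nat \<Rightarrow> nat \<Rightarrow> 'a) set"
  where "relative_elementary R S f m = word_eval (GL R) (elem_mat R) `
    {w \<in> words (bounded_gens R m). pres_class (st_gens S) (st_rels S) (wmap f w) = \<one>\<^bsub>Steinberg S\<^esub>}"

lemma pres_class_wmap_append:
  assumes "f \<in> carrier R \<rightarrow> carrier S" "u \<in> words (st_gens R)" "v \<in> words (st_gens R)"
  shows "pres_class (st_gens S) (st_rels S) (wmap f (u @ v)) =
    pres_class (st_gens S) (st_rels S) (wmap f u) \<otimes>\<^bsub>Steinberg S\<^esub> pres_class (st_gens S) (st_rels S) (wmap f v)"
  using presented_mult[OF wmap_words[OF assms(1,2)] wmap_words[OF assms(1,3)], of "st_rels S"]
  by (simp add: Steinberg_def)

context ring
begin

lemma relative_elementary_elementary: "relative_elementary R S f m \<subseteq> elementary R m"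
  by (auto simp: relative_elementary_def elementary_def)

lemma relative_elementary_one: "id_mat R \<in> relative_elementary R S f m"
  unfolding relative_elementary_def
  by (rule image_eqI[of _ _ "[]"]) (auto simp: word_eval_def GL_one words_def Steinberg_def presented_one)

lemma relative_elementary_mult:
  assumes f: "f \<in> carrier R \<rightarrow> carrier S"
    and "x \<in> relative_elementary R S f m" "y \<in> relative_elementary R S f m"
  shows "x \<otimes>\<^bsub>Q\<^esub> y \<in> relative_elementary R S f m"
proof -
  interpret St: group "Steinberg S" by (rule group_Steinberg)
  let ?c = "\<lambda>w. pres_class (st_gens S) (st_rels S) (wmap f w)"
  obtain u v where u: "u \<in> words (bounded_gens R m)" "x = word_eval (GL R) (elem_mat R) u" "?c u = \<one>\<^bsub>Steinberg S\<^esub>"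
    and v: "v \<in> words (bounded_gens R m)" "y = word_eval (GL R) (elem_mat R) v" "?c v = \<one>\<^bsub>Steinberg S\<^esub>"
    using assms(2,3) unfolding relative_elementary_def by blast
  have us: "u \<in> words (st_gens R)" "v \<in> words (st_gens R)" using u v bounded_words by blast+
  then have "x \<otimes>\<^bsub>Q\<^esub> y = word_eval (GL R) (elem_mat R) (u @ v)"
    using u v by (simp add: pres_images.eval_append[OF GL_images] GL_mult)
  moreover have "?c (u @ v) = \<one>\<^bsub>Steinberg S\<^esub>"
    unfolding pres_class_wmap_append[OF f us] u(3) v(3) by simp
  moreover have "u @ v \<in> words (bounded_gens R m)" using u v by (simp add: words_append)
  ultimately show ?thesis unfolding relative_elementary_def by blast
qed

lemma unit_mat_rf: "b \<in> carrier R \<Longrightarrow> unit_mat R i j b \<in> carrier Q"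
proof (rule rf_carrierI)
  show "finite {l. unit_mat R i j b k l \<noteq> \<zero>}" for k
    by (rule finite_subset[of _ "{j}"]) (auto simp: unit_mat_def)
qed (auto simp: unit_mat_def)

lemma conj_mat_rf: "a \<in> carrier R \<Longrightarrow> b \<in> carrier R \<Longrightarrow> conj_mat R j a b \<in> carrier Q"
proof (rule rf_carrierI)
  show "finite {l. conj_mat R j a b k l \<noteq> \<zero>}" for k
    by (rule finite_subset[of _ "{0, j}"]) (auto simp: conj_mat_def)
qed (auto simp: conj_mat_def)

lemma factor_lin_closed:
  "H \<subseteq> carrier R \<Longrightarrow> s \<in> factor_set m H \<Longrightarrow> b \<in> carrier R \<Longrightarrow> factor_lin R s b \<in> carrier Q"
  by (auto simp: factor_set_def unit_mat_rf conj_mat_rf subset_iff)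

lemma factor_lin_add:
  assumes "H \<subseteq> carrier R" "s \<in> factor_set m H" "b \<in> carrier R" "c \<in> carrier R"
  shows "factor_lin R s (b \<oplus> c) = factor_lin R s b \<oplus>\<^bsub>Q\<^esub> factor_lin R s c"
proof -
  have "conj_mat R j a (b \<oplus> c) = conj_mat R j a b \<oplus>\<^bsub>Q\<^esub> conj_mat R j a c" if "a \<in> carrier R" for j a
    using that assms by (auto simp: fun_eq_iff rf_add conj_mat_def r_distr l_distr minus_add)
  moreover have "unit_mat R i j (b \<oplus> c) = unit_mat R i j b \<oplus>\<^bsub>Q\<^esub> unit_mat R i j c" for i j
    using assms by (auto simp: fun_eq_iff rf_add unit_mat_def)
  ultimately show ?thesis using assms(1,2) by (auto simp: factor_set_def subset_iff)
qed

lemma factor_word_bounded: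
  "H \<subseteq> carrier R \<Longrightarrow> s \<in> factor_set m H \<Longrightarrow> b \<in> carrier R \<Longrightarrow> factor_word R s b \<in> words (bounded_gens R m)"
  by (auto simp: factor_set_def words_def bounded_gens_def subset_iff)

lemma word_eval_factor_word:
  assumes H: "H \<subseteq> carrier R" and s: "s \<in> factor_set m H" and b: "b \<in> carrier R"
  shows "word_eval (GL R) (elem_mat R) (factor_word R s b) = \<one>\<^bsub>Q\<^esub> \<oplus>\<^bsub>Q\<^esub> factor_lin R s b"
proof -
  interpret GL: group "GL R" by (rule group_GL)
  from s consider i j where "s = Inl (i, j)" "i \<noteq> j" | j a where "s = Inr (j, a)" "j \<noteq> 0" "a \<in> carrier R"
    using H by (auto simp: factor_set_def)
  then show ?thesis
  proof cases
    case 1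
    then show ?thesis using b elem_mat_GL[of i j b]
      by (auto simp: word_eval_def rf_one rf_add fun_eq_iff elem_mat_def id_mat_def unit_mat_def)
  next
    case 2
    then have "word_eval (GL R) (elem_mat R) (factor_word R s b) =
        elem_mat R (0, j, a) \<otimes>\<^bsub>Q\<^esub> (elem_mat R (j, 0, b) \<otimes>\<^bsub>Q\<^esub> elem_mat R (0, j, \<ominus> a))"
      using elem_mat_GL[of 0 j "\<ominus> a"] by (simp add: word_eval_def flip: GL_mult)
    also have "\<dots> = \<one>\<^bsub>Q\<^esub> \<oplus>\<^bsub>Q\<^esub> factor_lin R s b"
      using 2 b by (simp add: elem_mat_mult elem_mat_entry)
        (auto simp: fun_eq_iff rf_one rf_add elem_mat_def id_mat_def conj_mat_def r_distr r_minus
          m_assoc a_ac l_neg r_neg r_neg1 r_neg2)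
    finally show ?thesis .
  qed
qed

text \<open>A letter with parameter \<open>b\<close> becomes \<open>x_ij(0) = 1\<close> over
  \<open>S\<close>. In the conjugated factor the outer letters, with parameters \<open>f a\<close>
  and \<open>- f a\<close>, then cancel each other.\<close>

lemma factor_relative_elementary:
  assumes S: "ring S" and f: "f \<in> ring_hom R S" and H: "H \<subseteq> carrier R" and s: "s \<in> factor_set m H"
    and b: "b \<in> carrier R" "f b = \<zero>\<^bsub>S\<^esub>"
  shows "\<one>\<^bsub>Q\<^esub> \<oplus>\<^bsub>Q\<^esub> factor_lin R s b \<in> relative_elementary R S f m"
proof -
  interpret S: ring S by fact
  interpret St: group "Steinberg S" by (rule group_Steinberg)
  interpret h: ring_hom_ring R S f using S f by (intro ring_hom_ringI2 ring_axioms)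
  have fc: "f \<in> carrier R \<rightarrow> carrier S" by auto
  have single: "pres_class (st_gens S) (st_rels S) [((i, j, r), True)] = st_elem S i j r" for i j r
    by (simp add: st_elem_def)
  from s consider i j where "s = Inl (i, j)" "i \<noteq> j" | j a where "s = Inr (j, a)" "j \<noteq> 0" "a \<in> carrier R"
    using H by (auto simp: factor_set_def)
  then have "pres_class (st_gens S) (st_rels S) (wmap f (factor_word R s b)) = \<one>\<^bsub>Steinberg S\<^esub>"
  proof cases
    case 1
    then show ?thesis using st_elem_zero[OF S, of i j] b by (simp add: single)
  next
    case 2
    have w: "[((0, j, r), True)] \<in> words (st_gens R)" "[((j, 0, r), True)] \<in> words (st_gens R)"
      if "r \<in> carrier R" for r using that 2 by (auto simp: words_def st_gens_def)
    have "pres_class (st_gens S) (st_rels S) (wmap f (factor_word R s b)) =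
        pres_class (st_gens S) (st_rels S)
          (wmap f ([((0, j, a), True)] @ [((j, 0, b), True)] @ [((0, j, \<ominus> a), True)]))"
      using 2 by simp
    also have "\<dots> = st_elem S 0 j (f a) \<otimes>\<^bsub>Steinberg S\<^esub> (st_elem S j 0 (f b) \<otimes>\<^bsub>Steinberg S\<^esub> st_elem S 0 j (f (\<ominus> a)))"
      using 2 b w by (simp only: pres_class_wmap_append[OF fc] words_append a_inv_closed)
        (simp add: single)
    also have "\<dots> = st_elem S 0 j (f a) \<otimes>\<^bsub>Steinberg S\<^esub> st_elem S 0 j (\<ominus>\<^bsub>S\<^esub> f a)"
      using 2 b st_elem_zero[OF S, of j 0] st_elem_closed[of 0 j "\<ominus>\<^bsub>S\<^esub> f a" S] by simp
    also have "\<dots> = st_elem S 0 j \<zero>\<^bsub>S\<^esub>"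
      using 2 by (subst st_elem_add) (auto simp: S.r_neg)
    also have "\<dots> = \<one>\<^bsub>Steinberg S\<^esub>" using 2 by (intro st_elem_zero[OF S]) simp
    finally show ?thesis .
  qed
  then show ?thesis
    using factor_word_bounded[OF H s b(1)] word_eval_factor_word[OF H s b(1)]
    unfolding relative_elementary_def by (metis (mono_tags, lifting) image_eqI mem_Collect_eq)
qed

lemma finsum_a_inv:
  "finite S \<Longrightarrow> (\<And>s. s \<in> S \<Longrightarrow> f s \<in> carrier R) \<Longrightarrow> (\<Oplus>s\<in>S. \<ominus> f s) = \<ominus> finsum R f S"
proof (induction S rule: finite_induct)
  case (insert s S)
  then show ?case by (simp add: Pi_def minus_add)
qed simp

text \<open>Trace zero matrices are spanned by the linear parts of the factors: off the diagonal this is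
  clear, \<open>Y\<^sub>j\<^sub>j\<close> is moved to the corner by \<open>Inr (j, \<one>)\<close>, and there remains the trace.\<close>

lemma factor_set_span:
  assumes H: "finite H" "H \<subseteq> carrier R" "\<one> \<in> H" and m: "m > 1"
    and Y: "\<And>i j. Y i j \<in> carrier R" "\<And>i j. i \<ge> m \<or> j \<ge> m \<Longrightarrow> Y i j = \<zero>"
    and c: "\<And>h. c h \<in> carrier R"
    and trace: "(\<Oplus>h\<in>H. h \<otimes> c h) = (\<Oplus>i\<in>{..<m}. Y i i)"
    and ch: "ncong R N (\<Oplus>h\<in>H. c h \<otimes> h) \<zero>"
  shows "\<exists>d\<in>factor_set m H \<rightarrow> carrier R. ncong Q N Y (\<Oplus>\<^bsub>Q\<^esub>s\<in>factor_set m H. factor_lin R s (d s))"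
proof -
  interpret rf: ring Q by (rule ring_rf)
  have Hc: "h \<in> H \<Longrightarrow> h \<in> carrier R" for h using H by blast
  define \<beta> where "\<beta> j h = (if j = 1 then c h else \<zero>) \<oplus> (if h = \<one> then \<ominus> Y j j else \<zero>)" for j :: nat and h
  have \<beta>: "\<beta> j h \<in> carrier R" for j h using c Y by (simp add: \<beta>_def)
  let ?t = "\<Oplus>i\<in>{..<m}. Y i i"
  have t: "?t \<in> carrier R" using Y by (auto intro: finsum_closed)
  obtain z where z: "z \<in> carrier R" "(\<Oplus>h\<in>H. c h \<otimes> h) = \<zero> \<oplus> [N] \<cdot> z" using ch by (rule ncongE)
  have one_sum: "(\<Oplus>h\<in>H. (if h = \<one> then \<ominus> Y j j else \<zero>)) = \<ominus> Y j j" for j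
    using H Y by (subst finsum_single[of _ \<one>]) auto
  have left: "(\<Oplus>h\<in>H. h \<otimes> \<beta> j h) = (if j = 1 then ?t else \<zero>) \<oplus> \<ominus> Y j j" for j
  proof -
    have "(\<Oplus>h\<in>H. h \<otimes> \<beta> j h) = (\<Oplus>h\<in>H. (if j = 1 then h \<otimes> c h else \<zero>) \<oplus> (if h = \<one> then \<ominus> Y j j else \<zero>))"
      by (rule finsum_cong') (use Hc c Y in \<open>auto simp: \<beta>_def r_distr\<close>)
    also have "\<dots> = (\<Oplus>h\<in>H. if j = 1 then h \<otimes> c h else \<zero>) \<oplus> (\<Oplus>h\<in>H. if h = \<one> then \<ominus> Y j j else \<zero>)"
      by (rule finsum_addf) (use Hc c Y in auto)
    finally show ?thesis unfolding one_sum by (simp add: trace)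
  qed
  have right: "(\<Oplus>h\<in>H. \<beta> j h \<otimes> h) = (if j = 1 then [N] \<cdot> z else \<zero>) \<oplus> \<ominus> Y j j" for j
  proof -
    have "(\<Oplus>h\<in>H. \<beta> j h \<otimes> h) = (\<Oplus>h\<in>H. (if j = 1 then c h \<otimes> h else \<zero>) \<oplus> (if h = \<one> then \<ominus> Y j j else \<zero>))"
      by (rule finsum_cong') (use Hc c Y in \<open>auto simp: \<beta>_def l_distr\<close>)
    also have "\<dots> = (\<Oplus>h\<in>H. if j = 1 then c h \<otimes> h else \<zero>) \<oplus> (\<Oplus>h\<in>H. if h = \<one> then \<ominus> Y j j else \<zero>)"
      by (rule finsum_addf) (use Hc c Y in auto)
    finally show ?thesis unfolding one_sum using z by simp
  qed
  \<comment> \<open>\<open>D\<close> collects the conjugated factors. Its diagonal is right up to a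
    multiple of \<open>N\<close>; its off-diagonal entries are corrected by giving the factors
    \<open>Inl (i, j)\<close> the parameters \<open>Y i j - D i j\<close>.\<close>
  define D where "D k l = (\<Oplus>j\<in>{1..<m}. \<Oplus>h\<in>H. conj_mat R j h (\<beta> j h) k l)" for k l
  have cm: "conj_mat R j h (\<beta> j h) k l \<in> carrier R" if "h \<in> H" for j h k l
    using conj_mat_rf[OF Hc[OF that] \<beta>] by simp
  have D: "D k l \<in> carrier R" for k l unfolding D_def using cm by (auto intro!: finsum_closed)
  have D_out: "D k l = \<zero>" if "k \<ge> m \<or> l \<ge> m" for k l
  proof -
    have "D k l = (\<Oplus>j\<in>{1..<m}. \<Oplus>h\<in>H. \<zero>)"
      unfolding D_def using that m by (intro finsum_cong' refl) (auto simp: conj_mat_def)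
    then show ?thesis by simp
  qed
  have D_diag: "D j j = (if j = 1 then \<ominus> ([N] \<cdot> z) else \<zero>) \<oplus> Y j j" if j: "j \<in> {1..<m}" for j
  proof -
    have "D j j = (\<Oplus>h\<in>H. conj_mat R j h (\<beta> j h) j j)"
      unfolding D_def
    proof (rule finsum_single[OF _ j])
      fix j' assume "j' \<in> {1..<m}" "j' \<noteq> j"
      then have "(\<Oplus>h\<in>H. conj_mat R j' h (\<beta> j' h) j j) = (\<Oplus>h\<in>H. \<zero>)"
        using j by (intro finsum_cong' refl) (auto simp: conj_mat_def)
      then show "(\<Oplus>h\<in>H. conj_mat R j' h (\<beta> j' h) j j) = \<zero>" by simp
    qed (use cm in \<open>auto intro!: finsum_closed\<close>)
    also have "\<dots> = (\<Oplus>h\<in>H. \<ominus> (\<beta> j h \<otimes> h))"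
      using j Hc \<beta> by (intro finsum_cong' refl) (auto simp: conj_mat_def)
    also have "\<dots> = \<ominus> ((if j = 1 then [N] \<cdot> z else \<zero>) \<oplus> \<ominus> Y j j)"
      using H(1) Hc \<beta> by (subst finsum_a_inv) (auto simp: right)
    finally show ?thesis using z Y by (simp add: minus_add)
  qed
  have D_00: "D 0 0 = Y 0 0"
  proof -
    have "D 0 0 = (\<Oplus>j\<in>{1..<m}. (if j = 1 then ?t else \<zero>) \<oplus> \<ominus> Y j j)"
      unfolding D_def left[symmetric] using Hc \<beta>
      by (intro finsum_cong' refl) (auto simp: conj_mat_def intro!: finsum_closed)
    also have "\<dots> = (\<Oplus>j\<in>{1..<m}. if j = 1 then ?t else \<zero>) \<oplus> (\<Oplus>j\<in>{1..<m}. \<ominus> Y j j)"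
      by (rule finsum_addf) (use t Y in auto)
    also have "(\<Oplus>j\<in>{1..<m}. if j = 1 then ?t else \<zero>) = ?t"
      using m t by (subst finsum_single[of _ 1]) auto
    also have "(\<Oplus>j\<in>{1..<m}. \<ominus> Y j j) = \<ominus> (\<Oplus>j\<in>{1..<m}. Y j j)"
      using Y by (intro finsum_a_inv) auto
    also have "?t = Y 0 0 \<oplus> (\<Oplus>j\<in>{1..<m}. Y j j)"
    proof -
      have "{..<m} = insert 0 {1..<m}" using m by auto
      then show ?thesis using Y by (simp add: Pi_def)
    qed
    finally show ?thesis using Y by (simp add: a_assoc r_neg finsum_closed)
  qed
  define d where "d s = (case s of Inl (i, j) \<Rightarrow> Y i j \<oplus> \<ominus> D i j | Inr (j, h) \<Rightarrow> \<beta> j h)" for s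
  have d: "d s \<in> carrier R" for s using Y D \<beta> by (auto simp: d_def split: sum.split)
  let ?X = "\<Oplus>\<^bsub>Q\<^esub>s\<in>factor_set m H. factor_lin R s (d s)"
  have fl: "factor_lin R s (d s) \<in> carrier Q" if "s \<in> factor_set m H" for s
    using factor_lin_closed[OF H(2) that d] .
  have X: "?X \<in> carrier Q" using fl by (auto intro: rf.finsum_closed)
  let ?P = "{(i, j). i \<noteq> j \<and> i < m \<and> j < m}"
  have P: "finite ?P" by (rule finite_subset[of _ "{..<m} \<times> {..<m}"]) auto
  have X_entry: "?X k l = (if k \<noteq> l \<and> k < m \<and> l < m then Y k l \<oplus> \<ominus> D k l else \<zero>) \<oplus> D k l" for k l
  proof -
    have "?X k l = (\<Oplus>s\<in>factor_set m H. factor_lin R s (d s) k l)"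
      using finite_factor_set[OF H(1)] fl by (rule rf_finsum)
    also have "\<dots> = (\<Oplus>s\<in>Inl ` ?P. factor_lin R s (d s) k l) \<oplus> (\<Oplus>s\<in>Inr ` ({1..<m} \<times> H). factor_lin R s (d s) k l)"
      unfolding factor_set_def
      by (rule finsum_Un_disjoint) (use P H(1) fl in \<open>auto simp: factor_set_def\<close>)
    also have "(\<Oplus>s\<in>Inl ` ?P. factor_lin R s (d s) k l) =
        (\<Oplus>q\<in>?P. factor_lin R (Inl q) (d (Inl q)) k l)"
      by (rule finsum_reindex) (use fl in \<open>auto simp: factor_set_def\<close>)
    also have "\<dots> = (if k \<noteq> l \<and> k < m \<and> l < m then Y k l \<oplus> \<ominus> D k l else \<zero>)"
    proof (cases "(k, l) \<in> ?P")
      case True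
      have "(\<Oplus>q\<in>?P. factor_lin R (Inl q) (d (Inl q)) k l) = factor_lin R (Inl (k, l)) (d (Inl (k, l))) k l"
        by (rule finsum_single[OF P True]) (use Y D in \<open>auto simp: unit_mat_def d_def split: if_splits\<close>)
      then show ?thesis using True by (simp add: unit_mat_def d_def)
    next
      case False
      have "(\<Oplus>q\<in>?P. factor_lin R (Inl q) (d (Inl q)) k l) = (\<Oplus>q\<in>?P. \<zero>)"
        by (rule finsum_cong') (use False in \<open>auto simp: unit_mat_def\<close>)
      then show ?thesis using False by auto
    qed
    also have "(\<Oplus>s\<in>Inr ` ({1..<m} \<times> H). factor_lin R s (d s) k l) =
        (\<Oplus>q\<in>{1..<m} \<times> H. factor_lin R (Inr q) (d (Inr q)) k l)"
      by (rule finsum_reindex) (use fl in \<open>auto simp: factor_set_def\<close>)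
    also have "\<dots> = finsum R (\<lambda>(j, h). conj_mat R j h (\<beta> j h) k l) ({1..<m} \<times> H)"
      by (rule finsum_cong') (use cm in \<open>auto simp: d_def\<close>)
    also have "\<dots> = D k l"
      unfolding D_def by (rule finsum_Sigma'[symmetric]) (use H(1) cm in auto)
    finally show ?thesis .
  qed
  have "Y = ?X \<oplus>\<^bsub>Q\<^esub> [N] \<cdot>\<^bsub>Q\<^esub> unit_mat R 1 1 z"
  proof (intro ext)
    fix k l
    have "Y k l = ((if k \<noteq> l \<and> k < m \<and> l < m then Y k l \<oplus> \<ominus> D k l else \<zero>) \<oplus> D k l) \<oplus> [N] \<cdot> unit_mat R 1 1 z k l"
    proof (cases "k < m \<and> l < m")
      case False
      then show ?thesis using Y(2)[of k l] D_out[of k l] m by (auto simp: unit_mat_def)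
    next
      case True
      show ?thesis
      proof (cases "k = l")
        case True
        show ?thesis
        proof (cases "k = 0")
          case True
          then show ?thesis using \<open>k = l\<close> Y D_00 by (simp add: unit_mat_def)
        next
          case False
          then have "k \<in> {1..<m}" using \<open>k < m \<and> l < m\<close> by simp
          from D_diag[OF this] show ?thesis using \<open>k = l\<close> Y z(1)
            by (simp add: unit_mat_def a_ac r_neg r_neg1 r_neg2)
        qed
      next
        case False
        then show ?thesis using True Y D by (auto simp: unit_mat_def a_assoc l_neg)
      qed
    qed
    then show "Y k l = (?X \<oplus>\<^bsub>Q\<^esub> [N] \<cdot>\<^bsub>Q\<^esub> unit_mat R 1 1 z) k l"
      using rf_add[of ?X] rf_add_pow[OF unit_mat_rf[OF z(1)]] X_entry by metis
  qed
  then have "ncong Q N Y ?X" by (rule rf.ncongI[OF unit_mat_rf[OF z(1)]])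
  then show ?thesis using d by (intro bexI[of _ d]) auto
qed

end

section \<open>Completeness and the characteristic\<close>

context cring
begin

lemma p_ideal_eq: "p_ideal R p n = (\<lambda>r. [(p ^ n)] \<cdot> r) ` carrier R"
proof -
  have "r \<otimes> ([(p ^ n)] \<cdot> \<one>) = [(p ^ n)] \<cdot> r" if "r \<in> carrier R" for r
    using that by (simp add: add_pow_rdistr)
  then have "p_ideal R p n = {[(p ^ n)] \<cdot> r | r. r \<in> carrier R}"
    unfolding p_ideal_def cgenideal_def by metis
  then show ?thesis by blast
qed

lemma p_ideal_ideal: "ideal (p_ideal R p n) R"
  unfolding p_ideal_def by (rule cgenideal_ideal) simp

lemma p_proj_eq: "a \<in> carrier R \<Longrightarrow> p_proj R p n a = {x. ncong R (p ^ n) x a}"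
  by (auto simp: p_proj_def p_ideal_eq a_r_coset_def' ncong_def a_comm)

lemma p_proj_eq_iff:
  assumes "a \<in> carrier R" "b \<in> carrier R"
  shows "p_proj R p n a = p_proj R p n b \<longleftrightarrow> ncong R (p ^ n) a b"
proof
  assume "p_proj R p n a = p_proj R p n b"
  moreover have "a \<in> p_proj R p n a" using assms by (simp add: p_proj_eq)
  ultimately show "ncong R (p ^ n) a b" using assms by (simp add: p_proj_eq)
next
  assume ab: "ncong R (p ^ n) a b"
  have "ncong R (p ^ n) x a \<longleftrightarrow> ncong R (p ^ n) x b" for x
    using ncong_trans[OF _ ab assms(2)] ncong_trans[OF _ ncong_sym[OF ab assms(2)] assms(1)] by blast
  then show "p_proj R p n a = p_proj R p n b" using assms by (simp add: p_proj_eq)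
qed

lemma p_quot_carrier: "carrier (p_quot R p n) = p_proj R p n ` carrier R"
  by (auto simp: p_quot_def FactRing_def A_RCOSETS_def' p_proj_def)

lemma p_proj_hom: "p_proj R p n \<in> ring_hom R (p_quot R p n)"
proof -
  have "p_proj R p n = (+>) (p_ideal R p n)" by (simp add: fun_eq_iff p_proj_def)
  then show ?thesis
    unfolding p_quot_def using ideal.rcos_ring_hom[OF p_ideal_ideal, of p n] by simp
qed

lemma cring_p_quot: "cring (p_quot R p n)"
  unfolding p_quot_def by (rule ideal.quotient_is_cring[OF p_ideal_ideal cring_axioms])

lemma p_trans_p_proj:
  assumes "r \<in> carrier R"
  shows "p_trans R p n (p_proj R p (Suc n) r) = p_proj R p n r"
proof (intro equalityI subsetI)
  fix x assume "x \<in> p_trans R p n (p_proj R p (Suc n) r)"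
  then obtain z y where z: "z \<in> carrier R" "ncong R (p ^ Suc n) y r" "x = [(p ^ n)] \<cdot> z \<oplus> y"
    using assms by (auto simp: p_trans_def set_add_def' p_ideal_eq p_proj_eq)
  obtain w where w: "w \<in> carrier R" "y = r \<oplus> [(p ^ Suc n)] \<cdot> w" using z(2) by (rule ncongE)
  have "ncong R (p ^ n) x y" using z w assms by (intro ncongI[of z]) (auto simp: a_comm)
  moreover have "ncong R (p ^ n) y r" using ncong_dvd[OF z(2)] by simp
  ultimately have "ncong R (p ^ n) x r" using assms by (rule ncong_trans)
  then show "x \<in> p_proj R p n r" using assms by (simp add: p_proj_eq)
next
  fix x assume "x \<in> p_proj R p n r"
  then obtain z where z: "z \<in> carrier R" "x = r \<oplus> [(p ^ n)] \<cdot> z"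
    using assms by (auto simp: p_proj_eq ncong_def)
  then have "x = [(p ^ n)] \<cdot> z \<oplus> r" using assms by (simp add: a_comm)
  moreover have "r \<in> p_proj R p (Suc n) r" using assms by (simp add: p_proj_eq)
  moreover have "[(p ^ n)] \<cdot> z \<in> p_ideal R p n" using z(1) by (simp add: p_ideal_eq)
  ultimately show "x \<in> p_trans R p n (p_proj R p (Suc n) r)"
    unfolding p_trans_def set_add_def' by blast
qed

text \<open>Surjectivity of the natural map to the inverse limit: the cosets of the
  \<open>x k\<close> are compatible with the transition maps, and an element above this point of the
  limit is the required \<open>y\<close>.\<close>

lemma p_adic_limit:
  assumes "p_adically_complete p R" "\<And>k. x k \<in> carrier R" "\<And>k. ncong R (p ^ k) (x (Suc k)) (x k)"
  shows "\<exists>y\<in>carrier R. \<forall>k. ncong R (p ^ k) y (x k)"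
proof -
  have "p_trans R p k (p_proj R p (Suc k) (x (Suc k))) = p_proj R p k (x k)" for k
    using assms(2,3) by (simp add: p_trans_p_proj p_proj_eq_iff)
  then have "(\<lambda>k. p_proj R p k (x k)) \<in> carrier (p_limit R p)"
    using assms(2) by (simp add: p_limit_def p_quot_carrier)
  moreover have "bij_betw (\<lambda>r n. p_proj R p n r) (carrier R) (carrier (p_limit R p))"
    using assms(1) by (simp add: p_adically_complete_def ring_iso_def)
  ultimately have "(\<lambda>k. p_proj R p k (x k)) \<in> (\<lambda>r n. p_proj R p n r) ` carrier R"
    using bij_betw_imp_surj_on by blast
  then obtain y where y: "y \<in> carrier R" "(\<lambda>k. p_proj R p k (x k)) = (\<lambda>n. p_proj R p n y)" by blast
  have "ncong R (p ^ k) y (x k)" for k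
    using fun_cong[OF y(2), of k] p_proj_eq_iff[OF y(1) assms(2)] by metis
  then show ?thesis using y(1) by blast
qed

text \<open>Injectivity of the natural map to the inverse limit, since congruence modulo every
  \<open>p ^ k\<close> means equal cosets at every level.\<close>

lemma p_adic_separated:
  assumes "p_adically_complete p R" "x \<in> carrier R" "y \<in> carrier R" "\<And>k. ncong R (p ^ k) x y"
  shows "x = y"
proof -
  have "inj_on (\<lambda>r n. p_proj R p n r) (carrier R)"
    using assms(1) by (simp add: p_adically_complete_def ring_iso_def bij_betw_def)
  moreover have "(\<lambda>n. p_proj R p n x) = (\<lambda>n. p_proj R p n y)"
    using p_proj_eq_iff[OF assms(2,3)] assms(4) by blast
  ultimately show ?thesis using assms(2,3) by (auto dest: inj_onD)
qed

end

context domain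
begin

lemma frac_rel_iff:
  "((a, b), (c, d)) \<in> frac_rel R \<longleftrightarrow> a \<in> carrier R \<and> b \<in> carrier R - {\<zero>} \<and> c \<in> carrier R \<and>
    d \<in> carrier R - {\<zero>} \<and> a \<otimes> d = c \<otimes> b"
  by (simp add: frac_rel_def)

lemma frac_cancel:
  assumes u: "u \<in> carrier R" and e: "e \<in> carrier R" "e \<noteq> \<zero>"
  shows "frac R (u \<otimes> e) e = frac R u \<one>"
proof -
  have "u \<otimes> e \<otimes> d = c \<otimes> e \<longleftrightarrow> u \<otimes> d = c" if "c \<in> carrier R" "d \<in> carrier R" for c d
  proof -
    have "u \<otimes> e \<otimes> d = (u \<otimes> d) \<otimes> e" using u e that by (simp add: m_ac)
    then show ?thesis using m_rcancel[of e "u \<otimes> d" c] u e that by simp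
  qed
  then show ?thesis using u e by (auto simp: frac_def frac_rel_iff)
qed

text \<open>Addition in \<open>frac_field\<close> takes a union over all representatives. Those of
  \<open>r / 1\<close> are the pairs \<open>(r b, b)\<close> with \<open>b \<noteq> 0\<close>, and
  by \<open>frac_cancel\<close> all of them lead to the same class, so the union is that
  class.\<close>

lemma frac_add_one:
  assumes r: "r \<in> carrier R"
  shows "frac R r \<one> \<oplus>\<^bsub>frac_field R\<^esub> frac R \<one> \<one> = frac R (r \<oplus> \<one>) \<one>"
proof -
  have eq: "frac R (a \<otimes> d \<oplus> c \<otimes> b) (b \<otimes> d) = frac R (r \<oplus> \<one>) \<one>"
    if "(a, b) \<in> frac R r \<one>" "(c, d) \<in> frac R \<one> \<one>" for a b c d
  proof -
    have ab: "b \<in> carrier R" "b \<noteq> \<zero>" "a = r \<otimes> b" and cd: "d \<in> carrier R" "d \<noteq> \<zero>" "c = d"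
      using that by (auto simp: frac_def frac_rel_iff)
    have "a \<otimes> d \<oplus> c \<otimes> b = (r \<oplus> \<one>) \<otimes> (b \<otimes> d)"
      using ab cd r by (simp add: l_distr r_distr m_ac)
    moreover have "b \<otimes> d \<noteq> \<zero>" using ab cd integral by blast
    ultimately show ?thesis using frac_cancel[of "r \<oplus> \<one>" "b \<otimes> d"] ab cd r by simp
  qed
  have "(r, \<one>) \<in> frac R r \<one>" "(\<one>, \<one>) \<in> frac R \<one> \<one>" using r by (auto simp: frac_def frac_rel_iff)
  then have ne: "frac R r \<one> \<noteq> {}" "frac R \<one> \<one> \<noteq> {}" by auto
  have "(\<Union>(a, b)\<in>frac R r \<one>. \<Union>(c, d)\<in>frac R \<one> \<one>. frac R (a \<otimes> d \<oplus> c \<otimes> b) (b \<otimes> d)) =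
      (\<Union>x\<in>frac R r \<one>. \<Union>y\<in>frac R \<one> \<one>. frac R (r \<oplus> \<one>) \<one>)"
  proof (rule SUP_cong[OF refl])
    fix x assume x: "x \<in> frac R r \<one>"
    obtain a b where ab: "x = (a, b)" by (cases x)
    have "(\<Union>(c, d)\<in>frac R \<one> \<one>. frac R (a \<otimes> d \<oplus> c \<otimes> b) (b \<otimes> d)) =
        (\<Union>y\<in>frac R \<one> \<one>. frac R (r \<oplus> \<one>) \<one>)"
      by (rule SUP_cong[OF refl]) (use eq x ab in \<open>auto simp only: split_paired_all case_prod_conv\<close>)
    then show "(case x of (a, b) \<Rightarrow> \<Union>(c, d)\<in>frac R \<one> \<one>. frac R (a \<otimes> d \<oplus> c \<otimes> b) (b \<otimes> d)) =
        (\<Union>y\<in>frac R \<one> \<one>. frac R (r \<oplus> \<one>) \<one>)"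
      unfolding ab by simp
  qed
  also have "\<dots> = frac R (r \<oplus> \<one>) \<one>" using ne by simp
  finally show ?thesis by (simp add: frac_field_def)
qed

text \<open>In a domain, \<open>[N] x = 0\<close> with \<open>x \<noteq> 0\<close> forces
  \<open>[N] 1 = 0\<close>. The multiples of 1 in the fraction field are the fractions
  \<open>[k] 1 / 1\<close>, so \<open>ring_char\<close>, which is 0, would divide the positive
  number \<open>N\<close>.\<close>

lemma torsion_free_of_ring_char:
  assumes "ring_char (frac_field R) = 0" "N > (0::nat)" "x \<in> carrier R" "[N] \<cdot> x = \<zero>"
  shows "x = \<zero>"
proof (rule ccontr)
  assume "x \<noteq> \<zero>"
  have "([N] \<cdot> \<one>) \<otimes> x = \<zero>" using assms(3,4) by (simp add: add_pow_ldistr)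
  then have N: "[N] \<cdot> \<one> = \<zero>" using integral[of "[N] \<cdot> \<one>" x] assms(3) \<open>x \<noteq> \<zero>\<close> by auto
  have frac: "[k] \<cdot>\<^bsub>frac_field R\<^esub> \<one>\<^bsub>frac_field R\<^esub> = frac R ([k] \<cdot> \<one>) \<one>" for k :: nat
  proof (induction k)
    case 0
    show ?case by (simp add: add_pow_def nat_pow_def frac_field_def)
  next
    case (Suc k)
    have "[Suc k] \<cdot>\<^bsub>frac_field R\<^esub> \<one>\<^bsub>frac_field R\<^esub> =
        [k] \<cdot>\<^bsub>frac_field R\<^esub> \<one>\<^bsub>frac_field R\<^esub> \<oplus>\<^bsub>frac_field R\<^esub> \<one>\<^bsub>frac_field R\<^esub>"
      by (simp add: add_pow_def nat_pow_def)
    also have "\<dots> = frac R ([k] \<cdot> \<one> \<oplus> \<one>) \<one>"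
      using Suc frac_add_one[of "[k] \<cdot> \<one>"] by (simp add: frac_field_def)
    finally show ?case by simp
  qed
  have "[N] \<cdot>\<^bsub>frac_field R\<^esub> \<one>\<^bsub>frac_field R\<^esub> = \<zero>\<^bsub>frac_field R\<^esub>"
    unfolding frac N by (simp add: frac_field_def)
  then have "ring_char (frac_field R) dvd N" unfolding ring_char_def by (intro Gcd_dvd) simp
  then show False using assms(1,2) by simp
qed

end

section \<open>Reduction of group rings\<close>

lemma group_ring_map_hom:
  assumes "cring R" "cring S" "group G" "finite (carrier G)" "h \<in> ring_hom R S"
  shows "group_ring_map G h \<in> ring_hom (group_ring R G) (group_ring S G)"
proof -
  interpret R: cring R by fact
  interpret S: cring S by fact
  interpret G: group G by fact
  interpret h: ring_hom_cring R S h by unfold_locales fact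
  interpret RG: finite_group_ring R G by unfold_locales fact
  interpret SG: finite_group_ring S G by unfold_locales fact
  let ?f = "group_ring_map G h"
  have f: "?f a \<in> carrier SG.A" if "a \<in> carrier RG.A" for a
    using that by (auto simp: group_ring_map_def group_ring_carrier)
  have fx: "?f a x = h (a x)" if "x \<in> carrier G" for a x
    using that by (simp add: group_ring_map_def)
  show ?thesis
  proof (rule ring_hom_memI)
    fix a b assume a: "a \<in> carrier RG.A" and b: "b \<in> carrier RG.A"
    show "?f (a \<oplus>\<^bsub>RG.A\<^esub> b) = ?f a \<oplus>\<^bsub>SG.A\<^esub> ?f b"
      by (rule group_ring_eqI[of _ S G]) (use a b f in \<open>simp_all add: fx group_ring_add\<close>)
    show "?f (a \<otimes>\<^bsub>RG.A\<^esub> b) = ?f a \<otimes>\<^bsub>SG.A\<^esub> ?f b"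
    proof (rule group_ring_eqI[of _ S G])
      fix x assume x: "x \<in> carrier G"
      have "?f (a \<otimes>\<^bsub>RG.A\<^esub> b) x = (\<Oplus>\<^bsub>S\<^esub>y\<in>carrier G. h (a y \<otimes>\<^bsub>R\<^esub> b (inv\<^bsub>G\<^esub> y \<otimes>\<^bsub>G\<^esub> x)))"
        using a b x by (simp add: fx group_ring_mult Pi_def o_def)
      also have "\<dots> = (?f a \<otimes>\<^bsub>SG.A\<^esub> ?f b) x"
        unfolding group_ring_mult[OF x] using a b x f
        by (intro S.finsum_cong') (auto simp: fx)
      finally show "?f (a \<otimes>\<^bsub>RG.A\<^esub> b) x = (?f a \<otimes>\<^bsub>SG.A\<^esub> ?f b) x" .
    qed (use a b f in auto)
  next
    show "?f \<one>\<^bsub>RG.A\<^esub> = \<one>\<^bsub>SG.A\<^esub>"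
      by (rule group_ring_eqI[of _ S G]) (use f in \<open>auto simp: fx group_ring_one\<close>)
  qed (rule f)
qed

lemma group_ring_map_surj:
  assumes "h ` carrier R = carrier S"
  shows "group_ring_map G h ` carrier (group_ring R G) = carrier (group_ring S G)"
proof (intro equalityI subsetI)
  fix b assume b: "b \<in> carrier (group_ring S G)"
  have "\<exists>r. r \<in> carrier R \<and> h r = b x" if "x \<in> carrier G" for x
  proof -
    have "b x \<in> h ` carrier R" using b that assms by simp
    then show ?thesis by auto
  qed
  then obtain a where a: "\<And>x. x \<in> carrier G \<Longrightarrow> a x \<in> carrier R \<and> h (a x) = b x" by metis
  have "group_ring_map G h (restrict a (carrier G)) = b"
    using a b by (auto simp: group_ring_map_def group_ring_carrier fun_eq_iff PiE_iff extensional_def)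
  moreover have "restrict a (carrier G) \<in> carrier (group_ring R G)"
    using a by (simp add: group_ring_carrier)
  ultimately show "b \<in> group_ring_map G h ` carrier (group_ring R G)" by blast
qed (use assms in \<open>auto simp: group_ring_map_def group_ring_carrier\<close>)

context finite_group_ring
begin

lemma ncong_group_ring_iff:
  assumes "a \<in> carrier A" "b \<in> carrier A"
  shows "ncong A N a b \<longleftrightarrow> (\<forall>x\<in>carrier G. ncong R N (a x) (b x))"
proof
  assume "ncong A N a b"
  then obtain z where z: "z \<in> carrier A" "a = b \<oplus>\<^bsub>A\<^esub> [N] \<cdot>\<^bsub>A\<^esub> z" by (rule A.ncongE)
  then show "\<forall>x\<in>carrier G. ncong R N (a x) (b x)"
    using assms by (auto simp: group_ring_add group_ring_add_pow intro: R.ncong_add_pow)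
next
  assume "\<forall>x\<in>carrier G. ncong R N (a x) (b x)"
  then obtain z where z: "\<And>x. x \<in> carrier G \<Longrightarrow> z x \<in> carrier R \<and> a x = b x \<oplus>\<^bsub>R\<^esub> [N] \<cdot>\<^bsub>R\<^esub> z x"
    unfolding ncong_def by metis
  have zA: "restrict z (carrier G) \<in> carrier A" using z by (simp add: group_ring_carrier)
  have "a = b \<oplus>\<^bsub>A\<^esub> [N] \<cdot>\<^bsub>A\<^esub> restrict z (carrier G)"
  proof (rule group_ring_eqI[of _ R G])
    fix x assume x: "x \<in> carrier G"
    then show "a x = (b \<oplus>\<^bsub>A\<^esub> [N] \<cdot>\<^bsub>A\<^esub> restrict z (carrier G)) x"
      using z[OF x] by (simp only: group_ring_add[OF x] group_ring_add_pow[OF zA x] restrict_apply')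
  qed (use assms zA in auto)
  then show "ncong A N a b" by (rule A.ncongI[OF zA])
qed

lemma inj_single: "\<one>\<^bsub>R\<^esub> \<noteq> \<zero>\<^bsub>R\<^esub> \<Longrightarrow> inj_on single (carrier G)"
proof (rule inj_onI)
  fix x y assume one: "\<one>\<^bsub>R\<^esub> \<noteq> \<zero>\<^bsub>R\<^esub>" and x: "x \<in> carrier G" and "single x = single y"
  then have "single x x = single y x" by simp
  then show "x = y" using one x by (simp add: single_def split: if_splits)
qed

text \<open>Conjugacy class representatives write \<open>a\<close>, up to its class sums, as the difference of
  \<open>\<Sum> h c\<^sub>h\<close> and \<open>\<Sum> c\<^sub>h h\<close>, hence as a sum of commutators.\<close>

lemma class_decomposition:
  assumes a: "a \<in> carrier A"
    and K: "\<And>g. g \<in> carrier G \<Longrightarrow> ncong R N (\<Oplus>\<^bsub>R\<^esub>y\<in>conj_class G g. a y) \<zero>\<^bsub>R\<^esub>"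
  shows "\<exists>c. (\<forall>h\<in>carrier G. c h \<in> carrier A) \<and> (\<Oplus>\<^bsub>A\<^esub>h\<in>carrier G. single h \<otimes>\<^bsub>A\<^esub> c h) = a \<and>
    ncong A N (\<Oplus>\<^bsub>A\<^esub>h\<in>carrier G. c h \<otimes>\<^bsub>A\<^esub> single h) \<zero>\<^bsub>A\<^esub>"
proof -
  \<comment> \<open>The choice depends on the class as a set, so \<open>rep\<close> is constant on
    conjugacy classes; \<open>t x\<close> is then one fixed element that conjugates
    \<open>rep x\<close> to \<open>x\<close>.\<close>
  define rep where "rep x = (SOME z. z \<in> conj_class G x)" for x
  define t where "t x = (SOME h. h \<in> carrier G \<and> h \<otimes> rep x \<otimes> inv h = x)" for x
  have conj: "conj_class G (h \<otimes> x \<otimes> inv h) \<subseteq> conj_class G x"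
    if "x \<in> carrier G" "h \<in> carrier G" for x h
  proof
    fix y assume "y \<in> conj_class G (h \<otimes> x \<otimes> inv h)"
    then obtain k where k: "k \<in> carrier G" "y = k \<otimes> (h \<otimes> x \<otimes> inv h) \<otimes> inv k"
      by (auto simp: conj_class_def)
    then have "y = (k \<otimes> h) \<otimes> x \<otimes> inv (k \<otimes> h)"
      using that by (simp add: G.inv_mult_group G.m_assoc)
    then show "y \<in> conj_class G x" using k(1) that unfolding conj_class_def by blast
  qed
  have unconj: "inv h \<otimes> (h \<otimes> x \<otimes> inv h) \<otimes> inv (inv h) = x"
    if "x \<in> carrier G" "h \<in> carrier G" for x h
    using that by (simp add: G.m_assoc) (simp add: G.m_assoc[symmetric])
  have conj_eq: "conj_class G (h \<otimes> x \<otimes> inv h) = conj_class G x"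
    if "x \<in> carrier G" "h \<in> carrier G" for x h
    using conj[OF that] conj[of "h \<otimes> x \<otimes> inv h" "inv h"] unconj[OF that] that by simp
  have rep: "rep x \<in> conj_class G x" if "x \<in> carrier G" for x
  proof -
    have "\<exists>z. z \<in> conj_class G x" unfolding conj_class_def using G.one_closed by blast
    then show ?thesis unfolding rep_def by (rule someI_ex)
  qed
  have rep_carrier: "rep x \<in> carrier G" if "x \<in> carrier G" for x
    using rep[OF that] that by (auto simp: conj_class_def)
  have rep_conj: "rep (h \<otimes> x \<otimes> inv h) = rep x" if "x \<in> carrier G" "h \<in> carrier G" for x h
    unfolding rep_def conj_eq[OF that] ..
  have t: "t x \<in> carrier G \<and> t x \<otimes> rep x \<otimes> inv t x = x" if x: "x \<in> carrier G" for x
  proof -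
    obtain h where h: "h \<in> carrier G" "rep x = h \<otimes> x \<otimes> inv h"
      using rep[OF x] by (auto simp: conj_class_def)
    then have "\<exists>k. k \<in> carrier G \<and> k \<otimes> rep x \<otimes> inv k = x"
      using unconj[OF x h(1)] by (intro exI[of _ "inv h"]) simp
    then show ?thesis unfolding t_def by (rule someI_ex)
  qed
  \<comment> \<open>\<open>c h\<close> is \<open>h^-1\<close> times the part of \<open>a\<close>
    supported on the \<open>x\<close> with \<open>t x = h\<close>. Multiplication by
    \<open>h\<close> from the left restores that part, whereas multiplication from the right moves
    its coefficients from \<open>x\<close> to \<open>h^-1 x h = rep x\<close>.\<close>
  define c where "c h = (\<lambda>y\<in>carrier G. if t (h \<otimes> y) = h then a (h \<otimes> y) else \<zero>\<^bsub>R\<^esub>)" for h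
  have c: "c h \<in> carrier A" if "h \<in> carrier G" for h
    using a that unfolding c_def by (subst group_ring_carrier) auto
  have left: "(single h \<otimes>\<^bsub>A\<^esub> c h) x = (if t x = h then a x else \<zero>\<^bsub>R\<^esub>)"
    if "h \<in> carrier G" "x \<in> carrier G" for h x
    using that c by (simp add: single_mult) (simp add: c_def G.m_assoc[symmetric])
  have right: "(c h \<otimes>\<^bsub>A\<^esub> single h) z = (if t (h \<otimes> z \<otimes> inv h) = h
      then a (h \<otimes> z \<otimes> inv h) else \<zero>\<^bsub>R\<^esub>)"
    if "h \<in> carrier G" "z \<in> carrier G" for h z
    using that c by (simp add: mult_single) (simp add: c_def G.m_assoc[symmetric])
  have cl: "single h \<otimes>\<^bsub>A\<^esub> c h \<in> carrier A" "c h \<otimes>\<^bsub>A\<^esub> single h \<in> carrier A" if "h \<in> carrier G" for h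
    using c[OF that] by auto
  have "(\<Oplus>\<^bsub>A\<^esub>h\<in>carrier G. single h \<otimes>\<^bsub>A\<^esub> c h) = a"
  proof (rule group_ring_eqI[of _ R G])
    fix x assume x: "x \<in> carrier G"
    have "(\<Oplus>\<^bsub>A\<^esub>h\<in>carrier G. single h \<otimes>\<^bsub>A\<^esub> c h) x = (\<Oplus>\<^bsub>R\<^esub>h\<in>carrier G. (single h \<otimes>\<^bsub>A\<^esub> c h) x)"
      using fin cl x by (intro group_ring_finsum) auto
    also have "\<dots> = (single (t x) \<otimes>\<^bsub>A\<^esub> c (t x)) x"
      using fin t[OF x] a x left by (intro R.finsum_single) auto
    finally show "(\<Oplus>\<^bsub>A\<^esub>h\<in>carrier G. single h \<otimes>\<^bsub>A\<^esub> c h) x = a x" using left[of "t x" x] t[OF x] x by simp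
  qed (use a cl in \<open>auto intro!: A.finsum_closed\<close>)
  moreover have "ncong A N (\<Oplus>\<^bsub>A\<^esub>h\<in>carrier G. c h \<otimes>\<^bsub>A\<^esub> single h) \<zero>\<^bsub>A\<^esub>"
  proof -
    have "ncong R N ((\<Oplus>\<^bsub>A\<^esub>h\<in>carrier G. c h \<otimes>\<^bsub>A\<^esub> single h) z) (\<zero>\<^bsub>A\<^esub> z)" if z: "z \<in> carrier G" for z
    proof -
      let ?x = "\<lambda>h. h \<otimes> z \<otimes> inv h"
      let ?M = "{h \<in> carrier G. t (?x h) = h}"
      have x: "?x h \<in> carrier G" if "h \<in> carrier G" for h using that z by simp
      have "(\<Oplus>\<^bsub>A\<^esub>h\<in>carrier G. c h \<otimes>\<^bsub>A\<^esub> single h) z = (\<Oplus>\<^bsub>R\<^esub>h\<in>carrier G. (c h \<otimes>\<^bsub>A\<^esub> single h) z)"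
        using fin cl z by (intro group_ring_finsum) auto
      also have "\<dots> = (\<Oplus>\<^bsub>R\<^esub>h\<in>carrier G. if t (?x h) = h then a (?x h) else \<zero>\<^bsub>R\<^esub>)"
        using right a z by (intro R.finsum_cong') auto
      also have "\<dots> = (\<Oplus>\<^bsub>R\<^esub>h\<in>?M. a (?x h))"
        using fin a x by (intro R.finsum_restrict_if) auto
      finally have sum: "(\<Oplus>\<^bsub>A\<^esub>h\<in>carrier G. c h \<otimes>\<^bsub>A\<^esub> single h) z = (\<Oplus>\<^bsub>R\<^esub>h\<in>?M. a (?x h))" .
      \<comment> \<open>The whole class is thus collected at its representative: the coefficient
        there is the class sum, and elsewhere it is an empty sum.\<close>
      show ?thesis
      proof (cases "rep z = z")
        case True
        have "bij_betw ?x ?M (conj_class G z)"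
        proof (rule bij_betw_byWitness[where f' = t])
          have tz: "t y \<in> carrier G \<and> ?x (t y) = y" if y: "y \<in> conj_class G z" for y
          proof -
            obtain h where h: "h \<in> carrier G" "y = ?x h" using y by (auto simp: conj_class_def)
            then have "rep y = z" using rep_conj[OF z] True by simp
            then show ?thesis using t[of y] h x by auto
          qed
          show "\<forall>y\<in>conj_class G z. ?x (t y) = y" using tz by blast
          show "t ` conj_class G z \<subseteq> ?M" using tz by auto
        qed (auto simp: conj_class_def)
        then have "(\<Oplus>\<^bsub>R\<^esub>y\<in>conj_class G z. a y) = (\<Oplus>\<^bsub>R\<^esub>h\<in>?M. a (?x h))"
          by (rule R.finsum_bij_betw) (use a z in \<open>auto simp: conj_class_def\<close>)
        then show ?thesis using K[OF z] z by (simp add: sum group_ring_zero)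
      next
        case False
        have M: "?M = {}"
        proof (rule ccontr)
          assume "?M \<noteq> {}"
          then obtain h where h: "h \<in> carrier G" "t (?x h) = h" by blast
          have "h \<otimes> rep z \<otimes> inv h = h \<otimes> z \<otimes> inv h"
            using t[OF x[OF h(1)]] h rep_conj[OF z h(1)] by simp
          then show False using False h(1) z rep_carrier[OF z] by simp
        qed
        show ?thesis unfolding sum M using z by (simp add: group_ring_zero)
      qed
    qed
    then show ?thesis using cl by (subst ncong_group_ring_iff) (auto intro!: A.finsum_closed)
  qed
  ultimately show ?thesis using c by blast
qed

end

section \<open>The congruence kernel\<close>

lemma (in ring) elementary_outside:
  assumes "x \<in> elementary R m" "k \<ge> m \<or> l \<ge> m"
  shows "x k l = id_mat R k l"
proof -
  interpret GL: pres_images "GL R" "st_gens R" "st_rels R" "elem_mat R" by (rule GL_images)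
  obtain w where w: "w \<in> words (bounded_gens R m)" "x = word_eval (GL R) (elem_mat R) w"
    using assms(1) by (auto simp: elementary_def)
  from w(1) have "\<forall>k l. k \<ge> m \<or> l \<ge> m \<longrightarrow> word_eval (GL R) (elem_mat R) w k l = id_mat R k l"
  proof (induction w)
    case Nil
    then show ?case by (simp add: GL_one)
  next
    case (Cons a w)
    obtain i j r b where a: "a = ((i, j, r), b)" by (metis surj_pair)
    have w: "w \<in> words (bounded_gens R m)" and ij: "i \<noteq> j" "i < m" "j < m" "r \<in> carrier R"
      using Cons.prems by (auto simp: a words_def bounded_gens_def)
    let ?X = "word_eval (GL R) (elem_mat R) w" and ?r = "if b then r else \<ominus> r"
    have ws: "w \<in> words (st_gens R)" using w bounded_words by blast
    have r: "?r \<in> carrier R" using ij by simp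
    have eX: "word_eval (GL R) (elem_mat R) (a # w) =
      (\<lambda>k l. if k = i then ?X i l \<oplus> ?r \<otimes> ?X j l else ?X k l)"
      unfolding a by (rule word_eval_GL_Cons[OF ij(1,4) ws])
    have IH: "?X k l = id_mat R k l" if "k \<ge> m \<or> l \<ge> m" for k l using Cons.IH[OF w] that by blast
    have rz: "?r \<otimes> \<zero> = \<zero>" using r by simp
    have zero: "?X k l = \<zero>" if "k < m" "l \<ge> m" for k l
      using IH[of k l] that by (simp add: id_mat_def)
    show ?case
      unfolding eX
    proof (intro allI impI)
      fix k l assume kl: "k \<ge> m \<or> l \<ge> m"
      show "(if k = i then ?X i l \<oplus> ?r \<otimes> ?X j l else ?X k l) = id_mat R k l"
      proof (cases "k = i")
        case True
        then have "l \<ge> m" using kl ij by simp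
        then have "?X i l = \<zero>" "?X j l = \<zero>" using ij zero by blast+
        then have "?X i l \<oplus> ?r \<otimes> ?X j l = \<zero>" by (simp only: rz l_zero zero_closed)
        then show ?thesis using True \<open>l \<ge> m\<close> ij by (simp only: if_True) (simp add: id_mat_def)
      next
        case False
        then show ?thesis using IH[OF kl] by simp
      qed
    qed
  qed
  then show ?thesis using w(2) assms(2) by blast
qed

context torsion_free_group_ring
begin

lemma group_ring_torsion_free:
  assumes "N > (0::nat)" "a \<in> carrier A" "[N] \<cdot>\<^bsub>A\<^esub> a = \<zero>\<^bsub>A\<^esub>"
  shows "a = \<zero>\<^bsub>A\<^esub>"
proof (rule group_ring_eqI[of _ R G])
  fix x assume x: "x \<in> carrier G"
  have "([N] \<cdot>\<^bsub>A\<^esub> a) x = \<zero>\<^bsub>A\<^esub> x" using assms(3) by simp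
  then have "[N] \<cdot>\<^bsub>R\<^esub> a x = \<zero>\<^bsub>R\<^esub>" using assms(2) x by (simp add: group_ring_add_pow group_ring_zero)
  then show "a x = \<zero>\<^bsub>A\<^esub> x" using torsion_free[OF assms(1)] assms(2) x by (simp add: group_ring_zero)
qed (use assms in auto)

text \<open>The class sums of the trace of \<open>V\<close> vanish modulo \<open>p\<close>. So
  \<open>class_decomposition\<close> writes this trace as the sum of the products
  \<open>h c_h\<close>, with the sum of the \<open>c_h h\<close> divisible by \<open>p\<close>,
  which is the input of \<open>factor_set_span\<close> for \<open>N = p\<close>.\<close>

lemma elementary_first_order:
  assumes p: "prime p" "k > 0" "p ^ k > (2::nat)" and m: "m > 1" and one: "\<one>\<^bsub>R\<^esub> \<noteq> \<zero>\<^bsub>R\<^esub>"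
    and x: "x \<in> elementary A m" and V: "V \<in> carrier A.Q"
    and xV: "x = \<one>\<^bsub>A.Q\<^esub> \<oplus>\<^bsub>A.Q\<^esub> [(p ^ k)] \<cdot>\<^bsub>A.Q\<^esub> V"
  shows "\<exists>d\<in>factor_set m (single ` carrier G) \<rightarrow> carrier A.
    ncong A.Q p V (\<Oplus>\<^bsub>A.Q\<^esub>s\<in>factor_set m (single ` carrier G). factor_lin A s (d s))"
proof -
  let ?H = "single ` carrier G"
  have pk: "p ^ k > 0" using prime_gt_0_nat[OF p(1)] by simp
  \<comment> \<open>Outside the \<open>m\<close> times \<open>m\<close> block \<open>x\<close> is
    the identity, so \<open>p ^ k V\<close> vanishes there, and by torsion-freeness \<open>V\<close>
    does as well.\<close>
  have out: "V i j = \<zero>\<^bsub>A\<^esub>" if "i \<ge> m \<or> j \<ge> m" for i j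
  proof -
    have I: "id_mat A i j \<in> carrier A" by (simp add: id_mat_def)
    have "id_mat A i j = id_mat A i j \<oplus>\<^bsub>A\<^esub> [(p ^ k)] \<cdot>\<^bsub>A\<^esub> V i j"
      using A.elementary_outside[OF x that] V unfolding xV
      by (simp only: A.rf_add A.rf_add_pow A.rf_one)
    then have "id_mat A i j \<oplus>\<^bsub>A\<^esub> [(p ^ k)] \<cdot>\<^bsub>A\<^esub> V i j = id_mat A i j \<oplus>\<^bsub>A\<^esub> \<zero>\<^bsub>A\<^esub>"
      using A.r_zero[OF I] by (simp only:)
    then have "[(p ^ k)] \<cdot>\<^bsub>A\<^esub> V i j = \<zero>\<^bsub>A\<^esub>"
      using I V A.add.l_cancel[of "id_mat A i j" "[(p ^ k)] \<cdot>\<^bsub>A\<^esub> V i j" "\<zero>\<^bsub>A\<^esub>"] by simp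
    then show ?thesis using group_ring_torsion_free[OF pk] V by simp
  qed
  let ?a = "\<Oplus>\<^bsub>A\<^esub>i\<in>{..<m}. V i i"
  have a: "?a \<in> carrier A" using V by (auto intro: A.finsum_closed)
  obtain c where c: "\<And>h. h \<in> carrier G \<Longrightarrow> c h \<in> carrier A"
    and ca: "(\<Oplus>\<^bsub>A\<^esub>h\<in>carrier G. single h \<otimes>\<^bsub>A\<^esub> c h) = ?a"
    and c0: "ncong A p (\<Oplus>\<^bsub>A\<^esub>h\<in>carrier G. c h \<otimes>\<^bsub>A\<^esub> single h) \<zero>\<^bsub>A\<^esub>"
    using class_decomposition[OF a elementary_class_trace[OF p x V xV]] by blast
  \<comment> \<open>Factors are indexed by elements of \<open>A\<close>, so the coefficients are
    carried over from \<open>G\<close> along \<open>single\<close>, which is injective because 1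
    differs from 0 in \<open>R\<close>.\<close>
  define c' where "c' h = (if h \<in> ?H then c (the_inv_into (carrier G) single h) else \<zero>\<^bsub>A\<^esub>)" for h
  have inj: "inj_on single (carrier G)" using one by (rule inj_single)
  have c's: "c' (single h) = c h" if "h \<in> carrier G" for h
    using that by (simp add: c'_def the_inv_into_f_f[OF inj])
  have c'c: "c' h \<in> carrier A" for h
    using c the_inv_into_f_f[OF inj] by (auto simp: c'_def)
  have "(\<Oplus>\<^bsub>A\<^esub>h\<in>?H. h \<otimes>\<^bsub>A\<^esub> c' h) = (\<Oplus>\<^bsub>A\<^esub>h\<in>carrier G. single h \<otimes>\<^bsub>A\<^esub> c' (single h))"
    using inj c'c by (intro A.finsum_reindex) auto
  also have "\<dots> = (\<Oplus>\<^bsub>A\<^esub>h\<in>carrier G. single h \<otimes>\<^bsub>A\<^esub> c h)"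
    using c c's by (intro A.finsum_cong') auto
  finally have left: "(\<Oplus>\<^bsub>A\<^esub>h\<in>?H. h \<otimes>\<^bsub>A\<^esub> c' h) = ?a" using ca by simp
  have "(\<Oplus>\<^bsub>A\<^esub>h\<in>?H. c' h \<otimes>\<^bsub>A\<^esub> h) = (\<Oplus>\<^bsub>A\<^esub>h\<in>carrier G. c' (single h) \<otimes>\<^bsub>A\<^esub> single h)"
    using inj c'c by (intro A.finsum_reindex) auto
  also have "\<dots> = (\<Oplus>\<^bsub>A\<^esub>h\<in>carrier G. c h \<otimes>\<^bsub>A\<^esub> single h)"
    using c c's by (intro A.finsum_cong') auto
  finally have right: "ncong A p (\<Oplus>\<^bsub>A\<^esub>h\<in>?H. c' h \<otimes>\<^bsub>A\<^esub> h) \<zero>\<^bsub>A\<^esub>" using c0 by simp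
  have Vc: "V i j \<in> carrier A" for i j using V by simp
  have H: "finite ?H" "?H \<subseteq> carrier A" "\<one>\<^bsub>A\<^esub> \<in> ?H"
    using fin by (auto simp: single_one[symmetric])
  show ?thesis
    by (rule A.factor_set_span[where c = c']) (fact H m Vc out c'c left right)+
qed

text \<open>The iteration yields \<open>u\<close> as an exact product of factors. Each factor is
  relative elementary because \<open>f\<close> kills multiples of \<open>p ^ n\<close>, and relative
  elementary matrices are closed under products.\<close>

theorem congruence_kernel:
  fixes f :: "('g \<Rightarrow> 'a) \<Rightarrow> 'e"
  assumes p: "prime p" "n > 0" "p ^ n > (2::nat)" and m: "m > 1" and one: "\<one>\<^bsub>R\<^esub> \<noteq> \<zero>\<^bsub>R\<^esub>"
    and complete: "\<And>x. (\<And>k. x k \<in> carrier A) \<Longrightarrow> (\<And>k. ncong A (p ^ k) (x (Suc k)) (x k)) \<Longrightarrow>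
      \<exists>y\<in>carrier A. \<forall>k. ncong A (p ^ k) y (x k)"
    and separated: "\<And>x y. x \<in> carrier A \<Longrightarrow> y \<in> carrier A \<Longrightarrow> (\<And>k. ncong A (p ^ k) x y) \<Longrightarrow> x = y"
    and S: "ring S" and f: "f \<in> ring_hom A S"
    and f_ker: "\<And>a. a \<in> carrier A \<Longrightarrow> f ([(p ^ n)] \<cdot>\<^bsub>A\<^esub> a) = \<zero>\<^bsub>S\<^esub>"
    and u: "u \<in> elementary A m" and u1: "ncong A.Q (p ^ n) u \<one>\<^bsub>A.Q\<^esub>"
  shows "u \<in> relative_elementary A S f m"
proof -
  interpret Q: ring A.Q by (rule A.ring_rf)
  let ?H = "single ` carrier G"
  have H: "?H \<subseteq> carrier A" "finite ?H" using fin by auto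
  obtain L where L: "set L = factor_set m ?H" "distinct L"
    using finite_distinct_list[OF finite_factor_set[OF H(2)]] by blast
  interpret approximation A A.Q p n L "factor_lin A"
  proof (intro approximation.intro approximation_axioms.intro)
    fix s x y assume s: "s \<in> set L" and x: "x \<in> carrier A"
    show "factor_lin A s x \<in> carrier A.Q"
      using A.factor_lin_closed[OF H(1)] s x unfolding L(1) by blast
    assume y: "y \<in> carrier A"
    show "factor_lin A s (x \<oplus>\<^bsub>A\<^esub> y) = factor_lin A s x \<oplus>\<^bsub>A.Q\<^esub> factor_lin A s y"
      using A.factor_lin_add[OF H(1)] s x y unfolding L(1) by blast
  qed (use p L A.ring_axioms Q.ring_axioms in auto)
  have fc: "f \<in> carrier A \<rightarrow> carrier S" using f by (auto simp: ring_hom_closed)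
  have rel: "set M \<subseteq> set L \<Longrightarrow> b \<in> set L \<rightarrow> carrier A \<Longrightarrow> prod_of M b \<in> relative_elementary A S f m" for M b
  proof (induction M)
    case Nil
    then show ?case by (simp add: prod_of_def A.rf_one A.relative_elementary_one)
  next
    case (Cons s M)
    have s: "s \<in> factor_set m ?H" "b s \<in> carrier A" using Cons.prems L by auto
    have "\<one>\<^bsub>A.Q\<^esub> \<oplus>\<^bsub>A.Q\<^esub> factor_lin A s ([(p ^ n)] \<cdot>\<^bsub>A\<^esub> b s) \<in> relative_elementary A S f m"
      using s f_ker by (intro A.factor_relative_elementary[OF S f H(1)]) auto
    from A.relative_elementary_mult[OF fc this Cons.IH] show ?case
      using Cons.prems by (simp add: prod_of_def)
  qed
  have uQ: "u \<in> carrier A.Q" by (rule A.elementary_rf[OF u])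
  have "\<exists>b\<in>set L \<rightarrow> carrier A. prod_of L b = u"
  proof (rule successive_approximation[OF uQ u1 complete])
    fix X Y assume X: "X \<in> carrier A.Q" and Y: "Y \<in> carrier A.Q" and XY: "\<And>k. ncong A.Q (p ^ k) X Y"
    show "X = Y"
    proof (intro ext)
      fix i j
      \<comment> \<open>The entries are themselves functions on the group, so \<open>ext\<close>
        asks for equality at every \<open>x\<close>; it is derived from the equality of
        entries.\<close>
      have "X i j = Y i j"
      proof (rule separated)
        fix k
        obtain Z where Z: "Z \<in> carrier A.Q" "X = Y \<oplus>\<^bsub>A.Q\<^esub> [(p ^ k)] \<cdot>\<^bsub>A.Q\<^esub> Z"
          using XY[of k] by (rule Q.ncongE)
        then have "X i j = Y i j \<oplus>\<^bsub>A\<^esub> [(p ^ k)] \<cdot>\<^bsub>A\<^esub> Z i j" by (simp only: A.rf_add A.rf_add_pow)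
        then show "ncong A (p ^ k) (X i j) (Y i j)" by (rule A.ncongI[rotated]) (use Z in simp)
      qed (use X Y in auto)
      then show "X i j x = Y i j x" for x by simp
    qed
  next
    fix b k assume b: "b \<in> set L \<rightarrow> carrier A" and ub: "ncong A.Q (p ^ (n + k)) u (prod_of L b)"
    let ?W = "prod_of L b"
    have W: "?W \<in> elementary A m" using rel[OF subset_refl b] A.relative_elementary_elementary by blast
    have WQ: "?W \<in> carrier A.Q" by (rule A.elementary_rf[OF W])
    \<comment> \<open>Multiplying by the inverse \<open>W'\<close> of \<open>?W\<close> brings the
      error into the form \<open>1 + p ^ (n + k) V\<close> with \<open>V = W' Y\<close>. The trace
      condition is known for elementary matrices, and \<open>W' u\<close> is one.\<close>
    obtain W' where W': "W' \<in> elementary A m" "W' \<otimes>\<^bsub>A.Q\<^esub> ?W = \<one>\<^bsub>A.Q\<^esub>"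
      using A.elementary_inv[OF W] unfolding A.rf_one by blast
    have W'Q: "W' \<in> carrier A.Q" by (rule A.elementary_rf[OF W'(1)])
    obtain Y where Y: "Y \<in> carrier A.Q" "u = ?W \<oplus>\<^bsub>A.Q\<^esub> [(p ^ (n + k))] \<cdot>\<^bsub>A.Q\<^esub> Y"
      using ub by (rule Q.ncongE)
    have "W' \<otimes>\<^bsub>A.Q\<^esub> u = \<one>\<^bsub>A.Q\<^esub> \<oplus>\<^bsub>A.Q\<^esub> [(p ^ (n + k))] \<cdot>\<^bsub>A.Q\<^esub> (W' \<otimes>\<^bsub>A.Q\<^esub> Y)"
      using Y WQ W'Q W'(2) by (simp add: Q.r_distr Q.add_pow_rdistr)
    moreover have "p ^ (n + k) > 2"
      using p(3) power_increasing[of n "n + k" p] prime_ge_1_nat[OF p(1)] by linarith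
    ultimately obtain d where d: "d \<in> factor_set m ?H \<rightarrow> carrier A"
      and Vd: "ncong A.Q p (W' \<otimes>\<^bsub>A.Q\<^esub> Y) (\<Oplus>\<^bsub>A.Q\<^esub>s\<in>factor_set m ?H. factor_lin A s (d s))"
      using elementary_first_order[OF p(1) _ _ m one A.elementary_mult[OF W'(1) u], of "n + k" "W' \<otimes>\<^bsub>A.Q\<^esub> Y"]
        p(2) W'Q Y(1) by auto
    have pn: "p dvd p ^ n" using p(2) by (simp add: dvd_power)
    \<comment> \<open>The step has to approximate \<open>Y\<close> instead of \<open>W' Y\<close>.
      As \<open>?W\<close>, and therefore \<open>W'\<close>, is 1 modulo \<open>p\<close>, the two
      agree to the precision that is needed.\<close>
    have W1: "ncong A.Q p ?W \<one>\<^bsub>A.Q\<^esub>"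
      by (rule Q.ncong_dvd[OF prod_of_ncong_one[OF subset_refl b] pn])
    have "ncong A.Q p (W' \<otimes>\<^bsub>A.Q\<^esub> ?W) (W' \<otimes>\<^bsub>A.Q\<^esub> \<one>\<^bsub>A.Q\<^esub>)"
      using W1 W'Q by (intro Q.ncong_mult) auto
    then have "ncong A.Q p \<one>\<^bsub>A.Q\<^esub> W'" using W'Q W'(2) by simp
    then have "ncong A.Q p (\<one>\<^bsub>A.Q\<^esub> \<otimes>\<^bsub>A.Q\<^esub> Y) (W' \<otimes>\<^bsub>A.Q\<^esub> Y)"
      using W'Q Y(1) by (intro Q.ncong_mult) auto
    then have "ncong A.Q p Y (W' \<otimes>\<^bsub>A.Q\<^esub> Y)" using Y(1) by simp
    moreover have "(\<Oplus>\<^bsub>A.Q\<^esub>s\<in>factor_set m ?H. factor_lin A s (d s)) \<in> carrier A.Q"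
      using d A.factor_lin_closed[OF H(1)] by (auto intro!: Q.finsum_closed)
    ultimately have "ncong A.Q p Y (\<Oplus>\<^bsub>A.Q\<^esub>s\<in>factor_set m ?H. factor_lin A s (d s))"
      using Vd Q.ncong_trans by blast
    then show "\<exists>d Y. d \<in> set L \<rightarrow> carrier A \<and> Y \<in> carrier A.Q \<and>
        u = ?W \<oplus>\<^bsub>A.Q\<^esub> [(p ^ (n + k))] \<cdot>\<^bsub>A.Q\<^esub> Y \<and> ncong A.Q p Y (\<Oplus>\<^bsub>A.Q\<^esub>s\<in>set L. factor_lin A s (d s))"
      using d Y unfolding L(1) by blast
  qed
  then show ?thesis using rel[OF subset_refl] by blast
qed

end

text \<open>The matrix of a lift reduces to the identity, which is the congruence modulo
  \<open>p ^ n\<close> that \<open>congruence_kernel\<close> starts from; completeness passes from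
  \<open>R\<close> to \<open>R[G]\<close> coefficient by coefficient. The word behind the relative
  elementary matrix is the element \<open>z\<close> of \<open>K2_map_surjI\<close>.\<close>

theorem theorem1p3:
  fixes R :: "('a, 'b) ring_scheme" and G :: "('g, 'c) monoid_scheme" and p n :: nat
  assumes "prime p"
    and "noetherian_domain R"
    and "p_adically_complete p R"
    and "krull_dim R < \<infinity>"
    and "ring_char (frac_field R) = 0"
    and "group G" and "finite (carrier G)"
    and "n > 0" and "p ^ n > 2"
  shows "K2_map (group_ring R G) (group_ring (p_quot R p n) G) (group_ring_map G (p_proj R p n))
      ` carrier (K2 (group_ring R G)) = carrier (K2 (group_ring (p_quot R p n) G))"
proof -
  interpret R: domain R using assms(2) by (rule noetherian_domain.axioms)
  interpret G: group G by fact
  interpret T: torsion_free_group_ring R G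
    by unfold_locales (use assms(7) R.torsion_free_of_ring_char[OF assms(5)] in auto)
  let ?S = "p_quot R p n" and ?f = "group_ring_map G (p_proj R p n)"
  interpret S: cring ?S by (rule R.cring_p_quot)
  interpret SG: finite_group_ring ?S G by unfold_locales fact
  have f: "?f \<in> ring_hom T.A SG.A"
    by (rule group_ring_map_hom[OF R.cring_axioms S.cring_axioms assms(6,7) R.p_proj_hom])
  have ker: "ncong T.A (p ^ n) a b" if "a \<in> carrier T.A" "b \<in> carrier T.A" "?f a = ?f b" for a b
  proof -
    have "ncong R (p ^ n) (a x) (b x)" if "x \<in> carrier G" for x
    proof -
      have "p_proj R p n (a x) = p_proj R p n (b x)"
        using fun_cong[OF \<open>?f a = ?f b\<close>, of x] that by (simp add: group_ring_map_def)
      then show ?thesis using R.p_proj_eq_iff[of "a x" "b x"] that \<open>a \<in> carrier T.A\<close> \<open>b \<in> carrier T.A\<close> by simp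
    qed
    then show ?thesis using that T.ncong_group_ring_iff by blast
  qed
  have zero: "?f ([(p ^ n)] \<cdot>\<^bsub>T.A\<^esub> a) = \<zero>\<^bsub>SG.A\<^esub>" if a: "a \<in> carrier T.A" for a
  proof -
    have "?f ([(p ^ n)] \<cdot>\<^bsub>T.A\<^esub> a) = ?f \<zero>\<^bsub>T.A\<^esub>"
    proof
      fix x
      show "?f ([(p ^ n)] \<cdot>\<^bsub>T.A\<^esub> a) x = ?f \<zero>\<^bsub>T.A\<^esub> x"
      proof (cases "x \<in> carrier G")
        case True
        have "ncong R (p ^ n) ([(p ^ n)] \<cdot>\<^bsub>R\<^esub> a x) \<zero>\<^bsub>R\<^esub>"
          using a True by (intro R.ncongI[of "a x"]) auto
        then show ?thesis using a True
          by (simp add: group_ring_map_def T.group_ring_add_pow group_ring_zero R.p_proj_eq_iff)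
      qed (simp add: group_ring_map_def)
    qed
    then show ?thesis using ring_hom_zero[OF f T.ring_group_ring SG.ring_group_ring] by simp
  qed
  show ?thesis
  proof (rule K2_map_surjI[OF T.ring_group_ring SG.ring_group_ring f])
    show "?f ` carrier T.A = carrier SG.A"
      by (rule group_ring_map_surj) (simp add: R.p_quot_carrier)
  next
    fix y assume y: "y \<in> carrier (Steinberg T.A)" and fy: "\<And>i j. ?f (st_to_GL T.A y i j) = id_mat SG.A i j"
    obtain w where w: "w \<in> words (st_gens T.A)" "y = pres_class (st_gens T.A) (st_rels T.A) w"
      using y by (auto simp: Steinberg_def presented_carrier)
    obtain m where m: "m > 1" "w \<in> words (bounded_gens T.A m)" using words_bounded[OF w(1)] .
    define u where "u = st_to_GL T.A y"
    have u: "u \<in> elementary T.A m"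
      using w(2) m(2) st_to_GL_class[OF T.ring_group_ring w(1)] by (simp add: u_def elementary_def)
    have uQ: "u \<in> carrier T.A.Q" by (rule T.A.elementary_rf[OF u])
    \<comment> \<open>The quotient by \<open>p ^ n\<close> is chosen to be 0 wherever
      \<open>u\<close> agrees with the identity. Since this is the case outside the first
      \<open>m\<close> columns, \<open>V\<close> is row finite, as membership in the matrix ring
      demands.\<close>
    have "\<exists>z. z \<in> carrier T.A \<and> u i j = id_mat T.A i j \<oplus>\<^bsub>T.A\<^esub> [(p ^ n)] \<cdot>\<^bsub>T.A\<^esub> z \<and>
        (u i j = id_mat T.A i j \<longrightarrow> z = \<zero>\<^bsub>T.A\<^esub>)" for i j
    proof (cases "u i j = id_mat T.A i j")
      case True
      then show ?thesis by (intro exI[of _ "\<zero>\<^bsub>T.A\<^esub>"]) (simp add: id_mat_def)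
    next
      case False
      have "?f (id_mat T.A i j) = id_mat SG.A i j"
        by (simp add: id_mat_def ring_hom_one[OF f] ring_hom_zero[OF f T.ring_group_ring SG.ring_group_ring])
      then have "ncong T.A (p ^ n) (u i j) (id_mat T.A i j)"
        using uQ fy[of i j] by (intro ker) (auto simp: u_def id_mat_def)
      then show ?thesis using False by (auto simp: ncong_def)
    qed
    then obtain V where V: "\<And>i j. V i j \<in> carrier T.A"
      "\<And>i j. u i j = id_mat T.A i j \<oplus>\<^bsub>T.A\<^esub> [(p ^ n)] \<cdot>\<^bsub>T.A\<^esub> V i j"
      "\<And>i j. u i j = id_mat T.A i j \<Longrightarrow> V i j = \<zero>\<^bsub>T.A\<^esub>" by metis
    have VQ: "V \<in> carrier T.A.Q"
    proof (rule T.A.rf_carrierI[OF V(1)])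
      fix i
      have "{j. V i j \<noteq> \<zero>\<^bsub>T.A\<^esub>} \<subseteq> {..<m}"
      proof
        fix j assume "j \<in> {j. V i j \<noteq> \<zero>\<^bsub>T.A\<^esub>}"
        then have "u i j \<noteq> id_mat T.A i j" using V(3) by auto
        then show "j \<in> {..<m}" using T.A.elementary_outside[OF u, of i j] by (meson lessThan_iff not_less)
      qed
      then show "finite {j. V i j \<noteq> \<zero>\<^bsub>T.A\<^esub>}" by (rule finite_subset) simp
    qed
    have u1: "ncong T.A.Q (p ^ n) u \<one>\<^bsub>T.A.Q\<^esub>"
    proof (rule ring.ncongI[OF T.A.ring_rf VQ])
      show "u = \<one>\<^bsub>T.A.Q\<^esub> \<oplus>\<^bsub>T.A.Q\<^esub> [(p ^ n)] \<cdot>\<^bsub>T.A.Q\<^esub> V"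
      proof (rule ext, rule ext)
        fix i j
        show "u i j = (\<one>\<^bsub>T.A.Q\<^esub> \<oplus>\<^bsub>T.A.Q\<^esub> [(p ^ n)] \<cdot>\<^bsub>T.A.Q\<^esub> V) i j"
          using V(2)[of i j] VQ by (simp only: T.A.rf_add T.A.rf_add_pow T.A.rf_one)
      qed
    qed
    have "u \<in> relative_elementary T.A SG.A ?f m"
    proof (rule T.congruence_kernel[OF assms(1,8,9) m(1) _ _ _ SG.ring_group_ring f zero u u1])
      fix x assume x: "\<And>k. x k \<in> carrier T.A" "\<And>k. ncong T.A (p ^ k) (x (Suc k)) (x k)"
      have "\<exists>y\<in>carrier R. \<forall>k. ncong R (p ^ k) y (x k g)" if "g \<in> carrier G" for g
      proof (rule R.p_adic_limit[OF assms(3)])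
        show "ncong R (p ^ k) (x (Suc k) g) (x k g)" for k
          using x(2)[of k] T.ncong_group_ring_iff[OF x(1) x(1)] that by blast
      qed (use x(1) that in auto)
      then obtain y where y: "\<And>g. g \<in> carrier G \<Longrightarrow> y g \<in> carrier R"
        "\<And>g k. g \<in> carrier G \<Longrightarrow> ncong R (p ^ k) (y g) (x k g)" by metis
      have yA: "restrict y (carrier G) \<in> carrier T.A" using y(1) by (simp add: group_ring_carrier)
      have "ncong T.A (p ^ k) (restrict y (carrier G)) (x k)" for k
        unfolding T.ncong_group_ring_iff[OF yA x(1)] using y(2) by simp
      then show "\<exists>y\<in>carrier T.A. \<forall>k. ncong T.A (p ^ k) y (x k)" using yA by blast
    next
      fix a b assume a: "a \<in> carrier T.A" and b: "b \<in> carrier T.A" and ab: "\<And>k. ncong T.A (p ^ k) a b"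
      show "a = b"
      proof (rule group_ring_eqI[OF a b])
        fix g assume g: "g \<in> carrier G"
        have "ncong R (p ^ k) (a g) (b g)" for k
          using ab[of k] T.ncong_group_ring_iff[OF a b] g by blast
        then show "a g = b g" using a b g by (intro R.p_adic_separated[OF assms(3)]) auto
      qed
    qed simp
    then obtain v where v: "v \<in> words (bounded_gens T.A m)" "u = word_eval (GL T.A) (elem_mat T.A) v"
      "pres_class (st_gens SG.A) (st_rels SG.A) (wmap ?f v) = \<one>\<^bsub>Steinberg SG.A\<^esub>"
      unfolding relative_elementary_def by blast
    have vs: "v \<in> words (st_gens T.A)" using v(1) bounded_words by blast
    let ?z = "pres_class (st_gens T.A) (st_rels T.A) v"
    have "?z \<in> carrier (Steinberg T.A)" using vs by (auto simp: Steinberg_def presented_carrier)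
    moreover have "st_to_GL T.A ?z = st_to_GL T.A y"
      using st_to_GL_class[OF T.ring_group_ring vs] v(2) by (simp add: u_def)
    moreover have "st_map SG.A ?f ?z = \<one>\<^bsub>Steinberg SG.A\<^esub>"
      using st_map_class[OF f vs] v(3) by simp
    ultimately show "\<exists>z\<in>carrier (Steinberg T.A). st_to_GL T.A z = st_to_GL T.A y \<and>
        st_map SG.A ?f z = \<one>\<^bsub>Steinberg SG.A\<^esub>" by blast
  qed
qed

end
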